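(* Let $n\ge1$, let $(\phi,\mathbf u,p,U,W)^n$ and $(\phi,\mathbf u)^{n-1}$ be given, and let $\phi^{n+1},\mu^{n+\frac12},\widetilde{\mathbf u}^{n+1},U^{n+1},W^{n+1},\mathbf u^{n+1},p^{n+1}$ be produced by the following (Crank–Nicolson) scheme with time step $\delta t>0$. Step 1: in $\Omega$, $$\frac{\phi^{n+1}-\phi^n}{\delta t}+\nabla\cdot(\widetilde{\mathbf u}^{n+\frac12}\phi_\star^{n+\frac12})=M\Delta\mu^{n+\frac12},$$ $$\mu^{n+\frac12}=\lambda\Big(-\varepsilon\Delta\phi^{n+\frac12}+\frac1\varepsilon\phi_\star^{n+\frac12}U^{n+\frac12}\Big),$$ $$U^{n+1}-U^n=2\phi_\star^{n+\frac12}(\phi^{n+1}-\phi^n),$$ $$\frac{\widetilde{\mathbf u}^{n+1}-\mathbf u^n}{\delta t}+B(\mathbf u_\star^{n+\frac12},\widetilde{\mathbf u}^{n+\frac12})-\nu\Delta\widetilde{\mathbf u}^{n+\frac12}+\nabla p^n+\phi_\star^{n+\frac12}\nabla\mu^{n+\frac12}=0,$$ with, on $\Gamma$, $$\widetilde{\mathbf u}^{n+1}\cdot\mathbf n=0,\qquad \nu\partial_{\mathbf n}\widetilde{\mathbf u}_\tau^{n+\frac12}=-\nu\ell(\phi_\star^{n+\frac12})(\widetilde{\mathbf u}^{n+\frac12}-\mathbf u_w)-\frac\lambda\gamma\dot\phi^{n+\frac12}\nabla_\tau\phi_\star^{n+\frac12},$$ $$\partial_{\mathbf n}\mu^{n+\frac12}=0,\qquad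 \varepsilon\partial_{\mathbf n}\phi^{n+\frac12}=-\frac1\gamma\dot\phi^{n+\frac12}-Z(\phi_\star^{n+\frac12})W^{n+\frac12},$$ $$W^{n+1}-W^n=\frac12Z(\phi_\star^{n+\frac12})(\phi^{n+1}-\phi^n),$$ where $\widetilde{\mathbf u}^{n+\frac12}=\frac{\widetilde{\mathbf u}^{n+1}+\mathbf u^n}{2}$ and $\dot\phi^{n+\frac12}=\frac{\phi^{n+1}-\phi^n}{\delta t}+\widetilde{\mathbf u}_\tau^{n+\frac12}\cdot\nabla_\tau\phi_\star^{n+\frac12}$. Step 2: $$\frac{\mathbf u^{n+1}-\widetilde{\mathbf u}^{n+1}}{\delta t}+\nabla\Big(\frac{p^{n+1}-p^n}{2}\Big)=0,\quad \nabla\cdot\mathbf u^{n+1}=0\ \text{ in }\Omega,\qquad \mathbf u^{n+1}\cdot\mathbf n=0\ \text{ on }\Gamma.$$ Then the scheme is unconditionally energy stable, in the sense that (for every $\delta t>0$) the following discrete energy dissipation law holds: $$E_{cn}^{n+1}=E_{cn}^n-M\delta t\|\nabla\mu^{n+\frac12}\|^2-\nu\delta t\|\nabla\widetilde{\mathbf u}^{n+\frac12}\|^2-\frac{\lambda\delta t}{\gamma}\|\dot\phi^{n+\frac12}\|_\Gamma^2-\nu\delta t\big\|\ell(\phi_\star^{n+\frac12})^{\frac12}\widetilde{\mathbf u}_s^{n+\frac12}\big\|_\Gamma^2-\nu\delta t\big(\ell(\phi_\star^{n+\frac12})\widetilde{\mathbf u}_s^{n+\frac12},\mathbf u_w\big)_\Gamma,$$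 where $\widetilde{\mathbf u}_s^{n+\frac12}=\widetilde{\mathbf u}^{n+\frac12}-\mathbf u_w$ and $$E_{cn}^n=E(\mathbf u^n,\phi^n,U^n,W^n)+\frac{\delta t^2}{8}\|\nabla p^n\|^2 .$$
   Context: $\Omega\subset\mathbb R^d$ ($d=2,3$) is a bounded domain with boundary $\Gamma$ and outward unit normal $\mathbf n$. $M,\lambda,\varepsilon,\nu,\gamma>0$ are constants, $\ell(\cdot)\ge0$ is a given coefficient function, $\mathbf u_w$ is the given wall velocity on $\Gamma$ (independent of $n$), $\theta_s$ is a given angle. $\phi,\mu,p,U$ are scalar functions on $\Omega$, $\mathbf u,\widetilde{\mathbf u}$ vector fields on $\Omega$, $W$ a scalar function on $\Gamma$. Notation: for a sequence $S^n$, $S^{n+\frac12}=\frac{S^{n+1}+S^n}{2}$ (for $\phi,U,W$; $\mu^{n+\frac12}$ is itself an unknown of the scheme) and $S_\star^{n+\frac12}=\frac32S^n-\frac12S^{n-1}$. $(\cdot,\cdot),\|\cdot\|$ and $(\cdot,\cdot)_\Gamma,\|\cdot\|_\Gamma$ are the $L^2(\Omega)$ and $L^2(\Gamma)$ inner products and norms. $B(\mathbf a,\mathbf b)=(\mathbf a\cdot\nabla)\mathbf b+\frac12(\nabla\cdot\mathbf a)\mathbf b$. $\nabla_\tau=\nabla-(\mathbf n\cdot\nabla)\mathbf n$ is the tangential gradient on $\Gamma$; a subscript $\tau$ on a vector denotes its tangential part on $\Gamma$, and $\partial_{\mathbf n}\mathbf v_\tau$ denotes the tangential part of $\partial_{\mathbf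 n}\mathbf v$. $G(\phi)=-\frac{\sqrt2}{3}\cos\theta_s\sin(\frac\pi2\phi)$, $g=G'$, $C$ is a constant such that $G+C$ is positive (e.g. $C=\frac{\sqrt2}3+\eta$, $\eta>0$), $Z(\phi)=g(\phi)/\sqrt{G(\phi)+C}$. The energy functional is $$E(\mathbf u,\phi,U,W)=\int_\Omega\Big(\frac12|\mathbf u|^2+\lambda\Big(\frac\varepsilon2|\nabla\phi|^2+\frac1{4\varepsilon}U^2\Big)\Big)d\mathbf x+\lambda\int_\Gamma W^2ds-\lambda C|\Gamma|.$$ Standing assumptions: all functions are sufficiently smooth for the equations and the integrations by parts to make sense, and the previous velocities satisfy $\nabla\cdot\mathbf u^{k}=0$ in $\Omega$ and $\mathbf u^k\cdot\mathbf n=0$ on $\Gamma$ for $k=n-1,n$ (as they are outputs of Step 2 or admissible starting data). *)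

theory Defs
  imports "HOL-Analysis.Analysis"
begin

section \<open>Lipschitz domains, outward unit normal, surface measure\<close>

text \<open>
  Graph coordinates without a type of dimension \<open>d - 1\<close>: a function on the hyperplane orthogonal
  to the unit vector \<open>e\<close> is represented by a function \<open>g\<close> on the whole space that is constant
  along \<open>e\<close>. Inside the open set \<open>V\<close>, the set \<open>\<Omega>\<close> is the part below the graph of \<open>g\<close>.
  The last conjunct excludes nothing: by Rademacher's theorem it follows from the Lipschitz
  condition. It is spelled out because that theorem is not available in HOL-Analysis.
\<close>

definition lipschitz_chart ::
  "(real^'d) set \<Rightarrow> (real^'d) set \<Rightarrow> real^'d \<Rightarrow> (real^'d \<Rightarrow> real) \<Rightarrow> bool" where
  "lipschitz_chart \<Omega> V e g \<longleftrightarrow>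
     open V \<and> norm e = 1 \<and>
     (\<forall>x t. g (x + t *\<^sub>R e) = g x) \<and>
     (\<forall>x\<in>V. x \<in> \<Omega> \<longleftrightarrow> x \<bullet> e < g x) \<and>
     (\<exists>L. L-lipschitz_on UNIV g) \<and>
     negligible {x. \<not> g differentiable (at x)}"

definition bounded_lipschitz_domain :: "(real^'d) set \<Rightarrow> bool" where
  "bounded_lipschitz_domain \<Omega> \<longleftrightarrow>
     open \<Omega> \<and> connected \<Omega> \<and> \<Omega> \<noteq> {} \<and> bounded \<Omega> \<and>
     (\<forall>x\<in>frontier \<Omega>. \<exists>V e g. x \<in> V \<and> lipschitz_chart \<Omega> V e g)"

text \<open>
  \<open>\<nu>\<close> is the outward unit normal at the boundary point \<open>x\<close> if, near \<open>x\<close>, the set \<open>\<Omega>\<close> agrees with the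
  half space \<open>(y - x) \<bullet> \<nu> < 0\<close> up to arbitrarily thin cones around its boundary hyperplane. For a
  \<open>C\<^sup>1\<close> boundary such a \<open>\<nu>\<close> exists at every boundary point; for a Lipschitz boundary it exists at
  almost every one.
\<close>

definition is_outward_normal :: "(real^'d) set \<Rightarrow> real^'d \<Rightarrow> real^'d \<Rightarrow> bool" where
  "is_outward_normal \<Omega> x \<nu> \<longleftrightarrow> norm \<nu> = 1 \<and>
     (\<forall>c>0. \<exists>r>0. \<forall>y\<in>ball x r.
        ((y - x) \<bullet> \<nu> < - c * norm (y - x) \<longrightarrow> y \<in> \<Omega>) \<and>
        ((y - x) \<bullet> \<nu> > c * norm (y - x) \<longrightarrow> y \<notin> \<Omega>))"

definition outward_normal :: "(real^'d) set \<Rightarrow> real^'d \<Rightarrow> real^'d" where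
  "outward_normal \<Omega> x = (THE \<nu>. is_outward_normal \<Omega> x \<nu>)"

lemma is_outward_normal_unique:
  assumes "is_outward_normal \<Omega> x \<nu>" and "is_outward_normal \<Omega> x \<nu>'"
  shows "\<nu> = \<nu>'"
proof (rule ccontr)
  assume ne: "\<nu> \<noteq> \<nu>'"
  have n1: "\<nu> \<bullet> \<nu> = 1" "\<nu>' \<bullet> \<nu>' = 1"
    using assms by (auto simp: is_outward_normal_def dot_square_norm)
  define w where "w = \<nu> - \<nu>'"
  define a where "a = 1 - \<nu> \<bullet> \<nu>'"
  have ww: "w \<bullet> w = 2 * a"
    by (simp add: w_def a_def inner_diff_left inner_diff_right n1 inner_commute)
  have "w \<bullet> w > 0" using ne by (simp add: w_def)
  then have a: "a > 0" using ww by simp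
  have w1: "w \<bullet> \<nu> = a" "w \<bullet> \<nu>' = - a"
    by (simp_all add: w_def a_def inner_diff_left n1 inner_commute[of \<nu>' \<nu>])
  have nw: "norm w > 0" using ne by (simp add: w_def)
  define c where "c = a / (2 * norm w)"
  have c: "c > 0" and cw: "c * norm w < a" using a nw by (auto simp: c_def)
  obtain r where r: "r > 0" "\<And>y. y \<in> ball x r \<Longrightarrow> (y - x) \<bullet> \<nu> > c * norm (y - x) \<Longrightarrow> y \<notin> \<Omega>"
    using assms(1) c unfolding is_outward_normal_def by blast
  obtain r' where r': "r' > 0"
      "\<And>y. y \<in> ball x r' \<Longrightarrow> (y - x) \<bullet> \<nu>' < - c * norm (y - x) \<Longrightarrow> y \<in> \<Omega>"
    using assms(2) c unfolding is_outward_normal_def by blast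
  define t where "t = min r r' / (2 * norm w)"
  have t: "t > 0" using r(1) r'(1) nw by (simp add: t_def)
  define y where "y = x + t *\<^sub>R w"
  have yx: "y - x = t *\<^sub>R w" "norm (y - x) = t * norm w" using t by (simp_all add: y_def)
  have "t * norm w = min r r' / 2" using nw by (simp add: t_def)
  then have ball: "y \<in> ball x r" "y \<in> ball x r'"
    using r(1) r'(1) yx(2) by (auto simp: dist_norm norm_minus_commute)
  have k: "c * (t * norm w) < t * a" using mult_strict_left_mono[OF cw t] by (simp add: ac_simps)
  have "y \<notin> \<Omega>" using r(2)[OF ball(1)] k t by (simp add: yx w1)
  moreover have "y \<in> \<Omega>" using r'(2)[OF ball(2)] k t by (simp add: yx w1)
  ultimately show False by simp
qed

section \<open>Derivatives on the closed domain\<close>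

text \<open>
  All derivatives are taken within the closure of \<open>\<Omega>\<close>: at a point of the open set \<open>\<Omega>\<close> this is the
  ordinary derivative (see below); at a boundary point it is the one-sided derivative, i.e. the
  boundary value of the derivative of a function that is \<open>C\<^sup>1\<close> up to the boundary.
\<close>

definition deriv_cl ::
  "(real^'d) set \<Rightarrow> (real^'d \<Rightarrow> 'b::real_normed_vector) \<Rightarrow> real^'d \<Rightarrow> real^'d \<Rightarrow> 'b" where
  "deriv_cl \<Omega> f x = frechet_derivative f (at x within closure \<Omega>)"

lemma deriv_cl_interior:
  assumes "open \<Omega>" and "x \<in> \<Omega>"
  shows "deriv_cl \<Omega> f x = frechet_derivative f (at x)"
proof -
  have "x \<in> interior (closure \<Omega>)"
    using interior_maximal[OF closure_subset assms(1)] assms(2) by (rule subsetD)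
  then have "at x within closure \<Omega> = at x" by (rule at_within_interior)
  then show ?thesis by (simp add: deriv_cl_def)
qed

definition pderiv_cl :: "(real^'d) set \<Rightarrow> 'd \<Rightarrow> (real^'d \<Rightarrow> real) \<Rightarrow> real^'d \<Rightarrow> real" where
  "pderiv_cl \<Omega> i f x = deriv_cl \<Omega> f x (axis i 1)"

definition grad :: "(real^'d) set \<Rightarrow> (real^'d \<Rightarrow> real) \<Rightarrow> real^'d \<Rightarrow> real^'d" where
  "grad \<Omega> f x = (\<chi> i. pderiv_cl \<Omega> i f x)"

text \<open>The norm of the type of matrices is the Frobenius norm.\<close>

definition vgrad :: "(real^'d) set \<Rightarrow> (real^'d \<Rightarrow> real^'d) \<Rightarrow> real^'d \<Rightarrow> real^'d^'d" where
  "vgrad \<Omega> v x = (\<chi> i. grad \<Omega> (\<lambda>y. v y $ i) x)"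

definition divg :: "(real^'d) set \<Rightarrow> (real^'d \<Rightarrow> real^'d) \<Rightarrow> real^'d \<Rightarrow> real" where
  "divg \<Omega> v x = (\<Sum>i\<in>UNIV. pderiv_cl \<Omega> i (\<lambda>y. v y $ i) x)"

definition lapl :: "(real^'d) set \<Rightarrow> (real^'d \<Rightarrow> real) \<Rightarrow> real^'d \<Rightarrow> real" where
  "lapl \<Omega> f x = (\<Sum>i\<in>UNIV. pderiv_cl \<Omega> i (pderiv_cl \<Omega> i f) x)"

definition vlapl :: "(real^'d) set \<Rightarrow> (real^'d \<Rightarrow> real^'d) \<Rightarrow> real^'d \<Rightarrow> real^'d" where
  "vlapl \<Omega> v x = (\<chi> i. lapl \<Omega> (\<lambda>y. v y $ i) x)"

definition C1_cl :: "(real^'d) set \<Rightarrow> (real^'d \<Rightarrow> real) \<Rightarrow> bool" where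
  "C1_cl \<Omega> f \<longleftrightarrow>
     (\<forall>x\<in>closure \<Omega>. f differentiable (at x within closure \<Omega>)) \<and>
     (\<forall>i. continuous_on (closure \<Omega>) (pderiv_cl \<Omega> i f))"

definition C2_cl :: "(real^'d) set \<Rightarrow> (real^'d \<Rightarrow> real) \<Rightarrow> bool" where
  "C2_cl \<Omega> f \<longleftrightarrow> C1_cl \<Omega> f \<and> (\<forall>i. C1_cl \<Omega> (pderiv_cl \<Omega> i f))"

definition vC1_cl :: "(real^'d) set \<Rightarrow> (real^'d \<Rightarrow> real^'d) \<Rightarrow> bool" where
  "vC1_cl \<Omega> v \<longleftrightarrow> (\<forall>i. C1_cl \<Omega> (\<lambda>x. v x $ i))"

definition vC2_cl :: "(real^'d) set \<Rightarrow> (real^'d \<Rightarrow> real^'d) \<Rightarrow> bool" where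
  "vC2_cl \<Omega> v \<longleftrightarrow> (\<forall>i. C2_cl \<Omega> (\<lambda>x. v x $ i))"

text \<open>\<open>B(a,b) = (a \<cdot> \<nabla>) b + (\<nabla> \<cdot> a) b / 2\<close>; the directional derivative is \<open>deriv_cl \<Omega> b x (a x)\<close>.\<close>

definition Bform ::
  "(real^'d) set \<Rightarrow> (real^'d \<Rightarrow> real^'d) \<Rightarrow> (real^'d \<Rightarrow> real^'d) \<Rightarrow> real^'d \<Rightarrow> real^'d" where
  "Bform \<Omega> a b x = deriv_cl \<Omega> b x (a x) + ((1/2) * divg \<Omega> a x) *\<^sub>R b x"

definition normal_deriv ::
  "(real^'d) set \<Rightarrow> (real^'d \<Rightarrow> 'b::real_normed_vector) \<Rightarrow> real^'d \<Rightarrow> 'b" where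
  "normal_deriv \<Omega> f x = deriv_cl \<Omega> f x (outward_normal \<Omega> x)"

definition tangential :: "(real^'d) set \<Rightarrow> real^'d \<Rightarrow> real^'d \<Rightarrow> real^'d" where
  "tangential \<Omega> x v = v - (v \<bullet> outward_normal \<Omega> x) *\<^sub>R outward_normal \<Omega> x"

definition tgrad :: "(real^'d) set \<Rightarrow> (real^'d \<Rightarrow> real) \<Rightarrow> real^'d \<Rightarrow> real^'d" where
  "tgrad \<Omega> f x = grad \<Omega> f x - normal_deriv \<Omega> f x *\<^sub>R outward_normal \<Omega> x"

section \<open>Surface measure and inner products\<close>

text \<open>
  In every chart the surface measure is \<open>sqrt (1 + \<bar>\<nabla>g\<bar>\<^sup>2) dy\<close>, where \<open>y\<close> ranges over the hyperplane
  orthogonal to \<open>e\<close>. The functions involved depend on the hyperplane variable only, so that integral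
  equals the one over the slab \<open>0 \<le> x \<bullet> e \<le> 1\<close> of unit height; \<open>x + (g x - x \<bullet> e) *\<^sub>R e\<close> is the point of
  the graph on the line through \<open>x\<close> parallel to \<open>e\<close>. The measure vanishes off the boundary and is
  completed, as \<open>lebesgue\<close> is from \<open>lborel\<close>, so that functions given almost everywhere on the
  boundary (such as the normal) are measurable.
\<close>

definition is_surface_measure :: "(real^'d) set \<Rightarrow> (real^'d) measure \<Rightarrow> bool" where
  "is_surface_measure \<Omega> \<sigma> \<longleftrightarrow>
     (\<exists>\<sigma>\<^sub>0. sets \<sigma>\<^sub>0 = sets borel \<and> \<sigma> = completion \<sigma>\<^sub>0 \<and> emeasure \<sigma>\<^sub>0 (- frontier \<Omega>) = 0 \<and>
        (\<forall>V e g A. lipschitz_chart \<Omega> V e g \<longrightarrow> A \<in> sets borel \<longrightarrow> A \<subseteq> V \<longrightarrow>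
           emeasure \<sigma>\<^sub>0 (A \<inter> frontier \<Omega>) =
             (\<integral>\<^sup>+ x \<in> {x. 0 \<le> x \<bullet> e \<and> x \<bullet> e \<le> 1}.
                indicator A (x + (g x - x \<bullet> e) *\<^sub>R e) *
                ennreal (sqrt (1 + (norm (grad UNIV g x))\<^sup>2)) \<partial>lborel)))"

definition l2_inner :: "'a measure \<Rightarrow> ('a \<Rightarrow> 'b::real_inner) \<Rightarrow> ('a \<Rightarrow> 'b) \<Rightarrow> real" where
  "l2_inner M f g = (\<integral>x. f x \<bullet> g x \<partial>M)"

definition l2_norm :: "'a measure \<Rightarrow> ('a \<Rightarrow> 'b::real_inner) \<Rightarrow> real" where
  "l2_norm M f = sqrt (l2_inner M f f)"

definition in_L2 :: "'a measure \<Rightarrow> ('a \<Rightarrow> 'b::euclidean_space) \<Rightarrow> bool" where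
  "in_L2 M f \<longleftrightarrow> f \<in> borel_measurable M \<and> integrable M (\<lambda>x. (norm (f x))\<^sup>2)"

section \<open>The model and the scheme\<close>

definition mid :: "('a \<Rightarrow> 'b::real_vector) \<Rightarrow> ('a \<Rightarrow> 'b) \<Rightarrow> 'a \<Rightarrow> 'b" where
  "mid a b x = (1/2) *\<^sub>R (a x + b x)"

definition extrap :: "(nat \<Rightarrow> 'a \<Rightarrow> 'b::real_vector) \<Rightarrow> nat \<Rightarrow> 'a \<Rightarrow> 'b" where
  "extrap S n x = (3/2) *\<^sub>R S n x - (1/2) *\<^sub>R S (n - 1) x"

definition Gw :: "real \<Rightarrow> real \<Rightarrow> real" where
  "Gw \<theta>s s = - (sqrt 2 / 3) * cos \<theta>s * sin (pi / 2 * s)"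

definition Zw :: "real \<Rightarrow> real \<Rightarrow> real \<Rightarrow> real" where
  "Zw \<theta>s C s = deriv (Gw \<theta>s) s / sqrt (Gw \<theta>s s + C)"

definition energy ::
  "(real^'d) set \<Rightarrow> (real^'d) measure \<Rightarrow> real \<Rightarrow> real \<Rightarrow> real \<Rightarrow>
   (real^'d \<Rightarrow> real^'d) \<Rightarrow> (real^'d \<Rightarrow> real) \<Rightarrow> (real^'d \<Rightarrow> real) \<Rightarrow> (real^'d \<Rightarrow> real) \<Rightarrow> real" where
  "energy \<Omega> \<sigma> lam eps C u \<phi> U W =
     (\<integral>x. (1/2) * (norm (u x))\<^sup>2
          + lam * (eps / 2 * (norm (grad \<Omega> \<phi> x))\<^sup>2 + 1 / (4 * eps) * (U x)\<^sup>2) \<partial>lebesgue_on \<Omega>)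
     + lam * (\<integral>x. (W x)\<^sup>2 \<partial>\<sigma>)
     - lam * C * measure \<sigma> (frontier \<Omega>)"

definition energy_cn ::
  "(real^'d) set \<Rightarrow> (real^'d) measure \<Rightarrow> real \<Rightarrow> real \<Rightarrow> real \<Rightarrow> real \<Rightarrow>
   (real^'d \<Rightarrow> real^'d) \<Rightarrow> (real^'d \<Rightarrow> real) \<Rightarrow> (real^'d \<Rightarrow> real) \<Rightarrow> (real^'d \<Rightarrow> real) \<Rightarrow>
   (real^'d \<Rightarrow> real) \<Rightarrow> real" where
  "energy_cn \<Omega> \<sigma> lam eps C dt u \<phi> p U W =
     energy \<Omega> \<sigma> lam eps C u \<phi> U W + dt\<^sup>2 / 8 * (l2_norm (lebesgue_on \<Omega>) (grad \<Omega> p))\<^sup>2"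

end

theory Submission
  imports Defs
begin

text \<open>
  Testing the equations for \<open>\<phi>\<close>, \<open>\<mu>\<close> and the velocity with \<open>\<mu>\<close>, the increment of \<open>\<phi>\<close> and the intermediate
  velocity, all transport terms cancel: the convective form is skew, and the coupling
  \<open>\<phi>\<^sub>\<star> \<nabla>\<mu>\<close> is the adjoint of the transport of \<open>\<phi>\<close>. The pressure terms are absorbed by the projection
  step through the orthogonality of gradients and solenoidal fields.

  All this rests on the divergence theorem for functions that are \<open>C\<^sup>1\<close> up to a Lipschitz boundary.
  After a partition of unity, \<open>f\<close> is supported in one chart, where \<open>\<Omega>\<close> is \<open>h < 0\<close> for
  \<open>h x = x \<bullet> e - g x\<close>. For a cut-off \<open>\<eta>\<close> that depends on \<open>k h\<close> only, \<open>\<eta> f\<close> is Lipschitz with compact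
  support, so its partial derivatives have integral zero; as \<open>k\<close> tends to infinity, the term with \<open>\<nabla>\<eta>\<close>
  is a mean over a thin layer below the graph, which converges to the surface integral. No
  coordinates are needed: integrals over layers are compared with integrals over a slab of unit
  height by Tonelli's theorem and translation invariance.
\<close>

section \<open>Integration along a direction\<close>

text \<open>The law is an equality because every increment is paired with a mean, which gives a
  difference of squares. The updates of \<open>U\<close> and \<open>W\<close> are made for this:
  times the increment of \<open>\<phi>\<close>, the term \<open>\<phi>s * Uh\<close> is a quarter of
  the increment of the square of \<open>U\<close>, and the term with \<open>Wh\<close> is the
  increment of the square of \<open>W\<close>. The boundary terms of the two Green formulas are
  evaluated only together, since each contains the product of \<open>\<phi>dot\<close> with the
  transport of \<open>\<phi>s\<close>, with opposite signs. The weight \<open>dt\<^sup>2 / 8\<close>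
  comes from the projection step, which moves the velocity by \<open>dt / 2\<close> times a
  difference of pressure gradients. The analytic obstacle is the normal: at a Lipschitz boundary it
  exists only almost everywhere, and it is given by a description, so its measurability is not
  evident. Hence surface identities are stated almost everywhere, the surface measure is complete,
  and the divergence theorem delivers the integrability of the flux together with its value.
  Derivatives at boundary points are one-sided, so their uniqueness has to come from the geometry of
  the charts.\<close>

lemma nn_integral_lborel_translate:
  fixes f :: "'a::euclidean_space \<Rightarrow> ennreal"
  assumes "f \<in> borel_measurable borel"
  shows "(\<integral>\<^sup>+x. f (x + a) \<partial>lborel) = (\<integral>\<^sup>+x. f x \<partial>lborel)"
proof -
  have "(\<integral>\<^sup>+x. f x \<partial>lborel) = (\<integral>\<^sup>+x. f x \<partial>distr lborel borel ((+) a))"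
    by (simp add: lborel_distr_plus)
  also have "\<dots> = (\<integral>\<^sup>+x. f (a + x) \<partial>lborel)"
    using assms by (subst nn_integral_distr) auto
  finally show ?thesis by (simp add: add.commute)
qed

text \<open>Every line parallel to \<open>e\<close> meets the slab in a segment of length one. So
  the factor \<open>\<integral> indicator ?S (x - t e) dt = 1\<close> can be inserted for each
  \<open>x\<close>, and Tonelli together with the shift of \<open>x\<close> by
  \<open>t *\<^sub>R e\<close> moves the integration onto whole lines. It plays the role of Fubini
  in coordinates adapted to \<open>e\<close>.\<close>

lemma nn_integral_unit_slab:
  fixes e :: "'a::euclidean_space" and K :: "'a \<Rightarrow> ennreal"
  assumes e: "norm e = 1" and K [measurable]: "K \<in> borel_measurable borel"
  shows "(\<integral>\<^sup>+x. K x \<partial>lborel) =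
    (\<integral>\<^sup>+x. indicator {x. 0 \<le> x \<bullet> e \<and> x \<bullet> e \<le> 1} x * (\<integral>\<^sup>+t. K (x + t *\<^sub>R e) \<partial>lborel) \<partial>lborel)"
proof -
  let ?S = "{x. 0 \<le> x \<bullet> e \<and> x \<bullet> e \<le> 1}"
  have S [measurable]: "?S \<in> sets borel" by measurable
  have ee: "e \<bullet> e = 1" using e by (simp add: norm_eq_1)
  have one: "(\<integral>\<^sup>+t. indicator ?S (x - t *\<^sub>R e) \<partial>lborel) = 1" for x
  proof -
    have "(\<lambda>t. indicator ?S (x - t *\<^sub>R e) :: ennreal) = indicator {x \<bullet> e - 1 .. x \<bullet> e}"
      by (auto simp: fun_eq_iff indicator_def inner_diff_left ee)
    then show ?thesis by simp
  qed
  have m1 [measurable]: "(\<lambda>(x, t). indicator ?S x * K (x + t *\<^sub>R e)) \<in> borel_measurable (lborel \<Otimes>\<^sub>M lborel)"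
    by measurable
  have m2 [measurable]: "(\<lambda>(x, t). indicator ?S (x - t *\<^sub>R e) * K x) \<in> borel_measurable (lborel \<Otimes>\<^sub>M lborel)"
    by measurable
  have "(\<integral>\<^sup>+x. indicator ?S x * (\<integral>\<^sup>+t. K (x + t *\<^sub>R e) \<partial>lborel) \<partial>lborel) =
      (\<integral>\<^sup>+x. \<integral>\<^sup>+t. indicator ?S x * K (x + t *\<^sub>R e) \<partial>lborel \<partial>lborel)"
    by (intro nn_integral_cong nn_integral_cmult [symmetric]) measurable
  also have "\<dots> = (\<integral>\<^sup>+t. \<integral>\<^sup>+x. indicator ?S x * K (x + t *\<^sub>R e) \<partial>lborel \<partial>lborel)"
    by (rule lborel_pair.Fubini'[symmetric]) measurable
  also have "\<dots> = (\<integral>\<^sup>+t. \<integral>\<^sup>+x. indicator ?S (x - t *\<^sub>R e) * K x \<partial>lborel \<partial>lborel)"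
  proof (rule nn_integral_cong)
    fix t :: real
    have "(\<integral>\<^sup>+x. indicator ?S (x - t *\<^sub>R e) * K x \<partial>lborel) =
      (\<integral>\<^sup>+x. indicator ?S ((x + t *\<^sub>R e) - t *\<^sub>R e) * K (x + t *\<^sub>R e) \<partial>lborel)"
      by (rule nn_integral_lborel_translate[symmetric]) measurable
    then show "(\<integral>\<^sup>+x. indicator ?S x * K (x + t *\<^sub>R e) \<partial>lborel) =
        (\<integral>\<^sup>+x. indicator ?S (x - t *\<^sub>R e) * K x \<partial>lborel)" by simp
  qed
  also have "\<dots> = (\<integral>\<^sup>+x. \<integral>\<^sup>+t. indicator ?S (x - t *\<^sub>R e) * K x \<partial>lborel \<partial>lborel)"
    by (rule lborel_pair.Fubini') measurable
  also have "\<dots> = (\<integral>\<^sup>+x. (\<integral>\<^sup>+t. indicator ?S (x - t *\<^sub>R e) \<partial>lborel) * K x \<partial>lborel)"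
    by (intro nn_integral_cong nn_integral_multc) measurable
  also have "\<dots> = (\<integral>\<^sup>+x. K x \<partial>lborel)" by (simp add: one)
  finally show ?thesis ..
qed

text \<open>Difference quotients of an integrable function have integral zero by translation
  invariance. Here they are bounded by \<open>L * norm v\<close> on a fixed ball, so dominated
  convergence carries this over to the derivative. The Lipschitz estimate is asked only for points
  closer than \<open>d\<close>, because for a function extended by zero from a compact subset of a
  domain the segment between distant points may leave the domain.\<close>

lemma integral_directional_derivative_eq_0:
  fixes G :: "'a::euclidean_space \<Rightarrow> real"
  assumes d: "d > 0" and lip: "\<And>x y. norm (y - x) < d \<Longrightarrow> \<bar>G y - G x\<bar> \<le> L * norm (y - x)"
    and supp: "\<And>x. x \<notin> cball a R \<Longrightarrow> G x = 0"
    and Dv: "Dv \<in> borel_measurable borel"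
    and deriv: "AE x in lborel. ((\<lambda>t. G (x + t *\<^sub>R v)) has_real_derivative Dv x) (at 0)"
  shows "integrable lborel Dv" "(\<integral>x. Dv x \<partial>lborel) = 0"
proof -
  obtain b :: 'a where b: "b \<in> Basis" using nonempty_Basis by blast
  have L: "L \<ge> 0"
  proof -
    have "0 \<le> L * norm ((d/2) *\<^sub>R b)"
      using order_trans[OF abs_ge_zero lip[of "(d/2) *\<^sub>R b" 0]] b d by simp
    then show ?thesis using b d by (simp add: zero_le_mult_iff)
  qed
  have cont: "continuous_on UNIV G"
  proof (rule uniformly_continuous_imp_continuous, unfold uniformly_continuous_on_def, intro allI impI)
    fix eps :: real assume eps: "eps > 0"
    show "\<exists>r>0. \<forall>x\<in>UNIV. \<forall>y\<in>UNIV. dist y x < r \<longrightarrow> dist (G y) (G x) < eps"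
    proof (intro exI[of _ "min d (eps / (L + 1))"] conjI ballI impI)
      show "min d (eps / (L + 1)) > 0" using d eps L by simp
      fix x y :: 'a assume y: "dist y x < min d (eps / (L + 1))"
      then have "norm (y - x) < eps / (L + 1)" "norm (y - x) < d" by (auto simp: dist_norm)
      then have "(L + 1) * norm (y - x) < eps" using L by (simp add: field_simps)
      moreover have "\<bar>G y - G x\<bar> \<le> L * norm (y - x)" using lip y by (simp add: dist_norm)
      ultimately show "dist (G y) (G x) < eps"
        unfolding dist_real_def using norm_ge_zero[of "y - x"]
        by (simp only: distrib_right mult_1_left)
    qed
  qed
  then have Gm [measurable]: "G \<in> borel_measurable borel"
    by (simp add: borel_measurable_continuous_onI)
  have "bounded (G ` cball a R)"
    by (intro compact_imp_bounded compact_continuous_image continuous_on_subset[OF cont]) auto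
  then obtain B where B: "\<And>x. x \<in> cball a R \<Longrightarrow> \<bar>G x\<bar> \<le> B"
    unfolding bounded_iff by fastforce
  have cb: "integrable lborel (\<lambda>x. indicator (cball a r) x * c)" for c r :: real
    by (rule integrable_mult_left) (auto intro!: integrable_real_indicator emeasure_bounded_finite)
  have Gi: "integrable lborel G"
  proof (rule Bochner_Integration.integrable_bound[OF cb[of R B]])
    show "AE x in lborel. norm (G x) \<le> norm (indicator (cball a R) x * B)"
      using B supp by (intro AE_I2) (fastforce simp: indicator_def)
  qed simp
  have Gt: "integrable lborel (\<lambda>x. G (x + c))" "(\<integral>x. G (x + c) \<partial>lborel) = (\<integral>x. G x \<partial>lborel)" for c
  proof -
    have "integrable (distr lborel borel ((+) c)) G" using Gi by (simp add: lborel_distr_plus)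
    then show "integrable lborel (\<lambda>x. G (x + c))" by (simp add: integrable_distr_eq add.commute)
    have "(\<integral>x. G x \<partial>lborel) = (\<integral>x. G x \<partial>distr lborel borel ((+) c))" by (simp add: lborel_distr_plus)
    also have "\<dots> = (\<integral>x. G (x + c) \<partial>lborel)" by (subst integral_distr) (auto simp: add.commute)
    finally show "(\<integral>x. G (x + c) \<partial>lborel) = (\<integral>x. G x \<partial>lborel)" ..
  qed
  \<comment> \<open>All steps \<open>h n *\<^sub>R v\<close> stay shorter than \<open>d\<close>, so
    the local Lipschitz estimate applies to each quotient. The added 1 covers
    \<open>v = 0\<close>.\<close>
  define \<tau> where "\<tau> = d / (norm v + 1)"
  have \<tau>: "\<tau> > 0" using d by (auto simp: \<tau>_def intro!: divide_pos_pos add_nonneg_pos)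
  have \<tau>v: "\<tau> * norm v < d"
    using d add_nonneg_pos[OF norm_ge_zero[of v] zero_less_one]
    by (simp add: \<tau>_def pos_divide_less_eq distrib_left)
  define h where "h n = \<tau> / real (Suc n)" for n
  have h: "h n > 0" "h n * norm v < d" for n
  proof -
    show "h n > 0" using \<tau> by (simp add: h_def)
    have "h n \<le> \<tau>" using \<tau> by (simp add: h_def field_simps)
    then have "h n * norm v \<le> \<tau> * norm v" by (simp add: mult_right_mono)
    then show "h n * norm v < d" using \<tau>v by simp
  qed
  have h0: "h \<longlonglongrightarrow> 0"
    unfolding h_def by (rule LIMSEQ_Suc[OF lim_const_over_n])
  define s where "s n x = (G (x + h n *\<^sub>R v) - G x) / h n" for n x
  have lim: "AE x in lborel. (\<lambda>n. s n x) \<longlonglongrightarrow> Dv x"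
    using deriv
  proof eventually_elim
    case (elim x)
    then have "((\<lambda>t. (G (x + t *\<^sub>R v) - G x) / t) \<longlongrightarrow> Dv x) (at 0)"
      by (simp add: has_field_derivative_iff)
    moreover have "filterlim h (at 0) sequentially"
      using h h0 by (auto simp: filterlim_at less_imp_neq[symmetric] intro!: always_eventually)
    ultimately show ?case
      unfolding s_def using filterlim_compose by blast
  qed
  \<comment> \<open>A quotient vanishes unless \<open>x\<close> or its translate lies in the
    support; the translate is less than \<open>d\<close> away, hence the radius
    \<open>R + d\<close>.\<close>
  have bound: "norm (s n x) \<le> indicator (cball a (R + d)) x * (L * norm v)" for n x
  proof (cases "x \<in> cball a R \<or> x + h n *\<^sub>R v \<in> cball a R")
    case True
    have "norm (h n *\<^sub>R v) < d" using h[of n] by simp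
    then have "x \<in> cball a (R + d)"
      using True norm_triangle_ineq4[of "a - (x + h n *\<^sub>R v)" "- (h n *\<^sub>R v)"] d
      by (auto simp: dist_norm)
    moreover have "\<bar>G (x + h n *\<^sub>R v) - G x\<bar> \<le> L * norm v * h n"
      using lip[of "x + h n *\<^sub>R v" x] h[of n] by (simp add: ac_simps)
    then have "norm (s n x) \<le> L * norm v"
      using h(1)[of n] by (simp add: s_def field_simps)
    ultimately show ?thesis by simp
  next
    case False
    then show ?thesis using supp L by (auto simp: s_def)
  qed
  have s: "integrable lborel (s n)" "(\<integral>x. s n x \<partial>lborel) = 0" for n
    unfolding s_def using Gi Gt by auto
  have lim': "(\<lambda>n. integral\<^sup>L lborel (s n)) \<longlonglongrightarrow> integral\<^sup>L lborel Dv"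
    and int: "integrable lborel Dv"
    using integral_dominated_convergence[OF _ _ cb lim AE_I2[OF bound]]
          integrable_dominated_convergence[OF _ _ cb lim AE_I2[OF bound]] s(1) Dv by auto
  show "integrable lborel Dv" by (fact int)
  show "(\<integral>x. Dv x \<partial>lborel) = 0" using lim' by (simp add: s(2) LIMSEQ_const_iff)
qed

section \<open>Lipschitz graphs and their surface measure\<close>

lemma linear_eq_inner_axis:
  fixes f :: "real^'d \<Rightarrow> real"
  assumes "linear f"
  shows "f h = (\<chi> i. f (axis i 1)) \<bullet> h"
proof -
  have "f h = f (\<Sum>i\<in>UNIV. h $ i *\<^sub>R axis i 1)" by (simp add: basis_expansion scalar_mult_eq_scaleR[symmetric])
  also have "\<dots> = (\<Sum>i\<in>UNIV. h $ i * f (axis i 1))"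
    using assms by (simp add: linear_sum linear_scale)
  finally show ?thesis by (simp add: inner_vec_def mult.commute)
qed

lemma borel_measurable_vec_componentwise:
  fixes f :: "'a \<Rightarrow> real^'d"
  assumes "\<And>i. (\<lambda>x. f x $ i) \<in> borel_measurable M"
  shows "f \<in> borel_measurable M"
  unfolding borel_measurable_euclidean_space[of f]
  using assms by (auto simp: Basis_vec_def inner_axis)

lemma has_real_derivative_along_line:
  assumes "(f has_derivative f') (at x)"
  shows "((\<lambda>t. f (x + t *\<^sub>R v)) has_real_derivative f' v) (at 0)"
proof -
  have "(f has_derivative f') (at (x + 0 *\<^sub>R v))" using assms by simp
  moreover have "((\<lambda>t. x + t *\<^sub>R v) has_derivative (\<lambda>t. t *\<^sub>R v)) (at (0::real))"
    by (auto intro!: derivative_eq_intros)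
  ultimately have "((\<lambda>t. f (x + t *\<^sub>R v)) has_derivative (\<lambda>t. f' (t *\<^sub>R v))) (at 0)"
    using has_derivative_compose by blast
  moreover have "f' (t *\<^sub>R v) = f' v * t" for t
    using linear_scale[OF has_derivative_linear[OF assms]] by simp
  ultimately show ?thesis by (simp add: has_field_derivative_def mult.commute[of _ "f' v"])
qed

text \<open>A countable sequence of step sizes suffices to recover the derivative. It is this form
  that yields measurability in a parameter, as a limit of a sequence of measurable
  functions.\<close>

lemma has_real_derivative_lim_quotient:
  assumes "(f has_real_derivative f') (at 0)"
  shows "(\<lambda>n. (f (1 / real (Suc n)) - f 0) * real (Suc n)) \<longlonglongrightarrow> f'"
proof -
  have "((\<lambda>t. (f t - f 0) / t) \<longlongrightarrow> f') (at 0)"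
    using assms by (simp add: has_field_derivative_iff)
  moreover have "filterlim (\<lambda>n. 1 / real (Suc n)) (at 0) sequentially"
    using LIMSEQ_Suc[OF lim_const_over_n[of 1]]
    by (auto simp: filterlim_at intro!: always_eventually)
  ultimately have "(\<lambda>n. (f (1 / real (Suc n)) - f 0) / (1 / real (Suc n))) \<longlonglongrightarrow> f'"
    using filterlim_compose by blast
  then show ?thesis by (simp add: divide_inverse)
qed

text \<open>
  The set \<open>T\<close> of good points is a union of lines parallel to \<open>e\<close>, so that it is conull for the
  surface measure of the graph as soon as it is conull for Lebesgue measure.
\<close>

lemma lipschitz_chart_gradient:
  fixes \<Omega> :: "(real^'d) set"
  assumes chart: "lipschitz_chart \<Omega> V e g"
  obtains T \<Gamma> L where
    "T \<in> sets borel" "AE x in lborel. x \<in> T" "\<And>x t. x + t *\<^sub>R e \<in> T \<longleftrightarrow> x \<in> T"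
    "\<And>x. x \<in> T \<Longrightarrow> (g has_derivative (\<lambda>h. \<Gamma> x \<bullet> h)) (at x)"
    "\<And>x. x \<in> T \<Longrightarrow> grad UNIV g x = \<Gamma> x"
    "\<Gamma> \<in> borel_measurable borel" "\<And>x. \<Gamma> x \<bullet> e = 0" "\<And>x t. \<Gamma> (x + t *\<^sub>R e) = \<Gamma> x"
    "\<And>x i. \<bar>\<Gamma> x $ i\<bar> \<le> L" "L-lipschitz_on UNIV g"
proof -
  have e: "norm e = 1" and inv: "\<And>x t. g (x + t *\<^sub>R e) = g x"
    and neg: "negligible {x. \<not> g differentiable (at x)}"
    using chart by (auto simp: lipschitz_chart_def)
  obtain L where L: "L-lipschitz_on UNIV g" using chart by (auto simp: lipschitz_chart_def)
  have gm [measurable]: "g \<in> borel_measurable borel"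
    by (intro borel_measurable_continuous_onI lipschitz_on_continuous_on[OF L])
  \<comment> \<open>The exceptional set is enclosed in a Borel null set, to which Tonelli can be
    applied.\<close>
  obtain N where N: "N \<in> null_sets lborel" "{x. \<not> g differentiable (at x)} \<subseteq> N"
    using neg unfolding negligible_iff_null_sets null_sets_completion_iff2 by blast
  have [measurable]: "N \<in> sets borel" using N(1) by (auto simp: null_sets_def)
  \<comment> \<open>\<open>s x\<close> is the length of the part of the line through
    \<open>x\<close> that lies in \<open>N\<close>. Integrating over \<open>x\<close> first shows
    that it vanishes almost everywhere, and it is constant along each line.\<close>
  define s where "s x = (\<integral>\<^sup>+t. indicator N (x + t *\<^sub>R e) \<partial>lborel)" for x
  have m1 [measurable]: "(\<lambda>(x, t). indicator N (x + t *\<^sub>R e) :: ennreal) \<in> borel_measurable (lborel \<Otimes>\<^sub>M lborel)"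
    by measurable
  have s [measurable]: "s \<in> borel_measurable borel"
    unfolding s_def by measurable
  have sinv: "s (x + t *\<^sub>R e) = s x" for x t
    using nn_integral_lborel_translate[of "\<lambda>r. indicator N (x + r *\<^sub>R e)" t]
    by (simp add: s_def scaleR_add_left add_ac)
  have "(\<integral>\<^sup>+x. s x \<partial>lborel) = (\<integral>\<^sup>+t. \<integral>\<^sup>+x. indicator N (x + t *\<^sub>R e) \<partial>lborel \<partial>lborel)"
    unfolding s_def by (rule lborel_pair.Fubini'[symmetric]) measurable
  also have "\<dots> = (\<integral>\<^sup>+t. 0 \<partial>(lborel :: real measure))"
    using N(1) nn_integral_lborel_translate[of "indicator N"]
    by (intro nn_integral_cong) (auto simp: null_sets_def)
  finally have s0: "AE x in lborel. s x = 0"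
    by (simp add: nn_integral_0_iff_AE)
  have diff_inv: "g differentiable (at (x + t *\<^sub>R e))" if gx: "g differentiable (at x)" for x t
  proof -
    have eq: "(x + t *\<^sub>R e) + (-t) *\<^sub>R e = x" by simp
    obtain g' where "(g has_derivative g') (at x)"
      using gx unfolding differentiable_def by blast
    then have "(g has_derivative g') (at ((x + t *\<^sub>R e) + (-t) *\<^sub>R e))"
      by (simp only: eq)
    moreover have "((\<lambda>y. y + (-t) *\<^sub>R e) has_derivative (\<lambda>h. h)) (at (x + t *\<^sub>R e))"
      by (auto intro!: derivative_eq_intros)
    ultimately have "((\<lambda>y. g (y + (-t) *\<^sub>R e)) has_derivative g') (at (x + t *\<^sub>R e))"
      using has_derivative_compose by blast
    then have "(g has_derivative g') (at (x + t *\<^sub>R e))"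
      by (simp only: inv)
    then show ?thesis by (auto simp: differentiable_def)
  qed
  \<comment> \<open>Differentiability propagates along the line because \<open>g\<close> is constant
    in direction \<open>e\<close>. A single bad point would therefore put the whole line into
    \<open>N\<close> and make \<open>s x\<close> infinite.\<close>
  have sD: "g differentiable (at x)" if "s x = 0" for x
  proof (rule ccontr)
    assume nd: "\<not> g differentiable (at x)"
    have "x + t *\<^sub>R e \<in> N" for t
      using N(2) nd diff_inv[of "x + t *\<^sub>R e" "-t"] by (auto simp: algebra_simps)
    then have "s x = \<infinity>" by (simp add: s_def)
    then show False using that by simp
  qed
  define T where "T = {x. s x = 0}"
  \<comment> \<open>The default zero off \<open>T\<close> keeps \<open>\<Gamma>\<close> Borel,
    bounded, orthogonal to \<open>e\<close> and constant along \<open>e\<close> at every point, not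
    only almost everywhere.\<close>
  define \<Gamma> where "\<Gamma> x = (if x \<in> T then (\<chi> i. frechet_derivative g (at x) (axis i 1)) else 0)" for x
  have der: "(g has_derivative (\<lambda>h. \<Gamma> x \<bullet> h)) (at x)" if "x \<in> T" for x
  proof -
    have d: "(g has_derivative frechet_derivative g (at x)) (at x)"
      using sD that unfolding T_def frechet_derivative_works[symmetric] by simp
    have "frechet_derivative g (at x) = (\<lambda>h. \<Gamma> x \<bullet> h)"
      unfolding \<Gamma>_def if_P[OF that]
      by (intro ext linear_eq_inner_axis has_derivative_linear[OF d])
    with d show ?thesis by simp
  qed
  have dir: "((\<lambda>t. g (x + t *\<^sub>R v)) has_real_derivative \<Gamma> x \<bullet> v) (at 0)" if "x \<in> T" for x v
    using has_real_derivative_along_line[OF der[OF that]] .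
  have quot: "(\<lambda>n. (g (x + (1 / real (Suc n)) *\<^sub>R v) - g x) * real (Suc n)) \<longlonglongrightarrow> \<Gamma> x \<bullet> v" if "x \<in> T" for x v
    using has_real_derivative_lim_quotient[OF dir[OF that]] by simp
  have Tm [measurable]: "T \<in> sets borel" unfolding T_def by measurable
  have Tinv: "x + t *\<^sub>R e \<in> T \<longleftrightarrow> x \<in> T" for x t by (simp add: T_def sinv)
  show thesis
  proof (rule that[OF _ _ Tinv der _ _ _ _ _ L])
    show "T \<in> sets borel" by fact
    show "AE x in lborel. x \<in> T" using s0 by (simp add: T_def)
    show "grad UNIV g x = \<Gamma> x" if "x \<in> T" for x
      using that by (simp add: grad_def pderiv_cl_def deriv_cl_def \<Gamma>_def)
    show "\<Gamma> \<in> borel_measurable borel"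
    proof (rule borel_measurable_vec_componentwise)
      fix i
      have "(\<lambda>x. \<Gamma> x $ i) = (\<lambda>x. if x \<in> T then lim (\<lambda>n. (g (x + (1 / real (Suc n)) *\<^sub>R axis i 1) - g x) * real (Suc n)) else 0)"
      proof (rule ext)
        fix x
        show "\<Gamma> x $ i = (if x \<in> T then lim (\<lambda>n. (g (x + (1 / real (Suc n)) *\<^sub>R axis i 1) - g x) * real (Suc n)) else 0)"
        proof (cases "x \<in> T")
          case True
          have "\<Gamma> x $ i = \<Gamma> x \<bullet> axis i 1" by (simp add: inner_axis)
          then show ?thesis using limI[OF quot[OF True, of "axis i 1"]] True by (simp only: if_True)
        qed (simp add: \<Gamma>_def)
      qed
      also have "\<dots> \<in> borel_measurable borel" by measurable
      finally show "(\<lambda>x. \<Gamma> x $ i) \<in> borel_measurable borel" .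
    qed
    show "\<Gamma> x \<bullet> e = 0" for x
    proof (cases "x \<in> T")
      case True
      then show ?thesis using quot[OF True, of e] by (simp add: inv LIMSEQ_const_iff)
    qed (simp add: \<Gamma>_def)
    show "\<Gamma> (x + t *\<^sub>R e) = \<Gamma> x" for x t
    proof (cases "x \<in> T")
      case True
      have "\<Gamma> (x + t *\<^sub>R e) \<bullet> v = \<Gamma> x \<bullet> v" for v
      proof -
        have sh: "g (x + t *\<^sub>R e + r *\<^sub>R v) = g (x + r *\<^sub>R v)" for r
          using inv[of "x + r *\<^sub>R v" t] by (simp add: add_ac)
        have "x + t *\<^sub>R e \<in> T" using True Tinv by blast
        from quot[OF this, of v, unfolded sh inv] quot[OF True, of v]
        show ?thesis by (rule LIMSEQ_unique)
      qed
      then show ?thesis by (metis vector_eq_rdot)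
    qed (simp add: \<Gamma>_def Tinv)
    show "\<bar>\<Gamma> x $ i\<bar> \<le> L" for x i
    proof (cases "x \<in> T")
      case True
      have "\<bar>(g (x + (1 / real (Suc n)) *\<^sub>R axis i 1) - g x) * real (Suc n)\<bar> \<le> L" for n
        using lipschitz_onD[OF L, of "x + (1 / real (Suc n)) *\<^sub>R axis i 1" x]
        by (simp add: dist_norm dist_real_def abs_mult pos_le_divide_eq[symmetric] del: of_nat_Suc)
      then have "\<bar>\<Gamma> x \<bullet> axis i 1\<bar> \<le> L"
        using quot[OF True, of "axis i 1"] by (intro LIMSEQ_le_const2[OF tendsto_rabs]) auto
      then show ?thesis by (simp add: inner_axis)
    qed (use lipschitz_on_nonneg[OF L] in \<open>simp add: \<Gamma>_def\<close>)
  qed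
qed

section \<open>Geometry of one chart: normal, closure and frontier\<close>

lemma lipschitz_chartD:
  assumes "lipschitz_chart \<Omega> V e g"
  shows "open V" "norm e = 1" "e \<bullet> e = 1" "\<And>x t. g (x + t *\<^sub>R e) = g x"
    "\<And>x. x \<in> V \<Longrightarrow> x \<in> \<Omega> \<longleftrightarrow> x \<bullet> e < g x" "continuous_on UNIV g"
  using assms by (auto simp: lipschitz_chart_def norm_eq_1 intro: lipschitz_on_continuous_on)

text \<open>The vector \<open>e - \<gamma>\<close> is the gradient at \<open>z\<close> of the height
  \<open>y \<bullet> e - g y\<close>, which is negative exactly on the side of
  \<open>\<Omega>\<close>. Since \<open>\<gamma> \<bullet> e = 0\<close>, its length is
  \<open>sqrt (1 + (norm \<gamma>)\<^sup>2)\<close>. The first-order expansion at \<open>z\<close>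
  fixes the sign of the height outside any thin cone around the tangent plane, which is all that
  \<open>is_outward_normal\<close> asks for.\<close>

lemma chart_outward_normal:
  assumes chart: "lipschitz_chart \<Omega> V e g" and z: "z \<in> V" "g z = z \<bullet> e"
    and der: "(g has_derivative (\<lambda>h. \<gamma> \<bullet> h)) (at z)" and ge: "\<gamma> \<bullet> e = 0"
  shows "outward_normal \<Omega> z = (1 / sqrt (1 + (norm \<gamma>)\<^sup>2)) *\<^sub>R (e - \<gamma>)"
proof -
  note ch = lipschitz_chartD[OF chart]
  define N where "N = sqrt (1 + (norm \<gamma>)\<^sup>2)"
  have "(norm (e - \<gamma>))\<^sup>2 = 1 + (norm \<gamma>)\<^sup>2"
    using ge ch(3) by (simp add: power2_norm_eq_inner inner_diff_left inner_diff_right inner_commute)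
  then have N: "norm (e - \<gamma>) = N" by (simp add: N_def real_sqrt_unique)
  have Npos: "N > 0" by (simp add: N_def add_pos_nonneg)
  have on: "is_outward_normal \<Omega> z ((1 / N) *\<^sub>R (e - \<gamma>))"
    unfolding is_outward_normal_def
  proof (intro conjI allI impI)
    show "norm ((1 / N) *\<^sub>R (e - \<gamma>)) = 1" using N Npos by simp
    fix c :: real assume c: "c > 0"
    \<comment> \<open>The remainder gets half of the cone opening \<open>c * N\<close>, so outside
      the cone the linear part decides the sign.\<close>
    then have "c * N / 2 > 0" using Npos by simp
    then obtain r1 where r1: "r1 > 0"
      "\<And>y. norm (y - z) < r1 \<Longrightarrow> norm (g y - g z - \<gamma> \<bullet> (y - z)) \<le> c * N / 2 * norm (y - z)"
      using der unfolding has_derivative_at_alt by blast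
    obtain r2 where r2: "r2 > 0" "ball z r2 \<subseteq> V" using ch(1) z(1) open_contains_ball by blast
    show "\<exists>r>0. \<forall>y\<in>ball z r.
        ((y - z) \<bullet> ((1 / N) *\<^sub>R (e - \<gamma>)) < - c * norm (y - z) \<longrightarrow> y \<in> \<Omega>) \<and>
        ((y - z) \<bullet> ((1 / N) *\<^sub>R (e - \<gamma>)) > c * norm (y - z) \<longrightarrow> y \<notin> \<Omega>)"
    proof (intro exI[of _ "min r1 r2"] conjI ballI impI)
      show "min r1 r2 > 0" using r1 r2 by simp
    next
      fix y assume y: "y \<in> ball z (min r1 r2)"
      then have yV: "y \<in> V" using r2 by auto
      have rem: "\<bar>g y - g z - \<gamma> \<bullet> (y - z)\<bar> \<le> c * N * norm (y - z) / 2"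
        using r1(2)[of y] y by (simp add: dist_norm norm_minus_commute)
      have pos: "0 \<le> c * N * norm (y - z)" using c Npos by simp
      have eq: "(y - z) \<bullet> ((1 / N) *\<^sub>R (e - \<gamma>)) = ((y - z) \<bullet> e - \<gamma> \<bullet> (y - z)) / N"
        by (simp add: inner_diff_right inner_commute)
      have ye: "(y - z) \<bullet> e = y \<bullet> e - g z" using z by (simp add: inner_diff_left)
      {
        assume "(y - z) \<bullet> ((1 / N) *\<^sub>R (e - \<gamma>)) < - c * norm (y - z)"
        then have "y \<bullet> e - g z - \<gamma> \<bullet> (y - z) < - (c * N * norm (y - z))"
          unfolding eq ye using Npos by (simp add: divide_less_eq ac_simps)
        then have "y \<bullet> e < g y" using rem pos by linarith
        then show "y \<in> \<Omega>" using ch(5) yV by blast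
      }
      {
        assume "(y - z) \<bullet> ((1 / N) *\<^sub>R (e - \<gamma>)) > c * norm (y - z)"
        then have "y \<bullet> e - g z - \<gamma> \<bullet> (y - z) > c * N * norm (y - z)"
          unfolding eq ye using Npos by (simp add: less_divide_eq ac_simps)
        then have "\<not> y \<bullet> e < g y" using rem pos by linarith
        then show "y \<notin> \<Omega>" using ch(5) yV by blast
      }
    qed
  qed
  show ?thesis
    unfolding outward_normal_def N_def[symmetric]
    by (rule the_equality, rule on, rule is_outward_normal_unique[OF _ on])
qed

text \<open>The part of \<open>V\<close> above the graph is open and disjoint from
  \<open>\<Omega>\<close>, so it cannot contain a limit of points of
  \<open>\<Omega>\<close>.\<close>

lemma chart_closure_le:
  assumes chart: "lipschitz_chart \<Omega> V e g" and x: "x \<in> closure \<Omega>" "x \<in> V"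
  shows "x \<bullet> e \<le> g x"
proof (rule ccontr)
  note ch = lipschitz_chartD[OF chart]
  assume "\<not> x \<bullet> e \<le> g x"
  moreover have "open {x. g x < x \<bullet> e}"
    by (intro open_Collect_less ch(6) continuous_intros)
  then have "open (V \<inter> {x. g x < x \<bullet> e})" using ch(1) by blast
  ultimately have "V \<inter> {x. g x < x \<bullet> e} \<inter> \<Omega> \<noteq> {}"
    using x open_Int_closure_eq_empty[of "V \<inter> {x. g x < x \<bullet> e}" \<Omega>] by auto
  then show False using ch(5) by force
qed

lemma chart_frontier_eq:
  assumes chart: "lipschitz_chart \<Omega> V e g" and "open \<Omega>" and x: "x \<in> frontier \<Omega>" "x \<in> V"
  shows "g x = x \<bullet> e"
  using chart_closure_le[OF chart _ x(2)] lipschitz_chartD(5)[OF chart x(2)] x(1) \<open>open \<Omega>\<close>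
  by (auto simp: frontier_def interior_open)

text \<open>Moving from a point of the graph in direction \<open>-e\<close> leaves \<open>g\<close>
  unchanged and lowers the height, which produces points of \<open>\<Omega>\<close> arbitrarily
  close by.\<close>

lemma chart_graph_closure:
  assumes chart: "lipschitz_chart \<Omega> V e g" and x: "g x = x \<bullet> e" "x \<in> V"
  shows "x \<in> closure \<Omega>"
proof -
  note ch = lipschitz_chartD[OF chart]
  obtain r where r: "r > 0" "ball x r \<subseteq> V" using ch(1) x(2) open_contains_ball by blast
  show ?thesis
    unfolding closure_approachable
  proof (intro allI impI)
    fix d :: real assume d: "d > 0"
    define t where "t = min r d / 2"
    have t: "t > 0" "t < r" "t < d" using r d by (auto simp: t_def)
    define y where "y = x + (-t) *\<^sub>R e"
    have dy: "dist y x = t" using ch(2) t by (simp add: y_def dist_norm)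
    then have "y \<in> V" using r t by (auto simp: dist_commute)
    moreover have "y \<bullet> e < g y"
      unfolding y_def ch(4) using x ch(3) t by (simp add: inner_diff_left)
    ultimately show "\<exists>y\<in>\<Omega>. dist y x < d" using ch(5) dy t by metis
  qed
qed

section \<open>Layers below a graph and the area density\<close>

definition graph_proj :: "'a::euclidean_space \<Rightarrow> ('a \<Rightarrow> real) \<Rightarrow> 'a \<Rightarrow> 'a" where
  "graph_proj e g x = x + (g x - x \<bullet> e) *\<^sub>R e"

text \<open>The projection is constant on lines parallel to \<open>e\<close>, and on each such line
  both weights have mass one: the slab by its height, and \<open>w (x \<bullet> e - g x)\<close>
  because a shift by the height of the graph does not change the integral of \<open>w\<close>. All
  profiles of mass one thus have the same image on the graph, so a thin layer is compared with the
  slab of the surface measure without any error term.\<close>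

lemma graph_layer_distr:
  fixes e :: "'a::euclidean_space" and w :: "real \<Rightarrow> ennreal"
  assumes e: "norm e = 1" and inv: "\<And>x t. g (x + t *\<^sub>R e) = g x"
    and g [measurable]: "g \<in> borel_measurable borel"
    and w [measurable]: "w \<in> borel_measurable borel" and w1: "(\<integral>\<^sup>+t. w t \<partial>lborel) = 1"
  shows "distr (density lborel (\<lambda>x. w (x \<bullet> e - g x))) borel (graph_proj e g) =
    distr (density lborel (indicator {x. 0 \<le> x \<bullet> e \<and> x \<bullet> e \<le> 1})) borel (graph_proj e g)"
    (is "distr (density _ ?w) _ ?P = distr (density _ (indicator ?S)) _ _")
proof (rule measure_eqI)
  have ee: "e \<bullet> e = 1" using e by (simp add: norm_eq_1)
  have [measurable]: "?P \<in> borel_measurable borel"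
    unfolding graph_proj_def by measurable
  have [measurable]: "?S \<in> sets borel" by measurable
  fix A assume "A \<in> sets (distr (density lborel ?w) borel ?P)"
  then have A [measurable]: "A \<in> sets borel" by simp
  have [measurable]: "?P -` A \<in> sets borel"
    using measurable_sets[of ?P borel borel A] by simp
  have Pinv: "?P (x + t *\<^sub>R e) = ?P x" for x t
    by (simp add: graph_proj_def inv inner_add_left ee algebra_simps)
  have w1': "(\<integral>\<^sup>+t. w (t + c) \<partial>lborel) = 1" for c
    using w1 nn_integral_lborel_translate[of w c] by simp
  have "emeasure (distr (density lborel ?w) borel ?P) A =
      (\<integral>\<^sup>+x. w (x \<bullet> e - g x) * indicator A (?P x) \<partial>lborel)"
    by (simp add: emeasure_distr emeasure_density indicator_vimage[symmetric] comp_def)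
  also have "\<dots> = (\<integral>\<^sup>+x. indicator ?S x *
      (\<integral>\<^sup>+t. w ((x + t *\<^sub>R e) \<bullet> e - g (x + t *\<^sub>R e)) * indicator A (?P (x + t *\<^sub>R e)) \<partial>lborel) \<partial>lborel)"
    by (rule nn_integral_unit_slab[OF e]) measurable
  also have "\<dots> = (\<integral>\<^sup>+x. indicator ?S x * indicator A (?P x) \<partial>lborel)"
  proof (rule nn_integral_cong)
    fix x
    have "(\<integral>\<^sup>+t. w ((x + t *\<^sub>R e) \<bullet> e - g (x + t *\<^sub>R e)) * indicator A (?P (x + t *\<^sub>R e)) \<partial>lborel)
      = (\<integral>\<^sup>+t. w (t + (x \<bullet> e - g x)) * indicator A (?P x) \<partial>lborel)"
      unfolding inv Pinv by (simp add: inner_add_left ee add_ac algebra_simps)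
    also have "\<dots> = indicator A (?P x)"
      by (subst nn_integral_multc) (simp_all add: w1')
    finally show "indicator ?S x * (\<integral>\<^sup>+t. w ((x + t *\<^sub>R e) \<bullet> e - g (x + t *\<^sub>R e)) * indicator A (?P (x + t *\<^sub>R e)) \<partial>lborel)
      = indicator ?S x * indicator A (?P x)" by simp
  qed
  also have "\<dots> = emeasure (distr (density lborel (indicator ?S)) borel ?P) A"
    by (simp add: emeasure_distr emeasure_density indicator_vimage[symmetric] comp_def)
  finally show "emeasure (distr (density lborel ?w) borel ?P) A =
    emeasure (distr (density lborel (indicator ?S)) borel ?P) A" .
qed simp

text \<open>One choice of \<open>T\<close>, \<open>\<Gamma>\<close> and \<open>L\<close> is fixed
  per chart. \<open>\<Gamma>\<close> stands in for \<open>grad UNIV g\<close>, with which it agrees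
  on \<open>T\<close>, because its measurability, bound and invariance hold at every point.\<close>

locale graph_chart =
  fixes \<Omega> V :: "(real^'d) set" and e :: "real^'d" and g :: "real^'d \<Rightarrow> real"
    and T :: "(real^'d) set" and \<Gamma> :: "real^'d \<Rightarrow> real^'d" and L :: real
  assumes chart: "lipschitz_chart \<Omega> V e g" and open_\<Omega>: "open \<Omega>"
    and T_borel [measurable]: "T \<in> sets borel" and AE_T: "AE x in lborel. x \<in> T"
    and T_inv: "\<And>x t. x + t *\<^sub>R e \<in> T \<longleftrightarrow> x \<in> T"
    and g_deriv: "\<And>x. x \<in> T \<Longrightarrow> (g has_derivative (\<lambda>h. \<Gamma> x \<bullet> h)) (at x)"
    and grad_g: "\<And>x. x \<in> T \<Longrightarrow> grad UNIV g x = \<Gamma> x"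
    and \<Gamma>_borel [measurable]: "\<Gamma> \<in> borel_measurable borel"
    and \<Gamma>_orth: "\<And>x. \<Gamma> x \<bullet> e = 0"
    and \<Gamma>_inv: "\<And>x t. \<Gamma> (x + t *\<^sub>R e) = \<Gamma> x"
    and \<Gamma>_bound: "\<And>x i. \<bar>\<Gamma> x $ i\<bar> \<le> L"
    and g_lip: "L-lipschitz_on UNIV g"
begin

lemmas chartD = lipschitz_chartD[OF chart]

abbreviation P :: "real^'d \<Rightarrow> real^'d" where "P \<equiv> graph_proj e g"

abbreviation slab :: "(real^'d) set" where "slab \<equiv> {x. 0 \<le> x \<bullet> e \<and> x \<bullet> e \<le> 1}"

text \<open>The area density of the graph. It is also the length of \<open>e - \<Gamma> x\<close>,
  so in a flux integral the area factor cancels against the normalisation of the normal.\<close>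

definition J :: "real^'d \<Rightarrow> real" where "J x = sqrt (1 + (norm (\<Gamma> x))\<^sup>2)"

lemma g_borel [measurable]: "g \<in> borel_measurable borel"
  using chartD(6) by (rule borel_measurable_continuous_onI)

lemma V_borel [measurable]: "V \<in> sets borel"
  using chartD(1) by simp

lemma P_cont: "continuous_on UNIV P"
  unfolding graph_proj_def using chartD(6) by (intro continuous_intros)

lemma P_borel [measurable]: "P \<in> borel_measurable borel"
  using P_cont by (rule borel_measurable_continuous_onI)

lemma J_borel [measurable]: "J \<in> borel_measurable borel"
  unfolding J_def by measurable

lemma J_ge_1: "J x \<ge> 1"
  by (simp add: J_def)

lemma J_pos: "J x > 0"
  using J_ge_1[of x] by linarith

lemma T_P: "P x \<in> T \<longleftrightarrow> x \<in> T"
  by (simp only: graph_proj_def T_inv)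

lemma \<Gamma>_P: "\<Gamma> (P x) = \<Gamma> x"
  by (simp only: graph_proj_def \<Gamma>_inv)

lemma J_P: "J (P x) = J x"
  by (simp add: J_def \<Gamma>_P)

lemma J_le: "J x \<le> sqrt (1 + (real CARD('d) * L)\<^sup>2)"
proof -
  have "norm (\<Gamma> x) \<le> (\<Sum>i\<in>UNIV. \<bar>\<Gamma> x $ i\<bar>)" by (rule norm_le_l1_cart)
  also have "\<dots> \<le> (\<Sum>i\<in>(UNIV::'d set). L)" by (intro sum_mono \<Gamma>_bound)
  finally have "norm (\<Gamma> x) \<le> real CARD('d) * L" by simp
  then show ?thesis unfolding J_def by (intro real_sqrt_le_mono add_left_mono power_mono) auto
qed

end

lemma lipschitz_chart_imp_graph_chart:
  assumes "lipschitz_chart \<Omega> V e g" "open \<Omega>"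
  obtains T \<Gamma> L where "graph_chart \<Omega> V e g T \<Gamma> L"
  by (rule lipschitz_chart_gradient[OF assms(1)]) (rule that, rule graph_chart.intro, (assumption | rule assms)+)

section \<open>Surface integrals as averages over layers\<close>

locale surface_chart = graph_chart \<Omega> V e g T \<Gamma> L
  for \<Omega> V :: "(real^'d) set" and e g T \<Gamma> L +
  fixes \<sigma>\<^sub>0 :: "(real^'d) measure"
  assumes sets_\<sigma>\<^sub>0 [measurable_cong]: "sets \<sigma>\<^sub>0 = sets borel"
    and off_frontier: "emeasure \<sigma>\<^sub>0 (- frontier \<Omega>) = 0"
    and chart_area: "\<And>A. A \<in> sets borel \<Longrightarrow> A \<subseteq> V \<Longrightarrow>
      emeasure \<sigma>\<^sub>0 (A \<inter> frontier \<Omega>) =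
        (\<integral>\<^sup>+ x \<in> {x. 0 \<le> x \<bullet> e \<and> x \<bullet> e \<le> 1}. indicator A (x + (g x - x \<bullet> e) *\<^sub>R e) *
            ennreal (sqrt (1 + (norm (grad UNIV g x))\<^sup>2)) \<partial>lborel)"
begin

lemma measurable_\<sigma>\<^sub>0: "f \<in> borel_measurable borel \<Longrightarrow> f \<in> borel_measurable \<sigma>\<^sub>0"
  by (simp only: measurable_cong_sets[OF sets_\<sigma>\<^sub>0 refl])

lemma AE_frontier: "AE z in \<sigma>\<^sub>0. z \<in> frontier \<Omega>"
  by (rule AE_I[where N = "- frontier \<Omega>"]) (use off_frontier in \<open>auto simp: sets_\<sigma>\<^sub>0\<close>)

text \<open>The area formula for sets becomes an equality of measures, so that integrals can be
  transformed as well. \<open>chart_area\<close> speaks of subsets of \<open>V\<close> only, hence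
  the restriction by \<open>indicator V\<close> on both sides; \<open>grad UNIV g\<close> may be
  replaced by \<open>\<Gamma>\<close> since they differ on a null set at most.\<close>

lemma surface_density:
  "density \<sigma>\<^sub>0 (\<lambda>z. ennreal (indicator V z)) =
    distr (density lborel (\<lambda>x. ennreal (indicator slab x * indicator V (P x) * J x))) borel P"
    (is "?L = ?R")
proof (rule measure_eqI)
  fix A assume "A \<in> sets ?L"
  then have A [measurable]: "A \<in> sets borel" by (simp add: sets_\<sigma>\<^sub>0)
  have [measurable]: "P -` A \<in> sets borel"
    using measurable_sets[of P borel borel A] by simp
  have "emeasure ?L A = (\<integral>\<^sup>+z. indicator (A \<inter> V) z \<partial>\<sigma>\<^sub>0)"
  proof (subst emeasure_density)
    show "(\<lambda>z. ennreal (indicator V z)) \<in> borel_measurable \<sigma>\<^sub>0"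
      by (rule measurable_\<sigma>\<^sub>0) measurable
    show "A \<in> sets \<sigma>\<^sub>0" by (simp add: sets_\<sigma>\<^sub>0)
    show "(\<integral>\<^sup>+z. ennreal (indicator V z) * indicator A z \<partial>\<sigma>\<^sub>0) = (\<integral>\<^sup>+z. indicator (A \<inter> V) z \<partial>\<sigma>\<^sub>0)"
      by (rule nn_integral_cong) (auto split: split_indicator)
  qed
  also have "\<dots> = (\<integral>\<^sup>+z. indicator (A \<inter> V \<inter> frontier \<Omega>) z \<partial>\<sigma>\<^sub>0)"
    using AE_frontier by (intro nn_integral_cong_AE) (auto simp: indicator_def)
  also have "\<dots> = emeasure \<sigma>\<^sub>0 (A \<inter> V \<inter> frontier \<Omega>)"
    by (intro nn_integral_indicator) (simp add: sets_\<sigma>\<^sub>0)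
  also have "\<dots> = (\<integral>\<^sup>+ x. indicator (A \<inter> V) (P x) *
            ennreal (sqrt (1 + (norm (grad UNIV g x))\<^sup>2)) * indicator slab x \<partial>lborel)"
    by (subst chart_area) (auto simp: graph_proj_def)
  also have "\<dots> = (\<integral>\<^sup>+ x. ennreal (indicator slab x * indicator V (P x) * J x) * indicator (P -` A) x \<partial>lborel)"
    using AE_T by (intro nn_integral_cong_AE) (auto simp: indicator_def grad_g J_def)
  also have "\<dots> = emeasure ?R A"
    by (simp add: emeasure_distr emeasure_density)
  finally show "emeasure ?L A = emeasure ?R A" .
qed (simp add: sets_\<sigma>\<^sub>0)

text \<open>Dividing by \<open>J\<close> removes the area density, which leaves the plain slab; by
  \<open>graph_layer_distr\<close> the slab may then be exchanged for any profile \<open>w\<close>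
  of mass one. The quotient \<open>q z / J z\<close> is the form in which the component of the
  normal \<open>(e - \<Gamma>) / J\<close> will enter.\<close>

lemma surface_integral:
  fixes q :: "real^'d \<Rightarrow> real" and w :: "real \<Rightarrow> real"
  assumes q [measurable]: "q \<in> borel_measurable borel"
    and w [measurable]: "w \<in> borel_measurable borel" and w0: "\<And>t. w t \<ge> 0"
    and w1: "(\<integral>\<^sup>+t. ennreal (w t) \<partial>lborel) = 1"
  shows "integrable \<sigma>\<^sub>0 (\<lambda>z. indicator V z * (q z / J z)) \<longleftrightarrow>
      integrable lborel (\<lambda>x. w (x \<bullet> e - g x) * (indicator V (P x) * q (P x)))"
    and "(\<integral>z. indicator V z * (q z / J z) \<partial>\<sigma>\<^sub>0) =
      (\<integral>x. w (x \<bullet> e - g x) * (indicator V (P x) * q (P x)) \<partial>lborel)"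
proof -
  let ?Q = "\<lambda>z. indicator V z * q z"
  let ?D = "density lborel (\<lambda>x. ennreal (indicator slab x * indicator V (P x) * J x))"
  have JJ: "indicator slab x * indicator V (P x) * J x * (q (P x) / J (P x)) = indicator slab x * ?Q (P x)" for x
    using J_pos[of x] by (simp add: J_P)
  have ind: "indicator slab = (\<lambda>x. ennreal (indicator slab x))"
    by (auto simp: fun_eq_iff indicator_def)
  note layer = graph_layer_distr[OF chartD(2,4) g_borel, of "\<lambda>t. ennreal (w t)"]
  have lay: "distr (density lborel (\<lambda>x. ennreal (w (x \<bullet> e - g x)))) borel P =
      distr (density lborel (\<lambda>x. ennreal (indicator slab x))) borel P"
    using layer w1 ind by simp
  have nn: "indicator slab x * indicator V (P x) * J x \<ge> 0" for x
    using J_pos[of x] by simp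
  have [measurable]: "q \<in> borel_measurable \<sigma>\<^sub>0" "J \<in> borel_measurable \<sigma>\<^sub>0" "V \<in> sets \<sigma>\<^sub>0"
    by (auto intro: measurable_\<sigma>\<^sub>0 simp: sets_\<sigma>\<^sub>0)
  have "integrable \<sigma>\<^sub>0 (\<lambda>z. indicator V z * (q z / J z)) \<longleftrightarrow>
      integrable (density \<sigma>\<^sub>0 (\<lambda>z. ennreal (indicator V z))) (\<lambda>z. q z / J z)"
    by (subst integrable_density) auto
  also have "\<dots> \<longleftrightarrow> integrable lborel (\<lambda>x. indicator slab x * ?Q (P x))"
    unfolding surface_density
    by (subst integrable_distr_eq, simp, measurable, subst integrable_density) (use nn JJ in auto)
  also have "\<dots> \<longleftrightarrow> integrable (distr (density lborel (\<lambda>x. ennreal (indicator slab x))) borel P) ?Q"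
    by (subst integrable_distr_eq, simp, measurable, subst integrable_density) auto
  also have "\<dots> \<longleftrightarrow> integrable lborel (\<lambda>x. w (x \<bullet> e - g x) * ?Q (P x))"
    unfolding lay[symmetric]
    by (subst integrable_distr_eq, simp, measurable, subst integrable_density) (use w0 in auto)
  finally show "integrable \<sigma>\<^sub>0 (\<lambda>z. indicator V z * (q z / J z)) \<longleftrightarrow>
      integrable lborel (\<lambda>x. w (x \<bullet> e - g x) * (indicator V (P x) * q (P x)))" .
  have "(\<integral>z. indicator V z * (q z / J z) \<partial>\<sigma>\<^sub>0) =
      (\<integral>z. q z / J z \<partial>density \<sigma>\<^sub>0 (\<lambda>z. ennreal (indicator V z)))"
    by (subst integral_density) auto
  also have "\<dots> = (\<integral>x. indicator slab x * ?Q (P x) \<partial>lborel)"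
    unfolding surface_density
    by (subst integral_distr, simp, measurable, subst integral_density) (use nn JJ in auto)
  also have "\<dots> = (\<integral>z. ?Q z \<partial>distr (density lborel (\<lambda>x. ennreal (indicator slab x))) borel P)"
    by (subst integral_distr, simp, measurable, subst integral_density) auto
  also have "\<dots> = (\<integral>x. w (x \<bullet> e - g x) * ?Q (P x) \<partial>lborel)"
    unfolding lay[symmetric]
    by (subst integral_distr, simp, measurable, subst integral_density) (use w0 in auto)
  finally show "(\<integral>z. indicator V z * (q z / J z) \<partial>\<sigma>\<^sub>0) =
      (\<integral>x. w (x \<bullet> e - g x) * (indicator V (P x) * q (P x)) \<partial>lborel)" .
qed

text \<open>By \<open>T_P\<close> the projection maps points of \<open>T\<close> to points of
  \<open>T\<close>, so \<open>T\<close> is conull on the part of the surface in \<open>V\<close>,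
  and the pointwise formula for the normal applies there.\<close>

lemma AE_outward_normal:
  "AE z in \<sigma>\<^sub>0. z \<in> V \<longrightarrow> outward_normal \<Omega> z = (1 / J z) *\<^sub>R (e - \<Gamma> z)"
proof -
  have "AE z in density \<sigma>\<^sub>0 (\<lambda>z. ennreal (indicator V z)). z \<in> T"
    unfolding surface_density
    by (subst AE_distr_iff, simp, simp, subst AE_density, measurable) (use AE_T in \<open>auto simp: T_P\<close>)
  then have "AE z in \<sigma>\<^sub>0. z \<in> V \<longrightarrow> z \<in> T"
    by (subst (asm) AE_density, intro measurable_\<sigma>\<^sub>0, measurable) (auto simp: indicator_def elim!: eventually_mono)
  with AE_frontier show ?thesis
  proof eventually_elim
    case (elim z)
    then show ?case
      using chart_outward_normal[OF chart _ chart_frontier_eq[OF chart open_\<Omega>] g_deriv \<Gamma>_orth]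
      by (auto simp: J_def)
  qed
qed

lemma dist_graph_proj: "dist x (P x) = \<bar>g x - x \<bullet> e\<bar>"
  by (simp add: graph_proj_def dist_norm chartD)

lemma P_inner: "P x \<bullet> e = g x" "g (P x) = g x"
  by (simp_all add: graph_proj_def chartD inner_add_left)

text \<open>The area density is bounded in terms of the Lipschitz constant, and the points of the
  slab that project into the ball form a bounded set, since both \<open>x \<bullet> e\<close> and
  the height \<open>P x \<bullet> e\<close> are bounded there.\<close>

lemma emeasure_cball_finite:
  assumes "cball a r \<subseteq> V"
  shows "emeasure \<sigma>\<^sub>0 (cball a r) < \<infinity>"
proof -
  define B where "B = sqrt (1 + (real CARD('d) * L)\<^sup>2)"
  \<comment> \<open>The point \<open>P x\<close> is within \<open>\<bar>r\<bar>\<close> of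
    \<open>a\<close>, and \<open>x\<close> is within \<open>norm a + \<bar>r\<bar> + 1\<close> of
    \<open>P x\<close>; the radius is the sum of the two.\<close>
  define R where "R = norm a + 2 * \<bar>r\<bar> + 1"
  have B: "J x \<le> B" for x unfolding B_def by (rule J_le)
  then have B0: "B \<ge> 0" using J_pos[of 0] B[of 0] by linarith
  have [measurable]: "P -` cball a r \<in> sets borel"
    using measurable_sets[of P borel borel "cball a r"] by simp
  have R: "x \<in> cball a R" if "x \<in> slab" "P x \<in> cball a r" for x
  proof -
    have d: "dist (P x) a \<le> r" using that by (simp add: dist_commute)
    have "\<bar>P x \<bullet> e\<bar> \<le> norm (P x)" using Cauchy_Schwarz_ineq2[of "P x" e] chartD(2) by simp
    also have "norm (P x) \<le> norm a + \<bar>r\<bar>" using norm_triangle_sub[of "P x" a] d by (simp add: dist_norm)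
    finally have "dist x (P x) \<le> norm a + \<bar>r\<bar> + 1"
      using that(1) unfolding dist_graph_proj P_inner(1) by auto
    then show ?thesis using dist_triangle[of x a "P x"] d by (simp add: R_def dist_commute)
  qed
  have "emeasure \<sigma>\<^sub>0 (cball a r) = emeasure (density \<sigma>\<^sub>0 (\<lambda>z. ennreal (indicator V z))) (cball a r)"
  proof (subst emeasure_density)
    show "emeasure \<sigma>\<^sub>0 (cball a r) = (\<integral>\<^sup>+z. ennreal (indicator V z) * indicator (cball a r) z \<partial>\<sigma>\<^sub>0)"
    proof -
      have "emeasure \<sigma>\<^sub>0 (cball a r) = (\<integral>\<^sup>+z. indicator (cball a r) z \<partial>\<sigma>\<^sub>0)"
        by (rule nn_integral_indicator[symmetric]) (simp add: sets_\<sigma>\<^sub>0)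
      also have "\<dots> = (\<integral>\<^sup>+z. ennreal (indicator V z) * indicator (cball a r) z \<partial>\<sigma>\<^sub>0)"
        using assms by (intro nn_integral_cong) (auto split: split_indicator)
      finally show ?thesis .
    qed
  qed (auto simp: sets_\<sigma>\<^sub>0 intro!: measurable_\<sigma>\<^sub>0)
  also have "\<dots> = (\<integral>\<^sup>+x. ennreal (indicator slab x * indicator V (P x) * J x) * indicator (P -` cball a r) x \<partial>lborel)"
    unfolding surface_density by (simp add: emeasure_distr emeasure_density)
  also have "\<dots> \<le> (\<integral>\<^sup>+x. ennreal B * indicator (cball a R) x \<partial>lborel)"
    using B B0 R by (intro nn_integral_mono) (auto split: split_indicator intro: ennreal_leI)
  also have "\<dots> = ennreal B * emeasure lborel (cball a R)"
    by (simp add: nn_integral_cmult_indicator)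
  also have "\<dots> < \<infinity>"
    using emeasure_lborel_cball_finite[of a R] by (simp add: ennreal_mult_less_top)
  finally show ?thesis .
qed

end

section \<open>Functions that are continuously differentiable up to the boundary\<close>

locale lipschitz_domain =
  fixes \<Omega> :: "(real^'d) set"
  assumes domain: "bounded_lipschitz_domain \<Omega>"
begin

lemma open_\<Omega>: "open \<Omega>" and bounded_\<Omega>: "bounded \<Omega>"
  and charts: "\<And>x. x \<in> frontier \<Omega> \<Longrightarrow> \<exists>V e g. x \<in> V \<and> lipschitz_chart \<Omega> V e g"
  using domain by (auto simp: bounded_lipschitz_domain_def)

lemma compact_closure_\<Omega>: "compact (closure \<Omega>)"
  using bounded_\<Omega> by (simp add: compact_closure)

text \<open>Every point of the closure admits an open set of directions in which a short segment
  stays in the closure: a ball of directions in the interior, a cone around \<open>-e\<close> at the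
  frontier. This is what forces derivatives taken within the closure to be unique.\<close>

lemma closure_cone:
  assumes x: "x \<in> closure \<Omega>"
  obtains W where "open W" "W \<noteq> {}"
    "\<And>v. v \<in> W \<Longrightarrow> \<exists>t>0. \<forall>s\<in>{0..t}. x + s *\<^sub>R v \<in> closure \<Omega>"
proof (cases "x \<in> \<Omega>")
  case True
  then obtain r where r: "r > 0" "ball x r \<subseteq> \<Omega>" using open_\<Omega> open_contains_ball by blast
  show thesis
  proof (rule that[of "ball 0 1"])
    fix v :: "real^'d" assume "v \<in> ball 0 1"
    then have v: "norm v < 1" by simp
    have "x + s *\<^sub>R v \<in> closure \<Omega>" if "s \<in> {0..r/2}" for s
    proof -
      have "norm (s *\<^sub>R v) \<le> (r/2) * 1"
        unfolding norm_scaleR using that v by (intro mult_mono) auto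
      then have "x + s *\<^sub>R v \<in> ball x r" using r by (simp add: dist_norm)
      then show ?thesis using r closure_subset by blast
    qed
    then show "\<exists>t>0. \<forall>s\<in>{0..t}. x + s *\<^sub>R v \<in> closure \<Omega>" using r by (intro exI[of _ "r/2"]) auto
  qed auto
next
  case False
  then have fr: "x \<in> frontier \<Omega>" using x open_\<Omega> by (simp add: frontier_def interior_open)
  obtain V e g where xV: "x \<in> V" and chart: "lipschitz_chart \<Omega> V e g" using charts[OF fr] by blast
  note ch = lipschitz_chartD[OF chart]
  obtain L where L: "L-lipschitz_on UNIV g" using chart by (auto simp: lipschitz_chart_def)
  obtain r where r: "r > 0" "ball x r \<subseteq> V" using ch(1) xV open_contains_ball by blast
  \<comment> \<open>Directions whose descent along \<open>e\<close> strictly exceeds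
    \<open>L\<close> times the length of their part orthogonal to \<open>e\<close>: the Lipschitz
    graph cannot fall below them.\<close>
  define W where "W = {v. v \<bullet> e + L * norm (v + (- (v \<bullet> e)) *\<^sub>R e) < 0}"
  show thesis
  proof (rule that[of W])
    show "open W" unfolding W_def by (intro open_Collect_less continuous_intros)
    have "- e \<in> W" using ch(3) by (simp add: W_def)
    then show "W \<noteq> {}" by blast
  next
    fix v assume v: "v \<in> W"
    define t where "t = r / (2 * (norm v + 1))"
    have half: "m > 0 \<Longrightarrow> r / (2 * m) * m = r / 2" for m :: real by simp
    have n1: "norm v + 1 > 0" by (simp add: add_nonneg_pos)
    have t: "t > 0" using r n1 by (simp add: t_def)
    have tv: "t * norm v < r"
    proof -
      have "t * norm v \<le> t * (norm v + 1)" using t by simp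
      also have "\<dots> = r / 2" unfolding t_def using n1 half by blast
      finally show ?thesis using r by simp
    qed
    have "x + s *\<^sub>R v \<in> closure \<Omega>" if s: "s \<in> {0..t}" for s
    proof (cases "s = 0")
      case False
      then have s0: "s > 0" using s by simp
      have "norm (s *\<^sub>R v) \<le> t * norm v" using s by (simp add: mult_right_mono)
      then have V: "x + s *\<^sub>R v \<in> V" using r tv by (auto simp: dist_norm subset_iff)
      have "g (x + s *\<^sub>R v) = g ((x + s *\<^sub>R v) + (- (s * (v \<bullet> e))) *\<^sub>R e)" by (simp only: ch(4))
      also have "\<dots> = g (x + s *\<^sub>R (v + (- (v \<bullet> e)) *\<^sub>R e))" by (simp add: algebra_simps)
      finally have g1: "g (x + s *\<^sub>R v) = g (x + s *\<^sub>R (v + (- (v \<bullet> e)) *\<^sub>R e))" .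
      have "dist (g (x + s *\<^sub>R v)) (g x) \<le> L * (s * norm (v + (- (v \<bullet> e)) *\<^sub>R e))"
        unfolding g1
        using lipschitz_onD[OF L, of "x + s *\<^sub>R (v + (- (v \<bullet> e)) *\<^sub>R e)" x] s0
        by (simp add: dist_norm)
      then have "g x - g (x + s *\<^sub>R v) \<le> s * (L * norm (v + (- (v \<bullet> e)) *\<^sub>R e))"
        by (simp add: dist_real_def abs_le_iff ac_simps)
      also have "\<dots> < s * (- (v \<bullet> e))"
        using v s0 by (intro mult_strict_left_mono) (auto simp: W_def)
      finally have "(x + s *\<^sub>R v) \<bullet> e < g (x + s *\<^sub>R v)"
        using chart_frontier_eq[OF chart open_\<Omega> fr xV] by (simp add: inner_add_left)
      then show ?thesis using ch(5)[OF V] closure_subset by blast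
    qed (use x in simp)
    then show "\<exists>t>0. \<forall>s\<in>{0..t}. x + s *\<^sub>R v \<in> closure \<Omega>" using t by blast
  qed
qed

text \<open>In the directions of the cone two derivatives agree by uniqueness of the one-sided
  derivative on an interval, and a linear map is determined by its values on a nonempty open set.
  This makes \<open>deriv_cl\<close>, which rests on a choice among derivatives, computable at
  boundary points.\<close>

lemma has_derivative_closure_unique:
  fixes f :: "real^'d \<Rightarrow> 'b::real_normed_vector"
  assumes x: "x \<in> closure \<Omega>"
    and D: "(f has_derivative D) (at x within closure \<Omega>)" "(f has_derivative D') (at x within closure \<Omega>)"
  shows "D = D'"
proof -
  obtain W where W: "open W" "W \<noteq> {}"
    "\<And>v. v \<in> W \<Longrightarrow> \<exists>t>0. \<forall>s\<in>{0..t}. x + s *\<^sub>R v \<in> closure \<Omega>"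
    using closure_cone[OF x] by blast
  have eq: "D v = D' v" if v: "v \<in> W" for v
  proof -
    obtain t where t: "t > 0" "\<And>s. s \<in> {0..t} \<Longrightarrow> x + s *\<^sub>R v \<in> closure \<Omega>" using W(3)[OF v] by blast
    have line: "((\<lambda>s. f (x + s *\<^sub>R v)) has_vector_derivative E v) (at 0 within {0..t})"
      if "(f has_derivative E) (at x within closure \<Omega>)" for E
    proof -
      have "(f has_derivative E) (at (x + 0 *\<^sub>R v) within (\<lambda>s. x + s *\<^sub>R v) ` {0..t})"
        using t by (intro has_derivative_subset[OF _ image_subsetI]) (use that in auto)
      moreover have "((\<lambda>s. x + s *\<^sub>R v) has_derivative (\<lambda>s. s *\<^sub>R v)) (at 0 within {0..t})"
        by (auto intro!: derivative_eq_intros)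
      ultimately have "((\<lambda>s. f (x + s *\<^sub>R v)) has_derivative (\<lambda>s. E (s *\<^sub>R v))) (at 0 within {0..t})"
        by (rule has_derivative_in_compose[rotated])
      then show ?thesis
        using linear_scale[OF has_derivative_linear[OF that]] by (simp add: has_vector_derivative_def)
    qed
    show ?thesis
      by (rule vector_derivative_unique_within_closed_interval[of 0 t 0])
        (use t line D in \<open>auto simp: cbox_interval\<close>)
  qed
  obtain v r where v: "v \<in> W" and r: "r > 0" "ball v r \<subseteq> W" using W open_contains_ball by blast
  note lin = has_derivative_linear[OF D(1)] has_derivative_linear[OF D(2)]
  show ?thesis
  proof
    fix h :: "real^'d"
    \<comment> \<open>\<open>s\<close> shrinks \<open>h\<close> so that
      \<open>v + s *\<^sub>R h\<close> stays in the ball around \<open>v\<close>; the added 1 admits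
      \<open>h = 0\<close>.\<close>
    define s where "s = r / (2 * (norm h + 1))"
    have half: "m > 0 \<Longrightarrow> r / (2 * m) * m = r / 2" for m :: real by simp
    have n1: "norm h + 1 > 0" by (simp add: add_nonneg_pos)
    have s: "s > 0" using r n1 by (simp add: s_def)
    have "s * norm h \<le> s * (norm h + 1)" using s by simp
    also have "\<dots> = r / 2" unfolding s_def using n1 half by blast
    finally have "v + s *\<^sub>R h \<in> W" using r s by (auto simp: dist_norm subset_iff)
    then have "D (v + s *\<^sub>R h) = D' (v + s *\<^sub>R h)" "D v = D' v" using eq v by auto
    then have "s *\<^sub>R D h = s *\<^sub>R D' h"
      by (simp add: linear_add[OF lin(1)] linear_add[OF lin(2)] linear_scale[OF lin(1)] linear_scale[OF lin(2)])
    then show "D h = D' h" using s by simp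
  qed
qed

lemma deriv_cl_eqI:
  assumes "x \<in> closure \<Omega>" "(f has_derivative D) (at x within closure \<Omega>)"
  shows "deriv_cl \<Omega> f x = D"
proof -
  have "f differentiable (at x within closure \<Omega>)" using assms(2) by (rule differentiableI)
  then have "(f has_derivative deriv_cl \<Omega> f x) (at x within closure \<Omega>)"
    unfolding deriv_cl_def frechet_derivative_works .
  then show ?thesis using assms has_derivative_closure_unique by blast
qed

lemma C1_cl_has_derivative:
  assumes "C1_cl \<Omega> f" "x \<in> closure \<Omega>"
  shows "(f has_derivative (\<lambda>h. grad \<Omega> f x \<bullet> h)) (at x within closure \<Omega>)"
proof -
  have d: "(f has_derivative deriv_cl \<Omega> f x) (at x within closure \<Omega>)"
    using assms unfolding C1_cl_def deriv_cl_def frechet_derivative_works[symmetric] by blast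
  have "deriv_cl \<Omega> f x = (\<lambda>h. grad \<Omega> f x \<bullet> h)"
    unfolding grad_def pderiv_cl_def
    by (intro ext linear_eq_inner_axis has_derivative_linear[OF d])
  with d show ?thesis by simp
qed

lemma deriv_cl_C1: "C1_cl \<Omega> f \<Longrightarrow> x \<in> closure \<Omega> \<Longrightarrow> deriv_cl \<Omega> f x h = grad \<Omega> f x \<bullet> h"
  using deriv_cl_eqI[OF _ C1_cl_has_derivative] by metis

lemma C1_cl_has_derivative_interior:
  assumes "C1_cl \<Omega> f" "x \<in> \<Omega>"
  shows "(f has_derivative (\<lambda>h. grad \<Omega> f x \<bullet> h)) (at x)"
proof -
  have "x \<in> interior (closure \<Omega>)"
    using interior_maximal[OF closure_subset open_\<Omega>] assms(2) by (rule subsetD)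
  then have "at x within closure \<Omega> = at x" by (rule at_within_interior)
  moreover have "x \<in> closure \<Omega>" using assms(2) closure_subset by blast
  ultimately show ?thesis using C1_cl_has_derivative[OF assms(1), of x] by simp
qed

section \<open>Differentiation rules up to the boundary\<close>

lemma grad_nth: "grad \<Omega> f x $ i = pderiv_cl \<Omega> i f x"
  by (simp add: grad_def)

lemma C1_cl_continuous: "C1_cl \<Omega> f \<Longrightarrow> continuous_on (closure \<Omega>) f"
  unfolding continuous_on_eq_continuous_within
  using C1_cl_has_derivative has_derivative_continuous by blast

lemma C1_cl_pderiv_continuous: "C1_cl \<Omega> f \<Longrightarrow> continuous_on (closure \<Omega>) (pderiv_cl \<Omega> i f)"
  by (simp add: C1_cl_def)

lemma C1_cl_grad_continuous: "C1_cl \<Omega> f \<Longrightarrow> continuous_on (closure \<Omega>) (grad \<Omega> f)"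
  unfolding grad_def by (intro continuous_intros C1_cl_pderiv_continuous)

text \<open>Uniqueness of the derivative lets one exhibited continuous field both prove smoothness
  and identify the gradient. The rules for sums, products and inverses below come from it.\<close>

lemma C1_cl_intro:
  assumes D: "\<And>x. x \<in> closure \<Omega> \<Longrightarrow> (f has_derivative (\<lambda>h. G x \<bullet> h)) (at x within closure \<Omega>)"
    and G: "continuous_on (closure \<Omega>) G"
  shows "C1_cl \<Omega> f" and "\<And>x. x \<in> closure \<Omega> \<Longrightarrow> grad \<Omega> f x = G x"
proof -
  have p: "pderiv_cl \<Omega> i f x = G x $ i" if "x \<in> closure \<Omega>" for i x
    using deriv_cl_eqI[OF that D[OF that]] by (simp add: pderiv_cl_def inner_axis)
  show "grad \<Omega> f x = G x" if "x \<in> closure \<Omega>" for x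
    using p[OF that] by (simp add: grad_def)
  show "C1_cl \<Omega> f"
    unfolding C1_cl_def
  proof (intro conjI ballI allI)
    show "f differentiable (at x within closure \<Omega>)" if "x \<in> closure \<Omega>" for x
      using D[OF that] by (auto simp: differentiable_def)
    show "continuous_on (closure \<Omega>) (pderiv_cl \<Omega> i f)" for i
      by (rule continuous_on_eq[of _ "\<lambda>x. G x $ i"]) (use G p in \<open>auto intro!: continuous_intros\<close>)
  qed
qed

text \<open>Derivatives are taken within the closure, so values elsewhere are irrelevant even at
  boundary points. It is needed for second derivatives, where first derivatives are identified on
  the closure only.\<close>

lemma C1_cl_cong:
  assumes "C1_cl \<Omega> f" "\<And>x. x \<in> closure \<Omega> \<Longrightarrow> f' x = f x"
  shows "C1_cl \<Omega> f'" "\<And>x. x \<in> closure \<Omega> \<Longrightarrow> grad \<Omega> f' x = grad \<Omega> f x"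
proof -
  have "(f' has_derivative (\<lambda>h. grad \<Omega> f x \<bullet> h)) (at x within closure \<Omega>)" if "x \<in> closure \<Omega>" for x
    by (rule has_derivative_transform[OF that _ C1_cl_has_derivative[OF assms(1) that]]) (use assms in auto)
  from C1_cl_intro[OF this C1_cl_grad_continuous[OF assms(1)]]
  show "C1_cl \<Omega> f'" "\<And>x. x \<in> closure \<Omega> \<Longrightarrow> grad \<Omega> f' x = grad \<Omega> f x" by auto
qed

lemma C1_cl_const: "C1_cl \<Omega> (\<lambda>x. c)" "x \<in> closure \<Omega> \<Longrightarrow> grad \<Omega> (\<lambda>x. c) x = 0"
  using C1_cl_intro[of "\<lambda>x. c" "\<lambda>x. 0"] by auto

lemma C1_cl_add:
  assumes "C1_cl \<Omega> f" "C1_cl \<Omega> g"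
  shows "C1_cl \<Omega> (\<lambda>x. f x + g x)"
    "\<And>x. x \<in> closure \<Omega> \<Longrightarrow> grad \<Omega> (\<lambda>x. f x + g x) x = grad \<Omega> f x + grad \<Omega> g x"
proof -
  have "((\<lambda>x. f x + g x) has_derivative (\<lambda>h. (grad \<Omega> f x + grad \<Omega> g x) \<bullet> h)) (at x within closure \<Omega>)"
    if "x \<in> closure \<Omega>" for x
    unfolding inner_add_left
    by (intro has_derivative_add C1_cl_has_derivative assms that)
  note * = C1_cl_intro[OF this]
  have "continuous_on (closure \<Omega>) (\<lambda>x. grad \<Omega> f x + grad \<Omega> g x)"
    by (intro continuous_intros C1_cl_grad_continuous assms)
  then show "C1_cl \<Omega> (\<lambda>x. f x + g x)"
    "\<And>x. x \<in> closure \<Omega> \<Longrightarrow> grad \<Omega> (\<lambda>x. f x + g x) x = grad \<Omega> f x + grad \<Omega> g x"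
    using * by auto
qed

lemma C1_cl_mult:
  assumes "C1_cl \<Omega> f" "C1_cl \<Omega> g"
  shows "C1_cl \<Omega> (\<lambda>x. f x * g x)"
    "\<And>x. x \<in> closure \<Omega> \<Longrightarrow> grad \<Omega> (\<lambda>x. f x * g x) x = g x *\<^sub>R grad \<Omega> f x + f x *\<^sub>R grad \<Omega> g x"
proof -
  have "((\<lambda>x. f x * g x) has_derivative (\<lambda>h. (g x *\<^sub>R grad \<Omega> f x + f x *\<^sub>R grad \<Omega> g x) \<bullet> h)) (at x within closure \<Omega>)"
    if "x \<in> closure \<Omega>" for x
    using has_derivative_mult[OF C1_cl_has_derivative[OF assms(1) that] C1_cl_has_derivative[OF assms(2) that]]
    by (simp add: inner_add_left algebra_simps)
  note * = C1_cl_intro[OF this]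
  have "continuous_on (closure \<Omega>) (\<lambda>x. g x *\<^sub>R grad \<Omega> f x + f x *\<^sub>R grad \<Omega> g x)"
    by (intro continuous_intros C1_cl_grad_continuous C1_cl_continuous assms)
  then show "C1_cl \<Omega> (\<lambda>x. f x * g x)"
    "\<And>x. x \<in> closure \<Omega> \<Longrightarrow> grad \<Omega> (\<lambda>x. f x * g x) x = g x *\<^sub>R grad \<Omega> f x + f x *\<^sub>R grad \<Omega> g x"
    using * by auto
qed

lemma C1_cl_inverse:
  assumes f: "C1_cl \<Omega> f" and nz: "\<And>x. x \<in> closure \<Omega> \<Longrightarrow> f x \<noteq> 0"
  shows "C1_cl \<Omega> (\<lambda>x. inverse (f x))"
proof (rule C1_cl_intro(1))
  show "((\<lambda>x. inverse (f x)) has_derivative (\<lambda>h. (- (inverse (f x) * inverse (f x)) *\<^sub>R grad \<Omega> f x) \<bullet> h)) (at x within closure \<Omega>)"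
    if "x \<in> closure \<Omega>" for x
    using Deriv.has_derivative_inverse[OF nz[OF that] C1_cl_has_derivative[OF f that]]
    by (simp add: algebra_simps)
  show "continuous_on (closure \<Omega>) (\<lambda>x. - (inverse (f x) * inverse (f x)) *\<^sub>R grad \<Omega> f x)"
    using nz by (intro continuous_intros C1_cl_grad_continuous C1_cl_continuous f) auto
qed

lemma C1_cl_cmult:
  assumes "C1_cl \<Omega> f"
  shows "C1_cl \<Omega> (\<lambda>x. c * f x)" "\<And>x. x \<in> closure \<Omega> \<Longrightarrow> grad \<Omega> (\<lambda>x. c * f x) x = c *\<^sub>R grad \<Omega> f x"
  using C1_cl_mult[OF C1_cl_const(1)[of c] assms] C1_cl_const(2)[of _ c] by auto

lemma C1_cl_sum:
  assumes "finite I" "\<And>i. i \<in> I \<Longrightarrow> C1_cl \<Omega> (f i)"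
  shows "C1_cl \<Omega> (\<lambda>x. \<Sum>i\<in>I. f i x) \<and> (\<forall>x\<in>closure \<Omega>. grad \<Omega> (\<lambda>x. \<Sum>i\<in>I. f i x) x = (\<Sum>i\<in>I. grad \<Omega> (f i) x))"
  using assms
proof (induction I rule: finite_induct)
  case empty
  then show ?case using C1_cl_const by simp
next
  case (insert i I)
  then show ?case using C1_cl_add[of "f i" "\<lambda>x. \<Sum>i\<in>I. f i x"] by simp
qed

lemma C2_clD: "C2_cl \<Omega> f \<Longrightarrow> C1_cl \<Omega> f" "C2_cl \<Omega> f \<Longrightarrow> C1_cl \<Omega> (pderiv_cl \<Omega> i f)"
  by (auto simp: C2_cl_def)

lemma C2_cl_add:
  assumes "C2_cl \<Omega> f" "C2_cl \<Omega> g"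
  shows "C2_cl \<Omega> (\<lambda>x. f x + g x)"
  unfolding C2_cl_def
proof (intro conjI allI)
  show "C1_cl \<Omega> (\<lambda>x. f x + g x)" using C1_cl_add assms C2_clD by blast
  show "C1_cl \<Omega> (pderiv_cl \<Omega> i (\<lambda>x. f x + g x))" for i
    by (rule C1_cl_cong(1)[OF C1_cl_add(1)[OF C2_clD(2)[OF assms(1), of i] C2_clD(2)[OF assms(2), of i]]])
      (simp add: grad_nth[symmetric] C1_cl_add(2) assms C2_clD)
qed

lemma C2_cl_cmult:
  assumes "C2_cl \<Omega> f"
  shows "C2_cl \<Omega> (\<lambda>x. c * f x)"
  unfolding C2_cl_def
proof (intro conjI allI)
  show "C1_cl \<Omega> (\<lambda>x. c * f x)" using C1_cl_cmult assms C2_clD by blast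
  show "C1_cl \<Omega> (pderiv_cl \<Omega> i (\<lambda>x. c * f x))" for i
    by (rule C1_cl_cong(1)[OF C1_cl_cmult(1)[OF C2_clD(2)[OF assms, of i], of c]])
      (simp add: grad_nth[symmetric] C1_cl_cmult(2) assms C2_clD)
qed

end

section \<open>The divergence theorem on Lipschitz domains\<close>

context lipschitz_domain
begin

text \<open>Extended by zero, \<open>\<eta> * f\<close> lives on a compact subset of
  \<open>\<Omega>\<close> and is Lipschitz at short distances, so its directional derivative has
  integral zero; the integrand is the product rule. The cut-off is differentiated only almost
  everywhere, as befits a clamped Lipschitz function.\<close>

lemma integral_cutoff_eq_0:
  assumes f: "C1_cl \<Omega> f" and K: "compact K" "K \<subseteq> \<Omega>"
    and \<eta>0: "\<And>x. \<bar>\<eta> x\<bar> \<le> 1" and \<eta>L: "M-lipschitz_on UNIV \<eta>"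
    and supp: "\<And>x. x \<in> \<Omega> \<Longrightarrow> x \<notin> K \<Longrightarrow> \<eta> x * f x = 0"
    and D: "AE x in lborel. x \<in> \<Omega> \<longrightarrow> ((\<lambda>t. \<eta> (x + t *\<^sub>R v)) has_real_derivative D x) (at 0)"
    and D_borel [measurable]: "D \<in> borel_measurable borel"
  shows "integrable lborel (\<lambda>x. indicator \<Omega> x * (D x * f x + \<eta> x * (grad \<Omega> f x \<bullet> v)))" (is "integrable _ ?D")
    and "(\<integral>x. indicator \<Omega> x * (D x * f x + \<eta> x * (grad \<Omega> f x \<bullet> v)) \<partial>lborel) = 0"
proof -
  note cont = continuous_on_subset[OF C1_cl_continuous[OF f] closure_subset]
    continuous_on_subset[OF C1_cl_grad_continuous[OF f] closure_subset]
  define G where "G x = (if x \<in> \<Omega> then \<eta> x * f x else 0)" for x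
  have G0: "G x = 0" if "x \<notin> K" for x using supp that by (simp add: G_def)
  obtain d where d: "d > 0" "(\<Union>x\<in>K. cball x d) \<subseteq> \<Omega>"
    using compact_subset_open_imp_cball_epsilon_subset[OF K(1) open_\<Omega> K(2)] by blast
  \<comment> \<open>The closed \<open>d\<close>-neighbourhood of \<open>K\<close>, still compact and
    inside \<open>\<Omega>\<close>: it bounds \<open>f\<close> and its gradient on every ball of
    radius \<open>d\<close> around a point of \<open>K\<close>.\<close>
  define K' where "K' = {x + y |x y. x \<in> K \<and> y \<in> cball 0 d}"
  have K': "compact K'" unfolding K'_def by (intro compact_sums K compact_cball)
  have cbK': "cball x d \<subseteq> K'" if "x \<in> K" for x
  proof
    fix y assume "y \<in> cball x d"
    then have "y = x + (y - x)" "y - x \<in> cball 0 d" by (auto simp: dist_norm norm_minus_commute)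
    then show "y \<in> K'" unfolding K'_def using that by blast
  qed
  have K'\<Omega>: "K' \<subseteq> \<Omega>"
  proof
    fix z assume "z \<in> K'"
    then obtain x y where "x \<in> K" "norm y \<le> d" "z = x + y" by (auto simp: K'_def)
    then have "z \<in> cball x d" by (simp add: dist_norm)
    then show "z \<in> \<Omega>" using d \<open>x \<in> K\<close> by blast
  qed
  have bd: "bounded (f ` K')" "bounded (grad \<Omega> f ` K')"
    using compact_continuous_image[OF continuous_on_subset[OF cont(1) K'\<Omega>] K']
      compact_continuous_image[OF continuous_on_subset[OF cont(2) K'\<Omega>] K']
    by (auto intro: compact_imp_bounded)
  obtain B1 where "\<forall>y\<in>f ` K'. norm y \<le> B1" using bd(1) unfolding bounded_iff by blast
  moreover obtain B2 where "\<forall>y\<in>grad \<Omega> f ` K'. norm y \<le> B2" using bd(2) unfolding bounded_iff by blast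
  ultimately have B: "\<And>x. x \<in> K' \<Longrightarrow> \<bar>f x\<bar> \<le> B1" "\<And>x. x \<in> K' \<Longrightarrow> norm (grad \<Omega> f x) \<le> B2"
    by simp_all
  have M: "M \<ge> 0" using \<eta>L by (rule lipschitz_on_nonneg)
  obtain a R where aR: "\<Omega> \<subseteq> cball a R" using bounded_\<Omega> bounded_subset_cball by blast
  \<comment> \<open>If neither point lies in \<open>K\<close>, both values vanish. Otherwise both
    lie in one such ball, whose convexity gives the mean value estimate for
    \<open>f\<close>.\<close>
  have lip: "\<bar>G y - G x\<bar> \<le> (\<bar>B1\<bar> * M + \<bar>B2\<bar>) * norm (y - x)" if yx: "norm (y - x) < d" for x y
  proof (cases "x \<in> K \<or> y \<in> K")
    case True
    then obtain c where c: "c \<in> K" "x \<in> cball c d" "y \<in> cball c d"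
      using yx d by (auto simp: dist_norm norm_minus_commute)
    have inK: "x \<in> K'" "y \<in> K'" using cbK'[OF c(1)] c by auto
    then have in\<Omega>: "x \<in> \<Omega>" "y \<in> \<Omega>" "x \<in> K'" using K'\<Omega> by auto
    have "norm (f y - f x) \<le> B2 * norm (y - x)"
    proof (rule differentiable_bound[of "cball c d" f "\<lambda>x h. grad \<Omega> f x \<bullet> h"])
      fix z assume z: "z \<in> cball c d"
      then have "z \<in> K'" using cbK' c by blast
      then show "(f has_derivative (\<lambda>h. grad \<Omega> f z \<bullet> h)) (at z within cball c d)"
        using C1_cl_has_derivative_interior[OF f] K'\<Omega> has_derivative_at_withinI by blast
      show "onorm (\<lambda>h. grad \<Omega> f z \<bullet> h) \<le> B2"
        using B(2)[OF \<open>z \<in> K'\<close>] Cauchy_Schwarz_ineq2[of "grad \<Omega> f z"]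
        by (intro onorm_le) (smt (verit) mult_right_mono norm_ge_zero real_norm_def)
    qed (use c in auto)
    then have 1: "\<bar>\<eta> y\<bar> * \<bar>f y - f x\<bar> \<le> 1 * (\<bar>B2\<bar> * norm (y - x))"
      using \<eta>0[of y] by (intro mult_mono) (auto intro: order_trans[OF _ mult_right_mono])
    have "\<bar>\<eta> y - \<eta> x\<bar> \<le> M * norm (y - x)"
      using lipschitz_onD[OF \<eta>L, of y x] by (simp add: dist_norm)
    then have 2: "\<bar>f x\<bar> * \<bar>\<eta> y - \<eta> x\<bar> \<le> \<bar>B1\<bar> * (M * norm (y - x))"
      using B(1)[OF in\<Omega>(3)] by (intro mult_mono) auto
    have "G y - G x = \<eta> y * (f y - f x) + f x * (\<eta> y - \<eta> x)"
      using in\<Omega> by (simp add: G_def algebra_simps)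
    then have "\<bar>G y - G x\<bar> \<le> \<bar>\<eta> y\<bar> * \<bar>f y - f x\<bar> + \<bar>f x\<bar> * \<bar>\<eta> y - \<eta> x\<bar>"
      using abs_triangle_ineq by (simp add: abs_mult[symmetric])
    then show ?thesis using 1 2 by (simp add: algebra_simps)
  next
    case False
    then show ?thesis using G0 M by simp
  qed
  have [measurable]: "\<Omega> \<in> sets borel" using open_\<Omega> by simp
  have [measurable]: "\<eta> \<in> borel_measurable borel"
    by (intro borel_measurable_continuous_onI lipschitz_on_continuous_on[OF \<eta>L])
  have m1 [measurable]: "(\<lambda>x. indicator \<Omega> x * f x) \<in> borel_measurable borel"
    using borel_measurable_continuous_on_indicator[OF _ cont(1)] open_\<Omega> by simp
  have m2 [measurable]: "(\<lambda>x. indicator \<Omega> x * (grad \<Omega> f x \<bullet> v)) \<in> borel_measurable borel"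
    using borel_measurable_continuous_on_indicator[OF _ continuous_on_inner[OF cont(2) continuous_on_const[of _ v]]] open_\<Omega> by simp
  have eq: "?D = (\<lambda>x. D x * (indicator \<Omega> x * f x) + \<eta> x * (indicator \<Omega> x * (grad \<Omega> f x \<bullet> v)))"
    by (auto simp: fun_eq_iff algebra_simps)
  have D_meas: "?D \<in> borel_measurable borel" unfolding eq by measurable
  have deriv: "AE x in lborel. ((\<lambda>t. G (x + t *\<^sub>R v)) has_real_derivative ?D x) (at 0)"
    using D
  proof eventually_elim
    case (elim x)
    have line: "((\<lambda>t. x + t *\<^sub>R v) \<longlongrightarrow> x) (at 0)" by (auto intro!: tendsto_eq_intros)
    show ?case
    proof (cases "x \<in> \<Omega>")
      case True
      have "((\<lambda>t. f (x + t *\<^sub>R v)) has_real_derivative grad \<Omega> f x \<bullet> v) (at 0)"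
        using has_real_derivative_along_line[OF C1_cl_has_derivative_interior[OF f True]] .
      from DERIV_mult[OF elim[rule_format, OF True] this]
      have der: "((\<lambda>t. \<eta> (x + t *\<^sub>R v) * f (x + t *\<^sub>R v)) has_real_derivative ?D x) (at 0)"
        using True by (simp add: algebra_simps)
      have "eventually (\<lambda>t. x + t *\<^sub>R v \<in> \<Omega>) (nhds 0)"
        using topological_tendstoD[OF line open_\<Omega> True] True
        by (simp add: eventually_nhds_conv_at)
      then have "eventually (\<lambda>t. G (x + t *\<^sub>R v) = \<eta> (x + t *\<^sub>R v) * f (x + t *\<^sub>R v)) (nhds 0)"
        by eventually_elim (simp add: G_def)
      then show ?thesis using der by (subst DERIV_cong_ev[OF refl _ refl])
    next
      case False
      then have "x \<in> - K" using K by blast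
      moreover have "open (- K)" using K compact_imp_closed by blast
      ultimately have "eventually (\<lambda>t. x + t *\<^sub>R v \<in> - K) (nhds 0)"
        using topological_tendstoD[OF line, of "- K"] by (simp add: eventually_nhds_conv_at)
      then have "eventually (\<lambda>t. G (x + t *\<^sub>R v) = 0) (nhds 0)"
        by eventually_elim (simp add: G0)
      then show ?thesis using False by (subst DERIV_cong_ev[OF refl _ refl]) auto
    qed
  qed
  have supp': "G x = 0" if "x \<notin> cball a R" for x using aR that by (auto simp: G_def)
  show "integrable lborel ?D" "integral\<^sup>L lborel ?D = 0"
    using integral_directional_derivative_eq_0[OF d(1) lip supp' D_meas deriv] by blast+
qed

end

section \<open>The layer cut-off and the divergence theorem in one chart\<close>

lemma abs_clamp_diff_le: "\<bar>max 0 (min 1 a) - max 0 (min 1 b)\<bar> \<le> \<bar>a - b\<bar>" for a b :: real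
  by (auto simp: max_def min_def)

text \<open>The profile is 1 for \<open>s \<le> - 2 / k\<close> and 0 for
  \<open>s \<ge> - 1 / k\<close>, so its slope is minus a weight of mass one. The transition ends at
  \<open>- 1 / k\<close> rather than at 0 to keep the support of the cut-off away from the
  graph.\<close>

lemma clamp_has_real_derivative:
  fixes k s :: real
  assumes k: "k > 0" and s: "s \<noteq> - 2 / k" "s \<noteq> - 1 / k"
  shows "((\<lambda>s. max 0 (min 1 (- k * s - 1))) has_real_derivative - (k * indicator {- 2 / k<..<- 1 / k} s)) (at s)"
proof -
  have ks: "- k * s \<noteq> 2" "- k * s \<noteq> 1" using k s by (auto simp: field_simps)
  have cont: "continuous (at s) (\<lambda>s. - k * s)" by (intro continuous_intros)
  have ev: "eventually (\<lambda>t. P t) (nhds s)" if "open S" "- k * s \<in> S" "\<And>t. - k * t \<in> S \<Longrightarrow> P t" for S P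
  proof -
    have "((\<lambda>s. - k * s) \<longlongrightarrow> - k * s) (at s)" using cont by (simp add: isCont_def)
    from topological_tendstoD[OF this that(1,2)]
    show ?thesis using that by (auto simp: eventually_nhds_conv_at elim: eventually_mono)
  qed
  consider "- k * s < 1" | "1 < - k * s" "- k * s < 2" | "2 < - k * s" using ks by linarith
  then show ?thesis
  proof cases
    case 1
    have "eventually (\<lambda>t. max 0 (min 1 (- k * t - 1)) = 0) (nhds s)"
      by (rule ev[of "{..<1}"]) (use 1 in auto)
    moreover have "indicator {- 2 / k<..<- 1 / k} s = (0::real)"
      using 1 k by (auto simp: field_simps split: split_indicator)
    ultimately show ?thesis by (subst DERIV_cong_ev[OF refl _ refl]) auto
  next
    case 2
    have "eventually (\<lambda>t. max 0 (min 1 (- k * t - 1)) = - k * t - 1) (nhds s)"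
      by (rule ev[of "{1<..<2}"]) (use 2 in auto)
    moreover have "indicator {- 2 / k<..<- 1 / k} s = (1::real)"
      using 2 k by (auto simp: field_simps split: split_indicator)
    moreover have "((\<lambda>t. - k * t - 1) has_real_derivative - k) (at s)"
      by (auto intro!: derivative_eq_intros)
    ultimately show ?thesis by (subst DERIV_cong_ev[OF refl _ refl]) auto
  next
    case 3
    have "eventually (\<lambda>t. max 0 (min 1 (- k * t - 1)) = 1) (nhds s)"
      by (rule ev[of "{2<..}"]) (use 3 in auto)
    moreover have "indicator {- 2 / k<..<- 1 / k} s = (0::real)"
      using 3 k by (auto simp: field_simps split: split_indicator)
    ultimately show ?thesis by (subst DERIV_cong_ev[OF refl _ refl]) auto
  qed
qed

lemma (in lipschitz_domain) grad_eq_0_off_support: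
  assumes f: "C1_cl \<Omega> f" and supp: "\<And>x. x \<in> \<Omega> \<Longrightarrow> x \<notin> C \<Longrightarrow> f x = 0" and C: "closed C"
    and x: "x \<in> \<Omega>" "x \<notin> C"
  shows "grad \<Omega> f x = 0"
proof -
  have "((\<lambda>x. 0) has_derivative (\<lambda>h. grad \<Omega> f x \<bullet> h)) (at x)"
    by (rule has_derivative_transform_within_open[OF C1_cl_has_derivative_interior[OF f x(1)], of "\<Omega> - C"])
      (use x supp C open_\<Omega> in auto)
  then have "(\<lambda>h. grad \<Omega> f x \<bullet> h) = (\<lambda>h. 0)"
    by (rule has_derivative_unique) simp
  then show ?thesis by (metis inner_eq_zero_iff)
qed

locale lipschitz_surface_chart = lipschitz_domain \<Omega> + surface_chart \<Omega> V e g T \<Gamma> L \<sigma>\<^sub>0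
  for \<Omega> V :: "(real^'d) set" and e g T \<Gamma> L \<sigma>\<^sub>0
begin

text \<open>Each line parallel to \<open>e\<close> meets a level set of the height in a single
  point. This disposes of the two kinks of the cut-off.\<close>

lemma AE_height_neq: "AE x in lborel. x \<bullet> e - g x \<noteq> c"
proof -
  have "(\<integral>\<^sup>+x. indicator {c} (x \<bullet> e - g x) \<partial>lborel) =
    (\<integral>\<^sup>+x. indicator slab x * (\<integral>\<^sup>+t. indicator {c} ((x + t *\<^sub>R e) \<bullet> e - g (x + t *\<^sub>R e)) \<partial>lborel) \<partial>lborel)"
    by (rule nn_integral_unit_slab[OF chartD(2)]) measurable
  also have "\<dots> = (\<integral>\<^sup>+x. indicator slab x * (\<integral>\<^sup>+t. indicator {c + g x - x \<bullet> e} t \<partial>lborel) \<partial>lborel)"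
    by (intro nn_integral_cong arg_cong2[where f = "(*)"] refl)
      (auto simp: chartD inner_add_left split: split_indicator)
  also have "\<dots> = 0" by simp
  finally have "AE x in lborel. indicator {c} (x \<bullet> e - g x) = (0::ennreal)"
    by (subst (asm) nn_integral_0_iff_AE) simp_all
  then show ?thesis by eventually_elim (auto split: split_indicator_asm)
qed

text \<open>For each \<open>n\<close> the cut-off gives an exact identity between the integral of
  \<open>\<eta> n\<close> times the partial derivative and a weighted integral of \<open>f\<close>
  over the layer \<open>- 2 / k n < h < - 1 / k n\<close>. The former converges to the integral over
  \<open>\<Omega>\<close>. In the latter \<open>f x\<close> is replaced by \<open>f (P x)\<close> at
  a uniformly small cost, and what then appears is the surface integral itself, for every
  \<open>n\<close>. The margin between \<open>r\<close> and \<open>r'\<close> keeps the projections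
  of layer points inside the chart. The field \<open>q / J\<close> is \<open>f\<close> times the
  component \<open>i\<close> of the outward normal.\<close>

lemma local_divergence:
  fixes i :: 'd
  assumes f: "C1_cl \<Omega> f" and supp: "\<And>x. x \<in> closure \<Omega> \<Longrightarrow> x \<notin> cball a r \<Longrightarrow> f x = 0"
    and r: "r < r'" "cball a r' \<subseteq> V"
  defines "q \<equiv> \<lambda>z. indicator (closure \<Omega> \<inter> cball a r') z * f z * (e - \<Gamma> z) $ i"
  shows "q \<in> borel_measurable borel"
    "integrable \<sigma>\<^sub>0 (\<lambda>z. indicator V z * (q z / J z))"
    "(\<integral>x. indicator \<Omega> x * pderiv_cl \<Omega> i f x \<partial>lborel) = (\<integral>z. indicator V z * (q z / J z) \<partial>\<sigma>\<^sub>0)"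
proof -
  define S where "S = closure \<Omega> \<inter> cball a r'"
  define F where "F = (\<lambda>z. indicator S z * f z)"
  \<comment> \<open>The derivative of the height in direction \<open>i\<close>. It is constant along
    \<open>e\<close>, so a layer point and its projection share the same value.\<close>
  define c where "c = (\<lambda>z. (e - \<Gamma> z) $ i)"
  define h where "h = (\<lambda>x. x \<bullet> e - g x)"
  define v :: "real^'d" where "v = axis i 1"
  have q: "q z = F z * c z" for z by (simp add: q_def F_def c_def S_def)
  have S: "compact S" unfolding S_def by (intro closed_Int_compact) auto
  have SV: "S \<subseteq> V" using r by (auto simp: S_def)
  have fS: "continuous_on S f" by (rule continuous_on_subset[OF C1_cl_continuous[OF f]]) (simp add: S_def)
  have [measurable]: "F \<in> borel_measurable borel"
    unfolding F_def using borel_measurable_continuous_on_indicator[OF _ fS] S by (simp add: borel_compact)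
  have [measurable]: "c \<in> borel_measurable borel"
    unfolding c_def cart_eq_inner_axis by measurable
  have [measurable]: "h \<in> borel_measurable borel" unfolding h_def by measurable
  have [measurable]: "\<Omega> \<in> sets borel" using lipschitz_domain.open_\<Omega>[OF lipschitz_domain_axioms] by simp
  have q_eq: "q = (\<lambda>z. F z * c z)" by (rule ext) (rule q)
  show q_meas [measurable]: "q \<in> borel_measurable borel" unfolding q_eq by measurable
  have L0: "L \<ge> 0" using g_lip by (rule lipschitz_on_nonneg)
  have cL: "\<bar>c z\<bar> \<le> 1 + L" for z
    using \<Gamma>_bound[of z i] component_le_norm_cart[of e i] chartD(2) by (simp add: c_def)
  have cP: "c (P x) = c x" for x by (simp add: c_def \<Gamma>_P)
  have "bounded (f ` S)" using compact_continuous_image[OF fS S] by (rule compact_imp_bounded)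
  then obtain B where "\<forall>y\<in>f ` S. norm y \<le> B" unfolding bounded_iff by blast
  then have B: "\<bar>f z\<bar> \<le> \<bar>B\<bar>" if "z \<in> S" for z
    using that by (metis abs_ge_self image_eqI order_trans real_norm_def)
  have FB: "\<bar>F z\<bar> \<le> \<bar>B\<bar> * indicator (cball a r') z" for z
    using B[of z] by (cases "z \<in> S") (auto simp: F_def S_def)
  have "\<bar>q z\<bar> \<le> \<bar>B\<bar> * (1 + L) * indicator (cball a r') z" for z
    using mult_mono[OF FB[of z] cL[of z]] L0 by (simp add: q abs_mult ac_simps)
  note qB = this
  have cb: "integrable M (\<lambda>x. C * indicator (cball a r') x)"
    if "sets M = sets borel" "emeasure M (cball a r') < \<infinity>" for M :: "(real^'d) measure" and C :: real
    using that by (intro integrable_mult_right integrable_real_indicator) auto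
  note cb_lborel = cb[of lborel, OF sets_lborel emeasure_lborel_cball_finite]
    and cb_\<sigma>\<^sub>0 = cb[of \<sigma>\<^sub>0, OF sets_\<sigma>\<^sub>0 emeasure_cball_finite[OF r(2)]]
  have over_J: "integrable \<sigma>\<^sub>0 (\<lambda>z. indicator V z * (p z / J z))"
    if p [measurable]: "p \<in> borel_measurable borel" and pC: "\<And>z. \<bar>p z\<bar> \<le> C * indicator (cball a r') z" for p C
  proof (rule Bochner_Integration.integrable_bound[OF cb_\<sigma>\<^sub>0[of C]])
    show "(\<lambda>z. indicator V z * (p z / J z)) \<in> borel_measurable \<sigma>\<^sub>0"
      by (rule measurable_\<sigma>\<^sub>0) measurable
    show "AE z in \<sigma>\<^sub>0. norm (indicator V z * (p z / J z)) \<le> norm (C * indicator (cball a r') z)"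
    proof (rule AE_I2)
      fix z
      have "\<bar>p z / J z\<bar> \<le> \<bar>p z\<bar> / 1"
        unfolding abs_divide using J_ge_1[of z] by (intro divide_left_mono) auto
      then show "norm (indicator V z * (p z / J z)) \<le> norm (C * indicator (cball a r') z)"
        using pC[of z] by (auto simp: indicator_def abs_mult split: if_splits)
    qed
  qed
  show qi: "integrable \<sigma>\<^sub>0 (\<lambda>z. indicator V z * (q z / J z))"
    by (rule over_J[OF q_meas qB])

  define k where "k n = real (Suc n)" for n
  \<comment> \<open>Minus the slope of the cut-off: height \<open>k n\<close> on an interval of
    length \<open>1 / k n\<close>, the mass one required by \<open>surface_integral\<close>.\<close>
  define w where "w = (\<lambda>n t. k n * indicator {- 2 / k n<..<- 1 / k n} t)"
  define \<eta> where "\<eta> = (\<lambda>n x. max 0 (min 1 (- k n * h x - 1)))"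
  have k0: "k n > 0" for n by (simp add: k_def)
  have w0: "w n t \<ge> 0" for n t using k0[of n] by (simp add: w_def)
  have w_meas [measurable]: "w n \<in> borel_measurable borel" for n unfolding w_def by measurable
  have w1: "(\<integral>\<^sup>+t. ennreal (w n t) \<partial>lborel) = 1" for n
  proof -
    have "(\<integral>\<^sup>+t. ennreal (w n t) \<partial>lborel) = (\<integral>\<^sup>+t. ennreal (k n) * indicator {- 2 / k n<..<- 1 / k n} t \<partial>lborel)"
      by (intro nn_integral_cong) (auto simp: w_def split: split_indicator)
    also have "\<dots> = ennreal (k n) * ennreal (- 1 / k n - - 2 / k n)"
      using k0[of n] by (subst nn_integral_cmult_indicator) (auto simp: emeasure_lborel_Ioo divide_right_mono)
    also have "\<dots> = 1" using k0[of n]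
      by (subst ennreal_mult[symmetric]) (auto simp: diff_divide_distrib[symmetric] divide_right_mono)
    finally show ?thesis .
  qed
  have wh: "- 2 / k n < h x" "h x < - 1 / k n" if "w n (h x) \<noteq> 0" for n x
    using that by (auto simp: w_def split: split_indicator_asm)
  have V\<Omega>: "x \<in> \<Omega>" if "x \<in> V" "h x < 0" for x
    using chartD(5) that by (simp add: h_def)
  have \<Omega>V: "h x < 0" if "x \<in> V" "x \<in> \<Omega>" for x
    using chartD(5) that by (simp add: h_def)
  have h_lip: "\<bar>h x - h y\<bar> \<le> (1 + L) * norm (x - y)" for x y
  proof -
    have "\<bar>g x - g y\<bar> \<le> L * norm (x - y)" using lipschitz_onD[OF g_lip, of x y] by (simp add: dist_norm)
    moreover have "\<bar>(x - y) \<bullet> e\<bar> \<le> norm (x - y)" using Cauchy_Schwarz_ineq2[of "x - y" e] chartD(2) by simp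
    ultimately show ?thesis by (simp add: h_def inner_diff_left algebra_simps)
  qed
  have \<eta>01: "0 \<le> \<eta> n x" "\<eta> n x \<le> 1" for n x by (auto simp: \<eta>_def)
  have \<eta>_lip: "(k n * (1 + L))-lipschitz_on UNIV (\<eta> n)" for n
  proof (rule lipschitz_onI)
    fix x y
    have "\<bar>\<eta> n x - \<eta> n y\<bar> \<le> \<bar>(- k n * h x - 1) - (- k n * h y - 1)\<bar>"
      unfolding \<eta>_def by (rule abs_clamp_diff_le)
    also have "\<dots> = k n * \<bar>h x - h y\<bar>"
      using k0[of n] by (simp add: abs_mult[symmetric] right_diff_distrib[symmetric] abs_minus_commute flip: abs_mult_pos')
    also have "\<dots> \<le> k n * ((1 + L) * norm (x - y))" using k0[of n] h_lip by simp
    finally show "dist (\<eta> n x) (\<eta> n y) \<le> k n * (1 + L) * dist x y" by (simp add: dist_norm dist_real_def)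
  qed (use k0[of n] L0 in simp)
  have h_cont: "continuous_on UNIV h" unfolding h_def using chartD(6) by (intro continuous_intros)
  \<comment> \<open>Where the cut-off is nonzero the height is below \<open>- 1 / k n\<close>, so
    within the ball its support stays strictly under the graph and is a compact part of
    \<open>\<Omega>\<close>.\<close>
  define K where "K n = cball a r \<inter> {x. h x \<le> - 1 / k n}" for n
  have K: "compact (K n)" for n
    unfolding K_def by (intro compact_Int_closed compact_cball closed_Collect_le h_cont continuous_intros)
  have K\<Omega>: "K n \<subseteq> \<Omega>" for n
  proof
    fix x assume x: "x \<in> K n"
    then have "x \<in> V" using r by (auto simp: K_def)
    moreover have "h x < 0" using x k0[of n] by (auto simp: K_def intro: le_less_trans)
    ultimately show "x \<in> \<Omega>" by (rule V\<Omega>)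
  qed
  have cut_supp: "\<eta> n x * f x = 0" if "x \<in> \<Omega>" "x \<notin> K n" for n x
  proof (cases "x \<in> cball a r")
    case True
    then have "- 1 / k n < h x" using that by (auto simp: K_def)
    then have "- k n * h x - 1 < 0" using k0[of n] by (simp add: field_simps)
    then have "\<eta> n x = 0" unfolding \<eta>_def by (simp add: max_def min_def)
    then show ?thesis by simp
  next
    case False
    then show ?thesis using supp that closure_subset by (metis mult_zero_right subsetD)
  qed
  have cut_der: "AE x in lborel. x \<in> \<Omega> \<longrightarrow> ((\<lambda>t. \<eta> n (x + t *\<^sub>R v)) has_real_derivative - (w n (h x) * c x)) (at 0)" for n
    using AE_T AE_height_neq[of "- 1 / k n"] AE_height_neq[of "- 2 / k n"]
  proof eventually_elim
    case (elim x)
    have "(h has_derivative (\<lambda>y. y \<bullet> e - \<Gamma> x \<bullet> y)) (at x)"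
      unfolding h_def
      by (rule has_derivative_diff[OF has_derivative_inner_left[OF has_derivative_ident] g_deriv[OF elim(1)]])
    from has_real_derivative_along_line[OF this, of v]
    have hd: "((\<lambda>t. h (x + t *\<^sub>R v)) has_real_derivative c x) (at 0)"
      by (simp add: c_def v_def inner_axis inner_axis')
    have "((\<lambda>s. max 0 (min 1 (- k n * s - 1))) has_real_derivative - w n (h x)) (at (h (x + 0 *\<^sub>R v)))"
      using clamp_has_real_derivative[OF k0[of n], of "h x"] elim by (simp add: w_def h_def)
    from DERIV_chain2[OF this hd] show ?case by (simp add: \<eta>_def)
  qed
  have [measurable]: "(\<lambda>x. - (w n (h x) * c x)) \<in> borel_measurable borel" for n by measurable
  note cut = integral_cutoff_eq_0[OF f K K\<Omega> _ \<eta>_lip cut_supp cut_der this]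
  have pd: "grad \<Omega> f x \<bullet> v = pderiv_cl \<Omega> i f x" for x by (simp add: grad_def v_def inner_axis)
  define p where "p = (\<lambda>x. indicator \<Omega> x * pderiv_cl \<Omega> i f x)"
  have pcont: "continuous_on \<Omega> (pderiv_cl \<Omega> i f)"
    using continuous_on_subset[OF C1_cl_pderiv_continuous[OF f] closure_subset] .
  have [measurable]: "p \<in> borel_measurable borel"
    unfolding p_def using borel_measurable_continuous_on_indicator[OF _ pcont] by simp
  have p0: "p x = 0" if "x \<notin> cball a r" for x
  proof (cases "x \<in> \<Omega>")
    case True
    have "grad \<Omega> f x = 0"
      by (rule grad_eq_0_off_support[OF f _ closed_cball True that]) (use supp closure_subset in blast)
    then show ?thesis using grad_nth[of f x i] by (simp add: p_def)
  qed (simp add: p_def)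
  have "bounded (pderiv_cl \<Omega> i f ` closure \<Omega>)"
    using compact_continuous_image[OF C1_cl_pderiv_continuous[OF f] compact_closure_\<Omega>] by (rule compact_imp_bounded)
  then obtain Bp where "\<forall>y\<in>pderiv_cl \<Omega> i f ` closure \<Omega>. norm y \<le> Bp" unfolding bounded_iff by blast
  then have "\<bar>pderiv_cl \<Omega> i f x\<bar> \<le> \<bar>Bp\<bar>" if "x \<in> \<Omega>" for x
    using that closure_subset by (metis abs_ge_self image_eqI order_trans real_norm_def subsetD)
  then have pB: "\<bar>p x\<bar> \<le> \<bar>Bp\<bar> * indicator (cball a r') x" for x
    using p0[of x] r by (cases "x \<in> \<Omega>"; cases "x \<in> cball a r") (auto simp: p_def)
  have pi: "integrable lborel p"
    by (rule Bochner_Integration.integrable_bound[OF cb_lborel[of "\<bar>Bp\<bar>"]]) (use pB in \<open>auto simp: abs_mult\<close>)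
  have \<eta>_meas [measurable]: "\<eta> n \<in> borel_measurable borel" for n unfolding \<eta>_def by measurable
  have \<eta>pB: "\<bar>\<eta> n x * p x\<bar> \<le> \<bar>p x\<bar>" for n x
    using mult_right_mono[of "\<bar>\<eta> n x\<bar>" 1 "\<bar>p x\<bar>"] \<eta>01[of n x] by (simp add: abs_mult)
  have \<eta>pi: "integrable lborel (\<lambda>x. \<eta> n x * p x)" for n
    by (rule Bochner_Integration.integrable_bound[OF pi]) (use \<eta>pB in auto)
  have wF: "integrable lborel (\<lambda>x. w n (h x) * (c x * F x))" for n
  proof (rule Bochner_Integration.integrable_bound[OF cb_lborel[of "k n * ((1 + L) * \<bar>B\<bar>)"]])
    show "AE x in lborel. norm (w n (h x) * (c x * F x)) \<le> norm (k n * ((1 + L) * \<bar>B\<bar>) * indicator (cball a r') x)"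
    proof (rule AE_I2)
      fix x
      have "\<bar>w n (h x)\<bar> * (\<bar>c x\<bar> * \<bar>F x\<bar>) \<le> k n * ((1 + L) * (\<bar>B\<bar> * indicator (cball a r') x))"
        using cL FB k0[of n] L0
        by (intro mult_mono) (auto simp: w_def split: split_indicator)
      then show "norm (w n (h x) * (c x * F x)) \<le> norm (k n * ((1 + L) * \<bar>B\<bar>) * indicator (cball a r') x)"
        using k0[of n] L0 by (simp add: abs_mult mult.assoc)
    qed
  qed measurable
  \<comment> \<open>On the layer the truncation \<open>F\<close> may replace \<open>f\<close> on
    \<open>\<Omega>\<close>: the points of \<open>S\<close> there lie below the graph, hence in
    \<open>\<Omega>\<close>, and outside the small ball \<open>f\<close> vanishes.\<close>
  have cut_eq: "indicator \<Omega> x * (- (w n (h x) * c x) * f x + \<eta> n x * (grad \<Omega> f x \<bullet> v)) =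
      \<eta> n x * p x - w n (h x) * (c x * F x)" for n x
  proof -
    have wcf: "indicator \<Omega> x * (w n (h x) * c x * f x) = w n (h x) * (c x * F x)"
    proof (cases "w n (h x) = 0")
      case False
      then have hx: "h x < 0" using wh[of n x] k0[of n] by (meson divide_neg_pos less_trans neg_less_0_iff_less zero_less_one)
      have "indicator \<Omega> x * f x = F x"
      proof (cases "x \<in> S")
        case True
        then show ?thesis using V\<Omega>[OF _ hx] SV by (auto simp: F_def)
      next
        case xS: False
        have "f x = 0" if "x \<in> \<Omega>"
          using supp[of x] that xS closure_subset r by (force simp: S_def)
        then show ?thesis using xS by (auto simp: F_def split: split_indicator)
      qed
      then show ?thesis by (metis mult.assoc mult.left_commute)
    qed simp
    have "I * (- (w' * c') * f' + \<eta>' * g') = \<eta>' * (I * g') - I * (w' * c' * f')" for I w' c' f' \<eta>' g' :: real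
      by (simp add: algebra_simps)
    then show ?thesis unfolding pd wcf[symmetric] p_def .
  qed
  have key: "(\<integral>x. \<eta> n x * p x \<partial>lborel) = (\<integral>x. w n (h x) * (c x * F x) \<partial>lborel)" for n
    using cut(2)[of n] \<eta>01 \<eta>pi[of n] wF[of n] unfolding cut_eq by simp
  have lim1: "(\<lambda>n. \<integral>x. \<eta> n x * p x \<partial>lborel) \<longlonglongrightarrow> (\<integral>x. p x \<partial>lborel)"
  proof (rule integral_dominated_convergence[where w = "\<lambda>x. \<bar>p x\<bar>"])
    show "AE x in lborel. (\<lambda>n. \<eta> n x * p x) \<longlonglongrightarrow> p x"
    proof (rule AE_I2)
      fix x
      show "(\<lambda>n. \<eta> n x * p x) \<longlonglongrightarrow> p x"
      proof (cases "p x = 0")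
        case False
        then have xa: "x \<in> cball a r" using p0 by blast
        have "p x = 0" if "x \<notin> \<Omega>" using that unfolding p_def by simp
        then have x\<Omega>: "x \<in> \<Omega>" using False by blast
        have "x \<in> V" using xa r by auto
        then have hx: "h x < 0" using \<Omega>V x\<Omega> by blast
        \<comment> \<open>From this index on, the fixed point \<open>x\<close> lies deeper than the
          transition zone, where the cut-off equals 1.\<close>
        obtain N where N: "real N > 2 / (- h x)" using reals_Archimedean2 by blast
        have "\<eta> n x = 1" if "n \<ge> N" for n
        proof -
          have "2 / (- h x) < k n" using N that by (simp add: k_def)
          then have "2 < k n * (- h x)" using hx by (subst (asm) pos_divide_less_eq) auto
          then show ?thesis by (simp add: \<eta>_def max_def min_def)
        qed
        then have "eventually (\<lambda>n. \<eta> n x * p x = p x) sequentially"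
          unfolding eventually_sequentially by (metis mult_1)
        then show ?thesis by (rule tendsto_eventually)
      qed simp
    qed
  qed (use pi \<eta>pB in auto)
  define A where "A = (\<integral>z. indicator V z * (q z / J z) \<partial>\<sigma>\<^sub>0)"
  \<comment> \<open>The same surface integral with \<open>q\<close> replaced by the indicator of the
    ball. Its layer version has the value \<open>C\<close> for every \<open>n\<close>, which bounds
    the mass on which the replacement error acts.\<close>
  define C where "C = (\<integral>z. indicator V z * (indicator (cball a r') z / J z) \<partial>\<sigma>\<^sub>0)"
  have A: "integrable lborel (\<lambda>x. w n (h x) * (indicator V (P x) * q (P x)))"
    "(\<integral>x. w n (h x) * (indicator V (P x) * q (P x)) \<partial>lborel) = A" for n
    using surface_integral[of q "w n", OF q_meas w_meas w0 w1] qi unfolding A_def h_def by simp_all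
  have ball_meas: "(indicator (cball a r') :: _ \<Rightarrow> real) \<in> borel_measurable borel"
    by (rule borel_measurable_indicator) simp
  have "integrable \<sigma>\<^sub>0 (\<lambda>z. indicator V z * (indicator (cball a r') z / J z))"
    by (rule over_J[OF ball_meas, of 1]) simp
  then have C: "integrable lborel (\<lambda>x. w n (h x) * (indicator V (P x) * indicator (cball a r') (P x)))"
    "(\<integral>x. w n (h x) * (indicator V (P x) * indicator (cball a r') (P x)) \<partial>lborel) = C" for n
    using surface_integral[of "indicator (cball a r')" "w n", OF ball_meas w_meas w0 w1]
    unfolding C_def h_def by simp_all
  have C0: "C \<ge> 0" unfolding C_def using J_pos by (intro integral_nonneg_AE AE_I2) (simp add: less_imp_le)
  have lim2: "(\<lambda>n. \<integral>x. w n (h x) * (c x * F x) \<partial>lborel) \<longlonglongrightarrow> A"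
  proof (rule LIMSEQ_I)
    fix \<epsilon> :: real assume \<epsilon>: "\<epsilon> > 0"
    \<comment> \<open>The summand 1 keeps \<open>m\<close> positive even when \<open>C\<close> is
      zero.\<close>
    define m where "m = (1 + L) * (C + 1)"
    define \<epsilon>' where "\<epsilon>' = \<epsilon> / (2 * m)"
    have m: "m > 0" unfolding m_def using L0 C0 by (intro mult_pos_pos) linarith+
    have \<epsilon>': "\<epsilon>' > 0" unfolding \<epsilon>'_def using \<epsilon> m by (intro divide_pos_pos) linarith+
    have "(1 + L) * C \<le> m" unfolding m_def using L0 by (intro mult_left_mono) linarith+
    then have "\<epsilon>' * ((1 + L) * C) \<le> \<epsilon>' * m" using \<epsilon>' by (rule mult_left_mono[OF _ less_imp_le])
    moreover have "\<epsilon>' * m = \<epsilon> / 2" unfolding \<epsilon>'_def using m by simp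
    moreover have "\<epsilon> / 2 < \<epsilon>" using \<epsilon> by simp
    ultimately have small: "\<epsilon>' * (1 + L) * C < \<epsilon>" unfolding mult.assoc by (metis le_less_trans)
    have "uniformly_continuous_on S f" using fS S by (rule compact_uniformly_continuous)
    then obtain d where d: "d > 0" "\<And>x y. x \<in> S \<Longrightarrow> y \<in> S \<Longrightarrow> dist y x < d \<Longrightarrow> dist (f y) (f x) < \<epsilon>'"
      using \<epsilon>' unfolding uniformly_continuous_on_def by blast
    \<comment> \<open>The layer has depth at most \<open>2 / k n\<close>; this must be less than the
      modulus \<open>d\<close> of uniform continuity and less than the margin
      \<open>r' - r\<close>.\<close>
    obtain N where N: "real N > 2 / min d (r' - r)" using reals_Archimedean2 by blast
    show "\<exists>no. \<forall>n\<ge>no. norm ((\<integral>x. w n (h x) * (c x * F x) \<partial>lborel) - A) < \<epsilon>"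
    proof (intro exI allI impI)
      fix n assume n: "n \<ge> N"
      then have "2 / min d (r' - r) < k n" using N by (simp add: k_def)
      moreover have "min d (r' - r) > 0" using d(1) r(1) by simp
      ultimately have "2 / k n < min d (r' - r)"
        using k0[of n] by (metis mult.commute pos_divide_less_eq)
      then have kn: "2 / k n < d" "2 / k n < r' - r" by auto
      have pw: "\<bar>w n (h x) * (c x * F x) - w n (h x) * (indicator V (P x) * q (P x))\<bar> \<le>
          \<epsilon>' * (1 + L) * (w n (h x) * (indicator V (P x) * indicator (cball a r') (P x)))" for x
      proof (cases "w n (h x) = 0 \<or> F x = 0 \<and> F (P x) = 0")
        case True
        have "0 \<le> \<epsilon>' * (1 + L) * (w n (h x) * (indicator V (P x) * indicator (cball a r') (P x)))"
          using \<epsilon>' L0 w0 by (simp split: split_indicator)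
        then show ?thesis using True by (auto simp: q)
      next
        case False
        then have wn: "w n (h x) \<noteq> 0" by simp
        have hx: "h x < 0" using wh[OF wn] k0[of n]
          by (meson divide_neg_pos less_trans neg_less_0_iff_less zero_less_one)
        \<comment> \<open>Projecting moves a point by the absolute value of its height.\<close>
        have dP: "dist x (P x) < 2 / k n"
        proof -
          have "dist x (P x) = - h x" unfolding dist_graph_proj using hx by (simp add: h_def)
          then show ?thesis using wh(1)[OF wn] by linarith
        qed
        have Fr: "z \<in> cball a r" if "F z \<noteq> 0" for z
          using that supp[of z] by (auto simp: F_def S_def split: split_indicator_asm)
        have near: "z' \<in> cball a r'" if "z \<in> cball a r" "dist z z' < r' - r" for z z'
          using that dist_triangle[of a z' z] by simp
        have dP': "dist x (P x) < r' - r" "dist (P x) x < r' - r"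
          using dP kn(2) by (simp_all add: dist_commute)
        have sub: "cball a r \<subseteq> cball a r'" using r(1) by (intro subset_cball) simp
        have xP: "x \<in> cball a r'" "P x \<in> cball a r'"
        proof -
          consider "x \<in> cball a r" | "P x \<in> cball a r" using False Fr by blast
          then have "x \<in> cball a r' \<and> P x \<in> cball a r'"
            by cases (use near dP' sub in blast)+
          then show "x \<in> cball a r'" "P x \<in> cball a r'" by auto
        qed
        have xV: "x \<in> V" "P x \<in> V" using xP r by auto
        \<comment> \<open>The layer point is below the graph, hence in \<open>\<Omega>\<close>; its
          projection is on the graph, hence in the closure. Uniform continuity on \<open>S\<close>
          applies to the pair.\<close>
        have xS: "x \<in> S" "P x \<in> S"
          using V\<Omega>[OF xV(1) hx] closure_subset chart_graph_closure[OF chart _ xV(2)] xP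
          by (auto simp: S_def P_inner)
        have "\<bar>f x - f (P x)\<bar> \<le> \<epsilon>'"
          using d(2)[OF xS(2) xS(1)] dP kn by (simp add: dist_real_def)
        then have "w n (h x) * \<bar>c x\<bar> * \<bar>f x - f (P x)\<bar> \<le> w n (h x) * (1 + L) * \<epsilon>'"
          using cL w0 L0 by (intro mult_mono) auto
        moreover have "w n (h x) * (c x * F x) - w n (h x) * (indicator V (P x) * q (P x)) =
            w n (h x) * c x * (f x - f (P x))"
          using xS xV by (simp add: q cP F_def algebra_simps)
        ultimately show ?thesis using xV xP w0[of n "h x"] by (simp add: abs_mult ac_simps)
      qed
      have "norm ((\<integral>x. w n (h x) * (c x * F x) \<partial>lborel) - A) =
          \<bar>\<integral>x. w n (h x) * (c x * F x) - w n (h x) * (indicator V (P x) * q (P x)) \<partial>lborel\<bar>"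
        using A[of n] wF[of n] by simp
      also have "\<dots> \<le> (\<integral>x. \<bar>w n (h x) * (c x * F x) - w n (h x) * (indicator V (P x) * q (P x))\<bar> \<partial>lborel)"
        by (rule integral_abs_bound)
      also have "\<dots> \<le> (\<integral>x. \<epsilon>' * (1 + L) * (w n (h x) * (indicator V (P x) * indicator (cball a r') (P x))) \<partial>lborel)"
        by (intro integral_mono pw integrable_abs Bochner_Integration.integrable_diff wF A integrable_mult_right C)
      also have "\<dots> = \<epsilon>' * (1 + L) * C" using C by simp
      finally show "norm ((\<integral>x. w n (h x) * (c x * F x) \<partial>lborel) - A) < \<epsilon>" using small by simp
    qed
  qed
  have "(\<integral>x. p x \<partial>lborel) = A"
    using LIMSEQ_unique[OF lim1] lim2 unfolding key by blast
  then show "(\<integral>x. indicator \<Omega> x * pderiv_cl \<Omega> i f x \<partial>lborel) = (\<integral>z. indicator V z * (q z / J z) \<partial>\<sigma>\<^sub>0)"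
    by (simp add: p_def A_def)
qed

end

section \<open>Functions known only almost everywhere\<close>

lemma (in complete_measure) borel_measurable_AE_eq:
  assumes f: "f \<in> borel_measurable M" and ae: "AE x in M. f x = f' x"
  shows "f' \<in> borel_measurable M"
proof (rule measurableI)
  fix A :: "'b set" assume A: "A \<in> sets borel"
  show "f' -` A \<inter> space M \<in> sets M"
  proof (rule in_sets_AE)
    show "AE x in M. x \<in> f -` A \<inter> space M \<longleftrightarrow> x \<in> f' -` A \<inter> space M"
      using ae by eventually_elim simp
    show "f -` A \<inter> space M \<in> sets M" using f A by (simp add: measurable_sets)
  qed simp
qed simp

text \<open>Completeness yields the measurability of \<open>f'\<close> from the almost everywhere
  identity alone. Expressions in the outward normal or in normal derivatives are integrated through
  this lemma.\<close>

lemma (in complete_measure) integrable_AE_eq: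
  fixes f f' :: "'a \<Rightarrow> real"
  assumes f: "integrable M f" and ae: "AE x in M. f x = f' x"
  shows "integrable M f'" "integral\<^sup>L M f' = integral\<^sup>L M f"
proof -
  have fm: "f \<in> borel_measurable M" using f by simp
  have f'm: "f' \<in> borel_measurable M" using borel_measurable_AE_eq[OF fm ae] .
  show "integrable M f'"
    by (rule integrable_cong_AE_imp[OF f f'm]) (use ae in auto)
  show "integral\<^sup>L M f' = integral\<^sup>L M f"
    by (rule integral_cong_AE[OF f'm fm]) (use ae in auto)
qed

lemma integrable_completion_AE:
  fixes f f' :: "'a \<Rightarrow> real"
  assumes f: "integrable M f" and ae: "AE x in M. f x = f' x"
  shows "integrable (completion M) f'" "integral\<^sup>L (completion M) f' = integral\<^sup>L M f"
proof -
  have fm: "f \<in> borel_measurable M" using f by simp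
  have "integrable (completion M) f" using f fm by (simp add: integrable_completion)
  from completion.integrable_AE_eq[OF this AE_completion[OF ae]]
  show "integrable (completion M) f'" "integral\<^sup>L (completion M) f' = integral\<^sup>L M f"
    by (simp_all add: integral_completion[OF fm])
qed

lemma finite_measure_completion:
  assumes "emeasure M (space M) \<noteq> \<infinity>"
  shows "finite_measure (completion M)"
  by (rule finite_measureI) (use assms in \<open>simp add: main_part[OF sets.top]\<close>)

text \<open>Squaring removes the kink of \<open>max 0\<close> at zero: the derivative
  \<open>2 * max 0 s\<close> is continuous. This provides the bumps of the partition of
  unity.\<close>

lemma has_real_derivative_max_0_squared:
  "((\<lambda>s. (max 0 s)\<^sup>2) has_real_derivative 2 * max 0 s) (at (s::real))"
proof -
  consider "s > 0" | "s < 0" | "s = 0" by linarith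
  then show ?thesis
  proof cases
    case 1
    have "eventually (\<lambda>t. t \<in> {0<..}) (nhds s)" using 1 by (intro eventually_nhds_in_open) auto
    then have ev: "eventually (\<lambda>t. (max 0 t)\<^sup>2 = t\<^sup>2) (nhds s)" by eventually_elim simp
    have "((\<lambda>t. t\<^sup>2) has_real_derivative 2 * s) (at s)" by (auto intro!: derivative_eq_intros)
    then show ?thesis using 1 by (subst DERIV_cong_ev[OF refl ev refl]) simp
  next
    case 2
    have "eventually (\<lambda>t. t \<in> {..<0}) (nhds s)" using 2 by (intro eventually_nhds_in_open) auto
    then have ev: "eventually (\<lambda>t. (max 0 t)\<^sup>2 = 0) (nhds s)" by eventually_elim simp
    show ?thesis using 2 by (subst DERIV_cong_ev[OF refl ev refl]) simp
  next
    case 3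
    have "((\<lambda>t. (max 0 t)\<^sup>2 / t) \<longlongrightarrow> 0) (at (0::real))"
    proof (rule Lim_null_comparison)
      show "eventually (\<lambda>t. norm ((max 0 t)\<^sup>2 / t) \<le> \<bar>t\<bar>) (at (0::real))"
        by (intro always_eventually allI) (auto simp: max_def power2_eq_square)
      show "((\<lambda>t. \<bar>t\<bar>) \<longlongrightarrow> 0) (at (0::real))" by (auto intro!: tendsto_eq_intros)
    qed
    then show ?thesis using 3 by (simp add: has_field_derivative_iff)
  qed
qed

section \<open>From single charts to the whole domain\<close>

locale lipschitz_surface = lipschitz_domain \<Omega> for \<Omega> :: "(real^'d) set" +
  fixes \<sigma> :: "(real^'d) measure"
  assumes surface: "is_surface_measure \<Omega> \<sigma>"
begin

text \<open>The divergence theorem for one scalar function, component by component. Integrability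
  belongs to it because the integral of a non-integrable function is zero by convention, and a sum
  over charts could then not be taken under the integral.\<close>

definition has_flux :: "(real^'d \<Rightarrow> real) \<Rightarrow> bool" where
  "has_flux f \<longleftrightarrow> (\<forall>i. integrable \<sigma> (\<lambda>z. f z * outward_normal \<Omega> z $ i) \<and>
    (\<integral>x. pderiv_cl \<Omega> i f x \<partial>lebesgue_on \<Omega>) = (\<integral>z. f z * outward_normal \<Omega> z $ i \<partial>\<sigma>))"

text \<open>A single Borel measure serves all charts simultaneously, so contributions obtained in
  different charts can be added.\<close>

lemma completed_surface:
  obtains \<sigma>\<^sub>0 where "sets \<sigma>\<^sub>0 = sets borel" "\<sigma> = completion \<sigma>\<^sub>0" "emeasure \<sigma>\<^sub>0 (- frontier \<Omega>) = 0"
    "\<And>V e g T \<Gamma> L. graph_chart \<Omega> V e g T \<Gamma> L \<Longrightarrow> lipschitz_surface_chart \<Omega> V e g T \<Gamma> L \<sigma>\<^sub>0"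
proof -
  obtain \<sigma>\<^sub>0 where s: "sets \<sigma>\<^sub>0 = sets borel" "\<sigma> = completion \<sigma>\<^sub>0" "emeasure \<sigma>\<^sub>0 (- frontier \<Omega>) = 0"
    and area: "\<forall>V e g A. lipschitz_chart \<Omega> V e g \<longrightarrow> A \<in> sets borel \<longrightarrow> A \<subseteq> V \<longrightarrow>
           emeasure \<sigma>\<^sub>0 (A \<inter> frontier \<Omega>) =
             (\<integral>\<^sup>+ x \<in> {x. 0 \<le> x \<bullet> e \<and> x \<bullet> e \<le> 1}.
                indicator A (x + (g x - x \<bullet> e) *\<^sub>R e) *
                ennreal (sqrt (1 + (norm (grad UNIV g x))\<^sup>2)) \<partial>lborel)"
    using surface unfolding is_surface_measure_def by (elim exE conjE) (rule that)
  have "lipschitz_surface_chart \<Omega> V e g T \<Gamma> L \<sigma>\<^sub>0" if gc: "graph_chart \<Omega> V e g T \<Gamma> L" for V e g T \<Gamma> L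
    by (rule lipschitz_surface_chart.intro[OF lipschitz_domain_axioms surface_chart.intro[OF gc surface_chart_axioms.intro]])
      (fact s, fact s, rule area[rule_format, OF graph_chart.chart[OF gc]])
  then show thesis by (rule that[OF s])
qed

text \<open>The factor two supplies the margin between the two radii in
  \<open>local_divergence\<close>.\<close>

lemma chart_cball:
  assumes "x \<in> frontier \<Omega>"
  obtains V e g T \<Gamma> L r where "graph_chart \<Omega> V e g T \<Gamma> L" "r > 0" "cball x (2 * r) \<subseteq> V"
proof -
  obtain V e g where x: "x \<in> V" and chart: "lipschitz_chart \<Omega> V e g" using charts[OF assms] by blast
  obtain T \<Gamma> L where gc: "graph_chart \<Omega> V e g T \<Gamma> L"
    using lipschitz_chart_imp_graph_chart[OF chart open_\<Omega>] by blast
  obtain r where "r > 0" "cball x r \<subseteq> V"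
    using lipschitz_chartD(1)[OF chart] x open_contains_cball by blast
  then show thesis using that[OF gc, of "r / 2"] by simp
qed

lemma complete_\<sigma>: "complete_measure \<sigma>"
proof -
  obtain \<sigma>\<^sub>0 :: "(real^'d) measure" where "\<sigma> = completion \<sigma>\<^sub>0"
    using surface unfolding is_surface_measure_def by blast
  then show ?thesis by (simp add: completion.complete_measure_axioms)
qed

text \<open>Finiteness of the area follows from compactness of the frontier: finitely many balls,
  each inside a chart and of finite measure, cover it.\<close>

lemma AE_frontier: "AE x in \<sigma>. x \<in> frontier \<Omega>"
  and finite_\<sigma>: "finite_measure \<sigma>"
proof -
  obtain \<sigma>\<^sub>0 where s: "sets \<sigma>\<^sub>0 = sets borel" "\<sigma> = completion \<sigma>\<^sub>0" "emeasure \<sigma>\<^sub>0 (- frontier \<Omega>) = 0"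
    and sc: "\<And>V e g T \<Gamma> L. graph_chart \<Omega> V e g T \<Gamma> L \<Longrightarrow> lipschitz_surface_chart \<Omega> V e g T \<Gamma> L \<sigma>\<^sub>0"
    using completed_surface by blast
  have "AE x in \<sigma>\<^sub>0. x \<in> frontier \<Omega>"
    by (rule AE_I[where N = "- frontier \<Omega>"]) (use s in auto)
  then show "AE x in \<sigma>. x \<in> frontier \<Omega>" unfolding s(2) by (rule AE_completion)
  have "\<exists>r>0. emeasure \<sigma>\<^sub>0 (cball x r) < \<infinity>" if x: "x \<in> frontier \<Omega>" for x
  proof -
    obtain V e g T \<Gamma> L r where gc: "graph_chart \<Omega> V e g T \<Gamma> L" "r > 0" "cball x (2 * r) \<subseteq> V"
      using chart_cball[OF x] by blast
    interpret lipschitz_surface_chart \<Omega> V e g T \<Gamma> L \<sigma>\<^sub>0 by (rule sc[OF gc(1)])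
    show ?thesis using emeasure_cball_finite[OF gc(3)] gc(2) by (intro exI[of _ "2 * r"]) simp
  qed
  then have "\<forall>x\<in>frontier \<Omega>. \<exists>r. r > 0 \<and> emeasure \<sigma>\<^sub>0 (cball x r) < \<infinity>" by blast
  from bchoice[OF this] obtain \<rho> where
    "\<forall>x\<in>frontier \<Omega>. \<rho> x > 0 \<and> emeasure \<sigma>\<^sub>0 (cball x (\<rho> x)) < \<infinity>" ..
  then have \<rho>: "\<And>x. x \<in> frontier \<Omega> \<Longrightarrow> \<rho> x > 0" "\<And>x. x \<in> frontier \<Omega> \<Longrightarrow> emeasure \<sigma>\<^sub>0 (cball x (\<rho> x)) < \<infinity>"
    by blast+
  have comp: "compact (frontier \<Omega>)" using bounded_\<Omega> by (simp add: compact_frontier_bounded)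
  have cover: "frontier \<Omega> \<subseteq> (\<Union>x\<in>frontier \<Omega>. ball x (\<rho> x))" using \<rho>(1) by (meson UN_I centre_in_ball subsetI)
  obtain X where X: "X \<subseteq> frontier \<Omega>" "finite X" "frontier \<Omega> \<subseteq> (\<Union>x\<in>X. ball x (\<rho> x))"
    by (rule compactE_image[OF comp open_ball cover])
  have sub: "frontier \<Omega> \<subseteq> (\<Union>x\<in>X. cball x (\<rho> x))"
    by (rule order_trans[OF X(3)]) (intro UN_mono ball_subset_cball order_refl)
  have "emeasure \<sigma>\<^sub>0 UNIV = emeasure \<sigma>\<^sub>0 (frontier \<Omega> \<union> - frontier \<Omega>)" by simp
  also have "\<dots> \<le> emeasure \<sigma>\<^sub>0 (frontier \<Omega>) + emeasure \<sigma>\<^sub>0 (- frontier \<Omega>)"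
    by (rule emeasure_subadditive) (simp_all add: s(1))
  also have "\<dots> = emeasure \<sigma>\<^sub>0 (frontier \<Omega>)" by (simp add: s(3))
  also have "\<dots> \<le> emeasure \<sigma>\<^sub>0 (\<Union>x\<in>X. cball x (\<rho> x))"
    by (rule emeasure_mono[OF sub], unfold s(1), intro borel_closed closed_UN X(2) ballI closed_cball)
  also have "\<dots> \<le> (\<Sum>x\<in>X. emeasure \<sigma>\<^sub>0 (cball x (\<rho> x)))"
    by (rule emeasure_subadditive_finite[OF X(2)]) (auto simp: s(1))
  also have "\<dots> < \<infinity>" using X(1) \<rho>(2) unfolding infinity_ennreal_def ennreal_sum_less_top[OF X(2)] by blast
  finally have fin: "emeasure \<sigma>\<^sub>0 UNIV < \<infinity>" .
  then have "emeasure \<sigma>\<^sub>0 (space \<sigma>\<^sub>0) \<noteq> \<infinity>"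
    unfolding sets_eq_imp_space_eq[OF s(1)] space_borel by (rule less_imp_neq)
  then show "finite_measure \<sigma>" unfolding s(2) by (rule finite_measure_completion)
qed

lemma integrable_frontier:
  fixes f :: "real^'d \<Rightarrow> real"
  assumes "continuous_on (frontier \<Omega>) f"
  shows "integrable \<sigma> f"
proof -
  obtain \<sigma>\<^sub>0 where s: "sets \<sigma>\<^sub>0 = sets borel" "\<sigma> = completion \<sigma>\<^sub>0" "emeasure \<sigma>\<^sub>0 (- frontier \<Omega>) = 0"
    using completed_surface by blast
  have comp: "compact (frontier \<Omega>)" using bounded_\<Omega> by (simp add: compact_frontier_bounded)
  have "(\<lambda>x. indicator (frontier \<Omega>) x *\<^sub>R f x) \<in> borel_measurable borel"
    by (rule borel_measurable_continuous_on_indicator[OF _ assms]) simp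
  then have m: "(\<lambda>x. indicator (frontier \<Omega>) x *\<^sub>R f x) \<in> borel_measurable \<sigma>\<^sub>0"
    by (simp only: measurable_cong_sets[OF s(1) refl])
  have "AE x in \<sigma>. indicator (frontier \<Omega>) x *\<^sub>R f x = f x"
    using AE_frontier by eventually_elim simp
  then have fm: "f \<in> borel_measurable \<sigma>"
    unfolding s(2) by (rule completion.borel_measurable_AE_eq[OF measurable_completion[OF m]])
  have "bounded (f ` frontier \<Omega>)"
    using compact_continuous_image[OF assms comp] by (rule compact_imp_bounded)
  then obtain B where "\<forall>y\<in>f ` frontier \<Omega>. norm y \<le> B" unfolding bounded_iff by blast
  then have "AE x in \<sigma>. norm (f x) \<le> B"
    using AE_frontier by (auto elim: eventually_mono)
  then show ?thesis by (rule finite_measure.integrable_const_bound[OF finite_\<sigma> _ fm])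
qed

lemma integrable_domain:
  fixes f :: "real^'d \<Rightarrow> real"
  assumes "continuous_on (closure \<Omega>) f"
  shows "integrable (lebesgue_on \<Omega>) f"
proof -
  have lm: "\<Omega> \<in> lmeasurable" using bounded_\<Omega> open_\<Omega> by (rule lmeasurable_open)
  have fm: "f \<in> borel_measurable (lebesgue_on \<Omega>)"
    using continuous_on_subset[OF assms closure_subset] lm
    by (intro continuous_imp_measurable_on_sets_lebesgue) auto
  have "bounded (f ` closure \<Omega>)"
    using compact_continuous_image[OF assms compact_closure_\<Omega>] by (rule compact_imp_bounded)
  then obtain B where B: "\<forall>y\<in>f ` closure \<Omega>. norm y \<le> B" unfolding bounded_iff by blast
  have "AE x in lebesgue_on \<Omega>. norm (f x) \<le> B"
    using B closure_subset by (intro AE_I2) (auto simp: space_restrict_space)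
  then show ?thesis by (rule finite_measure.integrable_const_bound[OF finite_measure_lebesgue_on[OF lm] _ fm])
qed

lemma integral_domain_lborel:
  fixes f :: "real^'d \<Rightarrow> real"
  assumes "continuous_on (closure \<Omega>) f"
  shows "(\<integral>x. f x \<partial>lebesgue_on \<Omega>) = (\<integral>x. indicator \<Omega> x * f x \<partial>lborel)"
proof -
  have m: "(\<lambda>x. indicator \<Omega> x *\<^sub>R f x) \<in> borel_measurable borel"
    using open_\<Omega> by (intro borel_measurable_continuous_on_indicator continuous_on_subset[OF assms closure_subset]) simp
  have "(\<integral>x. f x \<partial>lebesgue_on \<Omega>) = (\<integral>x. indicator \<Omega> x *\<^sub>R f x \<partial>lebesgue)"
    using open_\<Omega> by (intro integral_restrict_space) auto
  also have "\<dots> = (\<integral>x. indicator \<Omega> x *\<^sub>R f x \<partial>lborel)"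
    using m by (intro integral_completion) simp
  finally show ?thesis by simp
qed

text \<open>The radius depends on the point alone and not on \<open>f\<close>, so a subcover can be
  selected before the pieces of \<open>f\<close> are formed. Near an interior point both sides
  vanish; near the frontier \<open>local_divergence\<close> is transferred to the completed
  measure.\<close>

lemma local_flux:
  assumes x: "x \<in> closure \<Omega>"
  shows "\<exists>\<rho>>0. \<forall>f. C1_cl \<Omega> f \<longrightarrow> (\<forall>y\<in>closure \<Omega>. y \<notin> cball x \<rho> \<longrightarrow> f y = 0) \<longrightarrow> has_flux f"
proof -
  obtain \<sigma>\<^sub>0 where s: "sets \<sigma>\<^sub>0 = sets borel" "\<sigma> = completion \<sigma>\<^sub>0" "emeasure \<sigma>\<^sub>0 (- frontier \<Omega>) = 0"
    and sc: "\<And>V e g T \<Gamma> L. graph_chart \<Omega> V e g T \<Gamma> L \<Longrightarrow> lipschitz_surface_chart \<Omega> V e g T \<Gamma> L \<sigma>\<^sub>0"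
    using completed_surface by blast
  have fr: "AE z in \<sigma>\<^sub>0. z \<in> frontier \<Omega>"
    by (rule AE_I[where N = "- frontier \<Omega>"]) (use s in auto)
  show ?thesis
  proof (cases "x \<in> \<Omega>")
    case True
    then obtain \<rho> where \<rho>: "\<rho> > 0" "cball x \<rho> \<subseteq> \<Omega>" using open_\<Omega> open_contains_cball by blast
    have "has_flux f" if f: "C1_cl \<Omega> f" and supp: "\<forall>y\<in>closure \<Omega>. y \<notin> cball x \<rho> \<longrightarrow> f y = 0" for f
      unfolding has_flux_def
    proof
      fix i
      \<comment> \<open>The cut-off is the constant 1, with Lipschitz constant and derivative zero:
        compact support in \<open>\<Omega>\<close> already suffices.\<close>
      have "(\<integral>y. indicator \<Omega> y * (0 * f y + 1 * (grad \<Omega> f y \<bullet> axis i 1)) \<partial>lborel) = 0"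
        by (rule integral_cutoff_eq_0(2)[OF f compact_cball \<rho>(2), of _ 0])
          (use supp closure_subset in \<open>auto intro!: lipschitz_intros\<close>)
      then have 1: "(\<integral>y. pderiv_cl \<Omega> i f y \<partial>lebesgue_on \<Omega>) = 0"
        by (simp add: integral_domain_lborel[OF C1_cl_pderiv_continuous[OF f]] inner_axis grad_nth)
      have z: "AE z in \<sigma>\<^sub>0. 0 = f z * outward_normal \<Omega> z $ i"
        using fr
      proof eventually_elim
        case (elim z)
        then have "z \<in> closure \<Omega>" "z \<notin> \<Omega>" using open_\<Omega> by (auto simp: frontier_def interior_open)
        moreover from this have "z \<notin> cball x \<rho>" using \<rho> by blast
        ultimately have "f z = 0" using supp by blast
        then show ?case by simp
      qed
      show "integrable \<sigma> (\<lambda>z. f z * outward_normal \<Omega> z $ i) \<and>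
        (\<integral>x. pderiv_cl \<Omega> i f x \<partial>lebesgue_on \<Omega>) = (\<integral>z. f z * outward_normal \<Omega> z $ i \<partial>\<sigma>)"
        using integrable_completion_AE[OF integrable_zero z, folded s(2)]
        by (intro conjI) (simp_all only: 1 Bochner_Integration.integral_zero)
    qed
    then show ?thesis using \<rho> by blast
  next
    case False
    then have "x \<in> frontier \<Omega>" using x open_\<Omega> by (simp add: frontier_def interior_open)
    then obtain V e g T \<Gamma> L r where gc: "graph_chart \<Omega> V e g T \<Gamma> L" and r: "r > 0" "cball x (2 * r) \<subseteq> V"
      using chart_cball by blast
    interpret c: lipschitz_surface_chart \<Omega> V e g T \<Gamma> L \<sigma>\<^sub>0 by (rule sc[OF gc])
    have "has_flux f" if f: "C1_cl \<Omega> f" and supp: "\<forall>y\<in>closure \<Omega>. y \<notin> cball x r \<longrightarrow> f y = 0" for f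
      unfolding has_flux_def
    proof
      fix i
      have rr: "r < 2 * r" using r by simp
      let ?q = "\<lambda>z. indicator (closure \<Omega> \<inter> cball x (2 * r)) z * f z * (e - \<Gamma> z) $ i"
      have supp': "f y = 0" if "y \<in> closure \<Omega>" "y \<notin> cball x r" for y using supp that by blast
      have ld: "integrable \<sigma>\<^sub>0 (\<lambda>z. indicator V z * (?q z / c.J z))"
        "(\<integral>x. indicator \<Omega> x * pderiv_cl \<Omega> i f x \<partial>lborel) = (\<integral>z. indicator V z * (?q z / c.J z) \<partial>\<sigma>\<^sub>0)"
        by (rule c.local_divergence[OF f _ rr r(2)], erule (1) supp')+
      \<comment> \<open>Inside the larger ball \<open>(e - \<Gamma>) / J\<close> is the normal;
        outside it \<open>f\<close> vanishes.\<close>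
      have z: "AE z in \<sigma>\<^sub>0. indicator V z * (?q z / c.J z) = f z * outward_normal \<Omega> z $ i"
        using fr c.AE_outward_normal
      proof eventually_elim
        case (elim z)
        then have zc: "z \<in> closure \<Omega>" by (simp add: frontier_def)
        show ?case
        proof (cases "z \<in> cball x (2 * r)")
          case True
          then have "z \<in> V" using r by blast
          then show ?thesis using elim True zc by simp
        next
          case False
          then have "f z = 0" using supp' zc r by auto
          then show ?thesis by simp
        qed
      qed
      show "integrable \<sigma> (\<lambda>z. f z * outward_normal \<Omega> z $ i) \<and>
        (\<integral>x. pderiv_cl \<Omega> i f x \<partial>lebesgue_on \<Omega>) = (\<integral>z. f z * outward_normal \<Omega> z $ i \<partial>\<sigma>)"
        using integrable_completion_AE[OF ld(1) z, folded s(2)] ld(2)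
        by (intro conjI) (simp_all only: integral_domain_lborel[OF C1_cl_pderiv_continuous[OF f]])
    qed
    then show ?thesis using r by blast
  qed
qed

lemma has_flux_sum:
  assumes X: "finite X" and f: "\<And>x. x \<in> X \<Longrightarrow> C1_cl \<Omega> (f x)" "\<And>x. x \<in> X \<Longrightarrow> has_flux (f x)"
    and g: "\<And>y. y \<in> closure \<Omega> \<Longrightarrow> g y = (\<Sum>x\<in>X. f x y)"
  shows "has_flux g"
  unfolding has_flux_def
proof
  fix i
  note cs = C1_cl_sum[where f = f, OF X f(1)]
  have pd: "pderiv_cl \<Omega> i g y = (\<Sum>x\<in>X. pderiv_cl \<Omega> i (f x) y)" if "y \<in> closure \<Omega>" for y
    using C1_cl_cong(2)[of "\<lambda>y. \<Sum>x\<in>X. f x y" g] cs g that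
    by (simp add: grad_nth[symmetric])
  have fl: "integrable \<sigma> (\<lambda>z. f x z * outward_normal \<Omega> z $ i)"
    "(\<integral>y. pderiv_cl \<Omega> i (f x) y \<partial>lebesgue_on \<Omega>) = (\<integral>z. f x z * outward_normal \<Omega> z $ i \<partial>\<sigma>)" if "x \<in> X" for x
    using f(2)[OF that] by (auto simp: has_flux_def)
  let ?h = "\<lambda>z. \<Sum>x\<in>X. f x z * outward_normal \<Omega> z $ i"
  have hi: "integrable \<sigma> ?h" by (intro Bochner_Integration.integrable_sum fl)
  have ae: "AE z in \<sigma>. ?h z = g z * outward_normal \<Omega> z $ i"
    using AE_frontier by eventually_elim (simp add: g frontier_def sum_distrib_right)
  note ic = complete_measure.integrable_AE_eq[OF complete_\<sigma> hi ae]
  have "(\<integral>y. pderiv_cl \<Omega> i g y \<partial>lebesgue_on \<Omega>) = (\<integral>y. (\<Sum>x\<in>X. pderiv_cl \<Omega> i (f x) y) \<partial>lebesgue_on \<Omega>)"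
    using closure_subset by (intro Bochner_Integration.integral_cong refl pd) (auto simp: space_restrict_space)
  also have "\<dots> = (\<Sum>x\<in>X. \<integral>y. pderiv_cl \<Omega> i (f x) y \<partial>lebesgue_on \<Omega>)"
    by (intro Bochner_Integration.integral_sum integrable_domain C1_cl_pderiv_continuous f)
  also have "\<dots> = (\<Sum>x\<in>X. \<integral>z. f x z * outward_normal \<Omega> z $ i \<partial>\<sigma>)"
    using fl by simp
  also have "\<dots> = (\<integral>z. ?h z \<partial>\<sigma>)" by (intro Bochner_Integration.integral_sum[symmetric] fl)
  also have "\<dots> = (\<integral>z. g z * outward_normal \<Omega> z $ i \<partial>\<sigma>)" using ic(2) by simp
  finally show "integrable \<sigma> (\<lambda>z. g z * outward_normal \<Omega> z $ i) \<and>
        (\<integral>x. pderiv_cl \<Omega> i g x \<partial>lebesgue_on \<Omega>) = (\<integral>z. g z * outward_normal \<Omega> z $ i \<partial>\<sigma>)"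
    using ic(1) by simp
qed

lemma C1_cl_bump:
  "C1_cl \<Omega> (\<lambda>y. (max 0 (r\<^sup>2 - (y - x) \<bullet> (y - x)))\<^sup>2)"
proof (rule C1_cl_intro(1))
  fix y
  let ?s = "\<lambda>y. r\<^sup>2 - (y - x) \<bullet> (y - x)"
  have "(?s has_derivative (\<lambda>h. - (2 * ((y - x) \<bullet> h)))) (at y within closure \<Omega>)"
    by (auto intro!: derivative_eq_intros simp: inner_commute)
  from has_derivative_compose[OF this has_real_derivative_max_0_squared[of "?s y", unfolded has_field_derivative_def]]
  show "((\<lambda>y. (max 0 (?s y))\<^sup>2) has_derivative (\<lambda>h. (- (4 * max 0 (?s y)) *\<^sub>R (y - x)) \<bullet> h)) (at y within closure \<Omega>)"
    by (simp add: algebra_simps)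
  show "continuous_on (closure \<Omega>) (\<lambda>y. - (4 * max 0 (?s y)) *\<^sub>R (y - x))"
    by (intro continuous_intros)
qed

text \<open>Truncated paraboloids over a finite subcover, divided by their sum, form the partition
  of unity. The sum is nonzero on the closure, and since smoothness up to the boundary is tested
  there only, the quotients are admissible.\<close>

theorem has_flux_C1:
  assumes f: "C1_cl \<Omega> f"
  shows "has_flux f"
proof -
  have "\<forall>x\<in>closure \<Omega>. \<exists>\<rho>. \<rho> > 0 \<and> (\<forall>f. C1_cl \<Omega> f \<longrightarrow> (\<forall>y\<in>closure \<Omega>. y \<notin> cball x \<rho> \<longrightarrow> f y = 0) \<longrightarrow> has_flux f)"
    using local_flux by blast
  from bchoice[OF this] obtain \<rho> where
    \<rho>: "\<forall>x\<in>closure \<Omega>. \<rho> x > 0 \<and> (\<forall>f. C1_cl \<Omega> f \<longrightarrow> (\<forall>y\<in>closure \<Omega>. y \<notin> cball x (\<rho> x) \<longrightarrow> f y = 0) \<longrightarrow> has_flux f)" ..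
  have cover: "closure \<Omega> \<subseteq> (\<Union>x\<in>closure \<Omega>. ball x (\<rho> x))"
    using \<rho> by (meson UN_I centre_in_ball subsetI)
  obtain X where X: "X \<subseteq> closure \<Omega>" "finite X" "closure \<Omega> \<subseteq> (\<Union>x\<in>X. ball x (\<rho> x))"
    by (rule compactE_image[OF compact_closure_\<Omega> open_ball cover])
  define \<psi> where "\<psi> = (\<lambda>x y. (max 0 ((\<rho> x)\<^sup>2 - (y - x) \<bullet> (y - x)))\<^sup>2)"
  define s where "s = (\<lambda>y. \<Sum>x\<in>X. \<psi> x y)"
  have \<psi>C: "C1_cl \<Omega> (\<psi> x)" for x unfolding \<psi>_def by (rule C1_cl_bump)
  have sC: "C1_cl \<Omega> s" unfolding s_def using C1_cl_sum[of X \<psi>, OF X(2) \<psi>C] by blast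
  have \<psi>0: "\<psi> x y \<ge> 0" for x y by (simp add: \<psi>_def)
  have s0: "s y \<noteq> 0" if y: "y \<in> closure \<Omega>" for y
  proof -
    obtain x where x: "x \<in> X" "y \<in> ball x (\<rho> x)" using X(3) y by blast
    then have "(norm (y - x))\<^sup>2 < (\<rho> x)\<^sup>2"
      by (intro power_strict_mono) (auto simp: dist_norm norm_minus_commute)
    then have "\<psi> x y > 0" by (simp add: \<psi>_def power2_norm_eq_inner)
    moreover have "\<psi> x y \<le> s y" unfolding s_def by (rule member_le_sum[OF x(1) \<psi>0 X(2)])
    ultimately show ?thesis by simp
  qed
  have supp: "\<psi> x y = 0" if x: "x \<in> X" "y \<notin> cball x (\<rho> x)" for x y
  proof -
    have "\<rho> x > 0" using x X \<rho> by blast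
    then have "(\<rho> x)\<^sup>2 \<le> (norm (y - x))\<^sup>2"
      using x by (intro power_mono) (auto simp: dist_norm norm_minus_commute)
    then show ?thesis by (simp add: \<psi>_def power2_norm_eq_inner)
  qed
  let ?f = "\<lambda>x y. \<psi> x y * (inverse (s y) * f y)"
  have fC: "C1_cl \<Omega> (?f x)" for x
    by (intro C1_cl_mult \<psi>C C1_cl_inverse sC s0 f)
  show ?thesis
  proof (rule has_flux_sum[OF X(2), where f = ?f])
    show "C1_cl \<Omega> (?f x)" for x by (rule fC)
    show "has_flux (?f x)" if x: "x \<in> X" for x
    proof -
      have "\<forall>y\<in>closure \<Omega>. y \<notin> cball x (\<rho> x) \<longrightarrow> ?f x y = 0" using supp[OF x] by simp
      then show ?thesis using \<rho> fC x X(1) by blast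
    qed
    show "f y = (\<Sum>x\<in>X. ?f x y)" if "y \<in> closure \<Omega>" for y
      using s0[OF that] by (simp add: sum_distrib_right[symmetric] s_def)
  qed
qed

end

section \<open>Integration by parts\<close>

lemma l2_norm_squared: "(l2_norm M f)\<^sup>2 = (\<integral>x. f x \<bullet> f x \<partial>M)"
proof -
  have "(\<integral>x. f x \<bullet> f x \<partial>M) \<ge> 0" by (intro integral_nonneg_AE AE_I2) simp
  then show ?thesis by (simp add: l2_norm_def l2_inner_def)
qed

context lipschitz_domain
begin

section \<open>Calculus of vector fields\<close>

lemma vC1_clD: "vC1_cl \<Omega> v \<Longrightarrow> C1_cl \<Omega> (\<lambda>x. v x $ i)"
  by (simp add: vC1_cl_def)

lemma vC2_clD: "vC2_cl \<Omega> v \<Longrightarrow> C2_cl \<Omega> (\<lambda>x. v x $ i)"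
  by (simp add: vC2_cl_def)

lemma vC2_cl_imp_vC1_cl: "vC2_cl \<Omega> v \<Longrightarrow> vC1_cl \<Omega> v"
  by (simp add: vC1_cl_def vC2_cl_def C2_clD)

lemma C2_cl_imp_vC1_cl_grad: "C2_cl \<Omega> f \<Longrightarrow> vC1_cl \<Omega> (grad \<Omega> f)"
  by (simp add: vC1_cl_def grad_nth C2_clD)

lemma vC1_cl_continuous: "vC1_cl \<Omega> v \<Longrightarrow> continuous_on (closure \<Omega>) v"
  using continuous_on_vec_lambda[of "closure \<Omega>" "\<lambda>i x. v x $ i"] C1_cl_continuous[OF vC1_clD]
  by (simp add: vec_nth_inverse)

lemma divg_continuous: "vC1_cl \<Omega> v \<Longrightarrow> continuous_on (closure \<Omega>) (divg \<Omega> v)"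
  unfolding divg_def by (intro continuous_on_sum C1_cl_pderiv_continuous vC1_clD)

lemma divg_grad: "divg \<Omega> (grad \<Omega> f) = lapl \<Omega> f"
  by (simp add: divg_def lapl_def grad_nth fun_eq_iff)

lemma lapl_continuous: "C2_cl \<Omega> f \<Longrightarrow> continuous_on (closure \<Omega>) (lapl \<Omega> f)"
  using divg_continuous[OF C2_cl_imp_vC1_cl_grad] by (simp add: divg_grad)

lemma vC1_cl_scaleR: "C1_cl \<Omega> f \<Longrightarrow> vC1_cl \<Omega> v \<Longrightarrow> vC1_cl \<Omega> (\<lambda>x. f x *\<^sub>R v x)"
  by (simp add: vC1_cl_def C1_cl_mult)

lemma vC1_cl_add: "vC1_cl \<Omega> v \<Longrightarrow> vC1_cl \<Omega> w \<Longrightarrow> vC1_cl \<Omega> (\<lambda>x. v x + w x)"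
  by (simp add: vC1_cl_def C1_cl_add)

lemma vC2_cl_add: "vC2_cl \<Omega> v \<Longrightarrow> vC2_cl \<Omega> w \<Longrightarrow> vC2_cl \<Omega> (\<lambda>x. v x + w x)"
  by (simp add: vC2_cl_def C2_cl_add)

lemma vC2_cl_cmult: "vC2_cl \<Omega> v \<Longrightarrow> vC2_cl \<Omega> (\<lambda>x. c *\<^sub>R v x)"
  by (simp add: vC2_cl_def C2_cl_cmult)

lemma C1_cl_inner:
  assumes v: "vC1_cl \<Omega> v" and w: "vC1_cl \<Omega> w"
  shows "C1_cl \<Omega> (\<lambda>x. v x \<bullet> w x)"
    "\<And>x. x \<in> closure \<Omega> \<Longrightarrow> grad \<Omega> (\<lambda>x. v x \<bullet> w x) x =
      (\<Sum>j\<in>UNIV. w x $ j *\<^sub>R grad \<Omega> (\<lambda>y. v y $ j) x + v x $ j *\<^sub>R grad \<Omega> (\<lambda>y. w y $ j) x)"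
proof -
  note c = C1_cl_mult[OF vC1_clD[OF v] vC1_clD[OF w]]
  have eq: "(\<lambda>x. v x \<bullet> w x) = (\<lambda>x. \<Sum>j\<in>UNIV. v x $ j * w x $ j)"
    by (simp add: inner_vec_def fun_eq_iff)
  note s = C1_cl_sum[of "UNIV :: 'd set" "\<lambda>j x. v x $ j * w x $ j", OF finite c(1)]
  show "C1_cl \<Omega> (\<lambda>x. v x \<bullet> w x)" using s unfolding eq by blast
  show "grad \<Omega> (\<lambda>x. v x \<bullet> w x) x =
      (\<Sum>j\<in>UNIV. w x $ j *\<^sub>R grad \<Omega> (\<lambda>y. v y $ j) x + v x $ j *\<^sub>R grad \<Omega> (\<lambda>y. w y $ j) x)"
    if "x \<in> closure \<Omega>" for x
    using s that unfolding eq by (simp add: c(2))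
qed

lemma deriv_cl_vec:
  assumes v: "vC1_cl \<Omega> v" and x: "x \<in> closure \<Omega>"
  shows "deriv_cl \<Omega> v x h $ j = grad \<Omega> (\<lambda>y. v y $ j) x \<bullet> h"
proof -
  have "(v has_derivative (\<lambda>h. \<chi> j. grad \<Omega> (\<lambda>y. v y $ j) x \<bullet> h)) (at x within closure \<Omega>)"
    unfolding has_derivative_componentwise_within[of v]
  proof
    fix b :: "real^'d" assume "b \<in> Basis"
    then obtain i where b: "b = axis i 1" by (auto simp: Basis_vec_def)
    show "((\<lambda>x. v x \<bullet> b) has_derivative (\<lambda>h. (\<chi> j. grad \<Omega> (\<lambda>y. v y $ j) x \<bullet> h) \<bullet> b)) (at x within closure \<Omega>)"
      using C1_cl_has_derivative[OF vC1_clD[OF v] x, of i] by (simp add: b inner_axis)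
  qed
  from deriv_cl_eqI[OF x this] show ?thesis by simp
qed

end

section \<open>Gauss and Green formulas\<close>

context lipschitz_surface
begin

text \<open>Applying the flux identity to the products \<open>w x $ i * q x\<close> and summing over
  \<open>i\<close> gives the divergence of \<open>q\<close> times \<open>w\<close>, split by the
  product rule. All later integrations by parts are instances of this one.\<close>

lemma gauss_product:
  assumes w: "vC1_cl \<Omega> w" and q: "C1_cl \<Omega> q"
  shows "integrable \<sigma> (\<lambda>z. q z * (w z \<bullet> outward_normal \<Omega> z))"
    "(\<integral>x. divg \<Omega> w x * q x \<partial>lebesgue_on \<Omega>) =
      (\<integral>z. q z * (w z \<bullet> outward_normal \<Omega> z) \<partial>\<sigma>) - (\<integral>x. w x \<bullet> grad \<Omega> q x \<partial>lebesgue_on \<Omega>)"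
proof -
  have c: "C1_cl \<Omega> (\<lambda>x. w x $ i * q x)" for i by (intro C1_cl_mult vC1_clD w q)
  have fl: "integrable \<sigma> (\<lambda>z. w z $ i * q z * outward_normal \<Omega> z $ i)"
    "(\<integral>x. pderiv_cl \<Omega> i (\<lambda>x. w x $ i * q x) x \<partial>lebesgue_on \<Omega>) = (\<integral>z. w z $ i * q z * outward_normal \<Omega> z $ i \<partial>\<sigma>)" for i
    using has_flux_C1[OF c[of i]] by (auto simp: has_flux_def)
  have eq: "(\<lambda>z. q z * (w z \<bullet> outward_normal \<Omega> z)) = (\<lambda>z. \<Sum>i\<in>UNIV. w z $ i * q z * outward_normal \<Omega> z $ i)"
    by (simp add: fun_eq_iff inner_vec_def sum_distrib_left ac_simps)
  show i1: "integrable \<sigma> (\<lambda>z. q z * (w z \<bullet> outward_normal \<Omega> z))"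
    unfolding eq by (intro Bochner_Integration.integrable_sum fl)
  have pd: "pderiv_cl \<Omega> i (\<lambda>x. w x $ i * q x) x = pderiv_cl \<Omega> i (\<lambda>x. w x $ i) x * q x + w x $ i * pderiv_cl \<Omega> i q x"
    if "x \<in> closure \<Omega>" for i x
    using C1_cl_mult(2)[OF vC1_clD[OF w, of i] q that]
    by (simp add: grad_nth[symmetric] mult.commute)
  have "(\<integral>z. q z * (w z \<bullet> outward_normal \<Omega> z) \<partial>\<sigma>) = (\<Sum>i\<in>UNIV. \<integral>z. w z $ i * q z * outward_normal \<Omega> z $ i \<partial>\<sigma>)"
    unfolding eq by (intro Bochner_Integration.integral_sum fl)
  also have "\<dots> = (\<Sum>i\<in>UNIV. \<integral>x. pderiv_cl \<Omega> i (\<lambda>x. w x $ i * q x) x \<partial>lebesgue_on \<Omega>)"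
    by (simp only: fl(2))
  also have "\<dots> = (\<integral>x. (\<Sum>i\<in>UNIV. pderiv_cl \<Omega> i (\<lambda>x. w x $ i * q x) x) \<partial>lebesgue_on \<Omega>)"
    by (intro Bochner_Integration.integral_sum[symmetric] integrable_domain C1_cl_pderiv_continuous c)
  also have "\<dots> = (\<integral>x. divg \<Omega> w x * q x + w x \<bullet> grad \<Omega> q x \<partial>lebesgue_on \<Omega>)"
  proof (intro Bochner_Integration.integral_cong refl)
    fix x assume "x \<in> space (lebesgue_on \<Omega>)"
    then have "x \<in> closure \<Omega>" using closure_subset by (auto simp: space_restrict_space)
    then show "(\<Sum>i\<in>UNIV. pderiv_cl \<Omega> i (\<lambda>x. w x $ i * q x) x) = divg \<Omega> w x * q x + w x \<bullet> grad \<Omega> q x"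
      by (simp add: pd divg_def inner_vec_def grad_nth sum.distrib sum_distrib_right)
  qed
  also have "\<dots> = (\<integral>x. divg \<Omega> w x * q x \<partial>lebesgue_on \<Omega>) + (\<integral>x. w x \<bullet> grad \<Omega> q x \<partial>lebesgue_on \<Omega>)"
    by (intro Bochner_Integration.integral_add integrable_domain continuous_intros divg_continuous
        C1_cl_continuous C1_cl_grad_continuous vC1_cl_continuous w q)
  finally show "(\<integral>x. divg \<Omega> w x * q x \<partial>lebesgue_on \<Omega>) =
      (\<integral>z. q z * (w z \<bullet> outward_normal \<Omega> z) \<partial>\<sigma>) - (\<integral>x. w x \<bullet> grad \<Omega> q x \<partial>lebesgue_on \<Omega>)"
    by simp
qed

lemma gauss_product_tangential:
  assumes w: "vC1_cl \<Omega> w" and q: "C1_cl \<Omega> q" and wn: "AE z in \<sigma>. w z \<bullet> outward_normal \<Omega> z = 0"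
  shows "(\<integral>x. w x \<bullet> grad \<Omega> q x \<partial>lebesgue_on \<Omega>) = - (\<integral>x. divg \<Omega> w x * q x \<partial>lebesgue_on \<Omega>)"
proof -
  have "AE z in \<sigma>. 0 = q z * (w z \<bullet> outward_normal \<Omega> z)"
    using wn by eventually_elim simp
  from complete_measure.integrable_AE_eq(2)[OF complete_\<sigma> integrable_zero this]
  show ?thesis using gauss_product(2)[OF w q] by simp
qed

lemma solenoidal_orthogonal_grad:
  assumes w: "vC1_cl \<Omega> w" and q: "C1_cl \<Omega> q" and wn: "AE z in \<sigma>. w z \<bullet> outward_normal \<Omega> z = 0"
    and div: "\<And>x. x \<in> \<Omega> \<Longrightarrow> divg \<Omega> w x = 0"
  shows "(\<integral>x. w x \<bullet> grad \<Omega> q x \<partial>lebesgue_on \<Omega>) = 0"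
proof -
  have "(\<integral>x. divg \<Omega> w x * q x \<partial>lebesgue_on \<Omega>) = (\<integral>x. 0 \<partial>lebesgue_on \<Omega>)"
    by (intro Bochner_Integration.integral_cong refl) (simp add: div space_restrict_space)
  then show ?thesis using gauss_product_tangential[OF w q wn] by simp
qed

lemma green:
  assumes f: "C2_cl \<Omega> f" and q: "C1_cl \<Omega> q"
  shows "integrable \<sigma> (\<lambda>z. q z * normal_deriv \<Omega> f z)"
    "(\<integral>x. lapl \<Omega> f x * q x \<partial>lebesgue_on \<Omega>) =
      (\<integral>z. q z * normal_deriv \<Omega> f z \<partial>\<sigma>) - (\<integral>x. grad \<Omega> f x \<bullet> grad \<Omega> q x \<partial>lebesgue_on \<Omega>)"
proof -
  have "AE z in \<sigma>. q z * (grad \<Omega> f z \<bullet> outward_normal \<Omega> z) = q z * normal_deriv \<Omega> f z"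
    using AE_frontier
    by eventually_elim (simp add: normal_deriv_def deriv_cl_C1[OF C2_clD(1)[OF f]] frontier_def)
  note e = complete_measure.integrable_AE_eq[OF complete_\<sigma> gauss_product(1)[OF C2_cl_imp_vC1_cl_grad[OF f] q] this]
  show "integrable \<sigma> (\<lambda>z. q z * normal_deriv \<Omega> f z)" by (rule e(1))
  show "(\<integral>x. lapl \<Omega> f x * q x \<partial>lebesgue_on \<Omega>) =
      (\<integral>z. q z * normal_deriv \<Omega> f z \<partial>\<sigma>) - (\<integral>x. grad \<Omega> f x \<bullet> grad \<Omega> q x \<partial>lebesgue_on \<Omega>)"
    using gauss_product(2)[OF C2_cl_imp_vC1_cl_grad[OF f] q] by (simp add: e(2) divg_grad)
qed

lemma green_vector:
  assumes v: "vC2_cl \<Omega> v"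
  shows "integrable \<sigma> (\<lambda>z. v z \<bullet> normal_deriv \<Omega> v z)"
    "(\<integral>x. vlapl \<Omega> v x \<bullet> v x \<partial>lebesgue_on \<Omega>) =
      (\<integral>z. v z \<bullet> normal_deriv \<Omega> v z \<partial>\<sigma>) - (\<integral>x. vgrad \<Omega> v x \<bullet> vgrad \<Omega> v x \<partial>lebesgue_on \<Omega>)"
proof -
  note v1 = vC2_cl_imp_vC1_cl[OF v]
  let ?v = "\<lambda>i x. v x $ i"
  note g = green[OF vC2_clD[OF v] vC1_clD[OF v1]]
  have ae: "AE z in \<sigma>. (\<Sum>i\<in>UNIV. ?v i z * normal_deriv \<Omega> (?v i) z) = v z \<bullet> normal_deriv \<Omega> v z"
    using AE_frontier
    by eventually_elim
      (simp add: normal_deriv_def deriv_cl_C1[OF vC1_clD[OF v1]] deriv_cl_vec[OF v1] frontier_def inner_vec_def)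
  have si: "integrable \<sigma> (\<lambda>z. \<Sum>i\<in>UNIV. ?v i z * normal_deriv \<Omega> (?v i) z)"
    by (intro Bochner_Integration.integrable_sum g)
  note e = complete_measure.integrable_AE_eq[OF complete_\<sigma> si ae]
  show "integrable \<sigma> (\<lambda>z. v z \<bullet> normal_deriv \<Omega> v z)" by (rule e(1))
  have "(\<integral>x. vlapl \<Omega> v x \<bullet> v x \<partial>lebesgue_on \<Omega>) = (\<integral>x. (\<Sum>i\<in>UNIV. lapl \<Omega> (?v i) x * ?v i x) \<partial>lebesgue_on \<Omega>)"
    by (simp add: vlapl_def inner_vec_def)
  also have "\<dots> = (\<Sum>i\<in>UNIV. \<integral>x. lapl \<Omega> (?v i) x * ?v i x \<partial>lebesgue_on \<Omega>)"
    by (intro Bochner_Integration.integral_sum integrable_domain continuous_on_mult lapl_continuous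
        C1_cl_continuous vC2_clD vC1_clD v v1)
  also have "\<dots> = (\<Sum>i\<in>UNIV. \<integral>z. ?v i z * normal_deriv \<Omega> (?v i) z \<partial>\<sigma>) -
      (\<Sum>i\<in>UNIV. \<integral>x. grad \<Omega> (?v i) x \<bullet> grad \<Omega> (?v i) x \<partial>lebesgue_on \<Omega>)"
    by (simp add: g(2) sum_subtractf)
  also have "(\<Sum>i\<in>UNIV. \<integral>z. ?v i z * normal_deriv \<Omega> (?v i) z \<partial>\<sigma>) = (\<integral>z. v z \<bullet> normal_deriv \<Omega> v z \<partial>\<sigma>)"
    unfolding e(2) by (intro Bochner_Integration.integral_sum[symmetric] g)
  also have "(\<Sum>i\<in>UNIV. \<integral>x. grad \<Omega> (?v i) x \<bullet> grad \<Omega> (?v i) x \<partial>lebesgue_on \<Omega>) =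
      (\<integral>x. (\<Sum>i\<in>UNIV. grad \<Omega> (?v i) x \<bullet> grad \<Omega> (?v i) x) \<partial>lebesgue_on \<Omega>)"
    by (intro Bochner_Integration.integral_sum[symmetric] integrable_domain continuous_on_inner
        C1_cl_grad_continuous vC1_clD v1)
  also have "\<dots> = (\<integral>x. vgrad \<Omega> v x \<bullet> vgrad \<Omega> v x \<partial>lebesgue_on \<Omega>)"
    by (simp add: vgrad_def inner_vec_def[of "vec_lambda _"])
  finally show "(\<integral>x. vlapl \<Omega> v x \<bullet> v x \<partial>lebesgue_on \<Omega>) =
      (\<integral>z. v z \<bullet> normal_deriv \<Omega> v z \<partial>\<sigma>) - (\<integral>x. vgrad \<Omega> v x \<bullet> vgrad \<Omega> v x \<partial>lebesgue_on \<Omega>)" .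
qed

text \<open>Tested with \<open>v\<close>, the transport part of \<open>Bform\<close> is the
  derivative of half the squared length of \<open>v\<close> along \<open>a\<close>. Integration by
  parts, without boundary term because \<open>a\<close> is tangential, turns it into minus half of
  the divergence term, which the second part of \<open>Bform\<close> compensates.\<close>

lemma convection_skew:
  assumes a: "vC1_cl \<Omega> a" and v: "vC1_cl \<Omega> v" and an: "AE z in \<sigma>. a z \<bullet> outward_normal \<Omega> z = 0"
  shows "continuous_on (closure \<Omega>) (Bform \<Omega> a v)"
    "(\<integral>x. Bform \<Omega> a v x \<bullet> v x \<partial>lebesgue_on \<Omega>) = 0"
proof -
  let ?B = "\<lambda>x. (\<chi> j. grad \<Omega> (\<lambda>y. v y $ j) x \<bullet> a x + (1/2) * divg \<Omega> a x * v x $ j)"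
  have B: "Bform \<Omega> a v x = ?B x" if "x \<in> closure \<Omega>" for x
    using deriv_cl_vec[OF v that] by (simp add: Bform_def vec_eq_iff)
  have "continuous_on (closure \<Omega>) ?B"
    by (intro continuous_intros C1_cl_grad_continuous C1_cl_continuous vC1_clD vC1_cl_continuous divg_continuous a v)
  then show cB: "continuous_on (closure \<Omega>) (Bform \<Omega> a v)"
    by (rule continuous_on_eq) (simp add: B)
  have q: "C1_cl \<Omega> (\<lambda>x. (1/2) * (v x \<bullet> v x))" by (intro C1_cl_cmult C1_cl_inner v)
  have gq: "grad \<Omega> (\<lambda>x. (1/2) * (v x \<bullet> v x)) x = (\<Sum>j\<in>UNIV. v x $ j *\<^sub>R grad \<Omega> (\<lambda>y. v y $ j) x)"
    if "x \<in> closure \<Omega>" for x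
    using C1_cl_cmult(2)[OF C1_cl_inner(1)[OF v v] that, of "1/2"] C1_cl_inner(2)[OF v v that]
    by (simp add: scaleR_sum_right scaleR_add_left[symmetric] flip: scaleR_2)
  have "(\<integral>x. Bform \<Omega> a v x \<bullet> v x \<partial>lebesgue_on \<Omega>) =
     (\<integral>x. a x \<bullet> grad \<Omega> (\<lambda>x. (1/2) * (v x \<bullet> v x)) x + divg \<Omega> a x * ((1/2) * (v x \<bullet> v x)) \<partial>lebesgue_on \<Omega>)"
  proof (intro Bochner_Integration.integral_cong refl)
    fix x assume "x \<in> space (lebesgue_on \<Omega>)"
    then have x: "x \<in> closure \<Omega>" using closure_subset by (auto simp: space_restrict_space)
    have "?B x \<bullet> v x = (\<Sum>j\<in>UNIV. (grad \<Omega> (\<lambda>y. v y $ j) x \<bullet> a x) * v x $ j) + divg \<Omega> a x * ((1/2) * (v x \<bullet> v x))"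
      by (simp add: inner_vec_def[of _ "v x"] algebra_simps sum.distrib sum_distrib_left)
    also have "(\<Sum>j\<in>UNIV. (grad \<Omega> (\<lambda>y. v y $ j) x \<bullet> a x) * v x $ j) = a x \<bullet> grad \<Omega> (\<lambda>x. (1/2) * (v x \<bullet> v x)) x"
      unfolding gq[OF x] by (simp add: inner_sum_right inner_commute mult.commute)
    finally show "Bform \<Omega> a v x \<bullet> v x = a x \<bullet> grad \<Omega> (\<lambda>x. (1/2) * (v x \<bullet> v x)) x + divg \<Omega> a x * ((1/2) * (v x \<bullet> v x))"
      unfolding B[OF x] .
  qed
  also have "\<dots> = (\<integral>x. a x \<bullet> grad \<Omega> (\<lambda>x. (1/2) * (v x \<bullet> v x)) x \<partial>lebesgue_on \<Omega>) +
      (\<integral>x. divg \<Omega> a x * ((1/2) * (v x \<bullet> v x)) \<partial>lebesgue_on \<Omega>)"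
    by (intro Bochner_Integration.integral_add integrable_domain continuous_on_inner continuous_on_mult
        vC1_cl_continuous C1_cl_grad_continuous C1_cl_continuous divg_continuous a q)
  also have "\<dots> = 0" using gauss_product_tangential[OF a q an] by simp
  finally show "(\<integral>x. Bform \<Omega> a v x \<bullet> v x \<partial>lebesgue_on \<Omega>) = 0" .
qed

section \<open>Energy balances of the scheme\<close>

lemma space_domain: "x \<in> space (lebesgue_on \<Omega>) \<Longrightarrow> x \<in> \<Omega>" "x \<in> \<Omega> \<Longrightarrow> x \<in> closure \<Omega>"
  using closure_subset by (auto simp: space_restrict_space)

text \<open>Since \<open>v\<close> is the mean of \<open>w1\<close> and \<open>w0\<close>, its
  product with their difference is half the difference of the squares. The fields \<open>r\<close>
  and \<open>s\<close> stand for the pressure gradient and the capillary force; their work is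
  carried along, to be absorbed by \<open>projection_balance\<close> and
  \<open>phase_balance\<close>.\<close>

lemma momentum_balance:
  fixes w1 w0 v a r s :: "real^'d \<Rightarrow> real^'d"
  assumes w: "vC1_cl \<Omega> w1" "vC1_cl \<Omega> w0" and v: "vC2_cl \<Omega> v" "\<And>x. v x = (1/2) *\<^sub>R (w1 x + w0 x)"
    and a: "vC1_cl \<Omega> a" "AE z in \<sigma>. a z \<bullet> outward_normal \<Omega> z = 0"
    and r: "continuous_on (closure \<Omega>) r" "continuous_on (closure \<Omega>) s"
    and eq: "\<And>x. x \<in> \<Omega> \<Longrightarrow> (1 / dt) *\<^sub>R (w1 x - w0 x) + Bform \<Omega> a v x - nu *\<^sub>R vlapl \<Omega> v x + r x + s x = 0"
  shows "((\<integral>x. w1 x \<bullet> w1 x \<partial>lebesgue_on \<Omega>) - (\<integral>x. w0 x \<bullet> w0 x \<partial>lebesgue_on \<Omega>)) / (2 * dt) =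
    nu * ((\<integral>z. v z \<bullet> normal_deriv \<Omega> v z \<partial>\<sigma>) - (\<integral>x. vgrad \<Omega> v x \<bullet> vgrad \<Omega> v x \<partial>lebesgue_on \<Omega>))
    - (\<integral>x. r x \<bullet> v x \<partial>lebesgue_on \<Omega>) - (\<integral>x. s x \<bullet> v x \<partial>lebesgue_on \<Omega>)"
proof -
  note v1 = vC2_cl_imp_vC1_cl[OF v(1)]
  note cv = vC1_cl_continuous[OF v1] and cw = vC1_cl_continuous[OF w(1)] vC1_cl_continuous[OF w(2)]
  note B = convection_skew[OF a(1) v1 a(2)]
  have cl: "continuous_on (closure \<Omega>) (vlapl \<Omega> v)"
    unfolding vlapl_def by (intro continuous_intros lapl_continuous vC2_clD v)
  have int: "integrable (lebesgue_on \<Omega>) (\<lambda>x. f x \<bullet> h x)"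
    if "continuous_on (closure \<Omega>) f" "continuous_on (closure \<Omega>) h" for f h :: "real^'d \<Rightarrow> real^'d"
    using that by (intro integrable_domain continuous_on_inner)
  have pw: "(1 / (2 * dt)) * (w1 x \<bullet> w1 x) - (1 / (2 * dt)) * (w0 x \<bullet> w0 x) =
      nu * (vlapl \<Omega> v x \<bullet> v x) - Bform \<Omega> a v x \<bullet> v x - r x \<bullet> v x - s x \<bullet> v x"
    if x: "x \<in> \<Omega>" for x
  proof -
    have vv: "(w1 x - w0 x) \<bullet> v x = (w1 x \<bullet> w1 x - w0 x \<bullet> w0 x) / 2"
      by (simp add: v(2) inner_diff_left inner_diff_right inner_add_right inner_commute)
    have "((1 / dt) *\<^sub>R (w1 x - w0 x) + Bform \<Omega> a v x - nu *\<^sub>R vlapl \<Omega> v x + r x + s x) \<bullet> v x = 0"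
      using eq[OF x] by simp
    then have "(1 / dt) * ((w1 x \<bullet> w1 x - w0 x \<bullet> w0 x) / 2) + Bform \<Omega> a v x \<bullet> v x
        - nu * (vlapl \<Omega> v x \<bullet> v x) + r x \<bullet> v x + s x \<bullet> v x = 0"
      unfolding inner_add_left inner_diff_left[of "_ + _"] inner_scaleR_left vv .
    moreover have "(1 / dt) * ((w1 x \<bullet> w1 x - w0 x \<bullet> w0 x) / 2) =
        (1 / (2 * dt)) * (w1 x \<bullet> w1 x) - (1 / (2 * dt)) * (w0 x \<bullet> w0 x)"
      by (simp add: diff_divide_distrib mult.commute)
    ultimately show ?thesis by linarith
  qed
  have "(\<integral>x. (1 / (2 * dt)) * (w1 x \<bullet> w1 x) - (1 / (2 * dt)) * (w0 x \<bullet> w0 x) \<partial>lebesgue_on \<Omega>) =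
     (\<integral>x. nu * (vlapl \<Omega> v x \<bullet> v x) - Bform \<Omega> a v x \<bullet> v x - r x \<bullet> v x - s x \<bullet> v x \<partial>lebesgue_on \<Omega>)"
    by (intro Bochner_Integration.integral_cong refl pw space_domain)
  then show ?thesis
    using int[OF cw(1) cw(1)] int[OF cw(2) cw(2)] int[OF cl cv] int[OF B(1) cv] int[OF r(1) cv] int[OF r(2) cv]
    by (simp add: B(2) green_vector(2)[OF v(1)] diff_divide_distrib)
qed

text \<open>The test function is \<open>\<mu>\<close>. The transported flux
  \<open>\<phi>s *\<^sub>R v\<close> is tangential, so integrating it by parts yields exactly the
  work of the capillary force that appears in the momentum balance.\<close>

lemma phase_balance:
  assumes \<phi>s: "C1_cl \<Omega> \<phi>s" and d: "C1_cl \<Omega> d" and v: "vC1_cl \<Omega> v" "AE z in \<sigma>. v z \<bullet> outward_normal \<Omega> z = 0"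
    and \<mu>: "C2_cl \<Omega> \<mu>" "AE z in \<sigma>. normal_deriv \<Omega> \<mu> z = 0"
    and eq: "\<And>x. x \<in> \<Omega> \<Longrightarrow> d x / dt + divg \<Omega> (\<lambda>y. \<phi>s y *\<^sub>R v y) x = M * lapl \<Omega> \<mu> x"
  shows "(\<integral>x. \<mu> x * d x \<partial>lebesgue_on \<Omega>) / dt =
    (\<integral>x. (\<phi>s x *\<^sub>R grad \<Omega> \<mu> x) \<bullet> v x \<partial>lebesgue_on \<Omega>) - M * (\<integral>x. grad \<Omega> \<mu> x \<bullet> grad \<Omega> \<mu> x \<partial>lebesgue_on \<Omega>)"
proof -
  note \<mu>1 = C2_clD(1)[OF \<mu>(1)]
  let ?w = "\<lambda>y. \<phi>s y *\<^sub>R v y"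
  have w: "vC1_cl \<Omega> ?w" by (intro vC1_cl_scaleR \<phi>s v)
  have wn: "AE z in \<sigma>. ?w z \<bullet> outward_normal \<Omega> z = 0" using v(2) by eventually_elim simp
  have "AE z in \<sigma>. 0 = \<mu> z * normal_deriv \<Omega> \<mu> z" using \<mu>(2) by eventually_elim simp
  from complete_measure.integrable_AE_eq(2)[OF complete_\<sigma> integrable_zero this]
  have lap: "(\<integral>x. lapl \<Omega> \<mu> x * \<mu> x \<partial>lebesgue_on \<Omega>) = - (\<integral>x. grad \<Omega> \<mu> x \<bullet> grad \<Omega> \<mu> x \<partial>lebesgue_on \<Omega>)"
    using green(2)[OF \<mu>(1) \<mu>1] by simp
  have int: "integrable (lebesgue_on \<Omega>) (\<lambda>x. lapl \<Omega> \<mu> x * \<mu> x)"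
    "integrable (lebesgue_on \<Omega>) (\<lambda>x. divg \<Omega> ?w x * \<mu> x)"
    by (intro integrable_domain continuous_on_mult lapl_continuous divg_continuous C1_cl_continuous \<mu> \<mu>1 w)+
  have "(\<integral>x. \<mu> x * d x \<partial>lebesgue_on \<Omega>) / dt = (\<integral>x. \<mu> x * d x / dt \<partial>lebesgue_on \<Omega>)" by simp
  also have "\<dots> = (\<integral>x. M * (lapl \<Omega> \<mu> x * \<mu> x) - divg \<Omega> ?w x * \<mu> x \<partial>lebesgue_on \<Omega>)"
  proof (intro Bochner_Integration.integral_cong refl)
    fix x assume "x \<in> space (lebesgue_on \<Omega>)"
    from eq[OF space_domain(1)[OF this]]
    have "d x / dt = M * lapl \<Omega> \<mu> x - divg \<Omega> ?w x" by simp
    then have "\<mu> x * (d x / dt) = \<mu> x * (M * lapl \<Omega> \<mu> x - divg \<Omega> ?w x)" by simp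
    then show "\<mu> x * d x / dt = M * (lapl \<Omega> \<mu> x * \<mu> x) - divg \<Omega> ?w x * \<mu> x"
      by (simp add: algebra_simps)
  qed
  also have "\<dots> = - M * (\<integral>x. grad \<Omega> \<mu> x \<bullet> grad \<Omega> \<mu> x \<partial>lebesgue_on \<Omega>) - (\<integral>x. divg \<Omega> ?w x * \<mu> x \<partial>lebesgue_on \<Omega>)"
    using int by (simp add: lap)
  also have "(\<integral>x. divg \<Omega> ?w x * \<mu> x \<partial>lebesgue_on \<Omega>) = - (\<integral>x. ?w x \<bullet> grad \<Omega> \<mu> x \<partial>lebesgue_on \<Omega>)"
    using gauss_product_tangential[OF w \<mu>1 wn] by simp
  finally show ?thesis by (simp add: inner_commute)
qed

text \<open>This evaluates the same integral of \<open>\<mu>\<close> against the increment from the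
  other side, through the equation that defines \<open>\<mu>\<close>. The gradient of the mean times
  the gradient of the increment is half a difference of squares. Likewise \<open>\<phi>s\<close>
  times the increment is half of \<open>U1 - U0\<close>, and this times half of
  \<open>U1 + U0\<close> explains the factor \<open>1 / (4 * eps)\<close>.\<close>

lemma potential_balance:
  assumes f: "C2_cl \<Omega> f1" "C2_cl \<Omega> f0" and h: "C2_cl \<Omega> h" "\<And>x. h x = (1/2) * (f1 x + f0 x)"
    and U: "in_L2 (lebesgue_on \<Omega>) U0" "in_L2 (lebesgue_on \<Omega>) U1"
    and eps: "eps > 0"
    and eq: "\<And>x. x \<in> \<Omega> \<Longrightarrow> \<mu> x = lam * (- eps * lapl \<Omega> h x + 1 / eps * \<phi>s x * ((U1 x + U0 x) / 2))"
    and eqU: "\<And>x. x \<in> \<Omega> \<Longrightarrow> U1 x - U0 x = 2 * \<phi>s x * (f1 x - f0 x)"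
  shows "(\<integral>x. \<mu> x * (f1 x - f0 x) \<partial>lebesgue_on \<Omega>) =
    - lam * eps * (\<integral>z. (f1 z - f0 z) * normal_deriv \<Omega> h z \<partial>\<sigma>)
    + lam * eps / 2 * ((\<integral>x. grad \<Omega> f1 x \<bullet> grad \<Omega> f1 x \<partial>lebesgue_on \<Omega>) - (\<integral>x. grad \<Omega> f0 x \<bullet> grad \<Omega> f0 x \<partial>lebesgue_on \<Omega>))
    + lam / (4 * eps) * ((\<integral>x. (U1 x)\<^sup>2 \<partial>lebesgue_on \<Omega>) - (\<integral>x. (U0 x)\<^sup>2 \<partial>lebesgue_on \<Omega>))"
proof -
  note f1 = C2_clD(1)[OF f(1)] C2_clD(1)[OF f(2)]
  define d where "d = (\<lambda>x. f1 x - f0 x)"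
  have deq: "d = (\<lambda>x. f1 x + (-1) * f0 x)" by (simp add: d_def)
  have d: "C1_cl \<Omega> d" unfolding deq by (intro C1_cl_add C1_cl_cmult f1)
  have gd: "grad \<Omega> d x = grad \<Omega> f1 x - grad \<Omega> f0 x" if "x \<in> closure \<Omega>" for x
    unfolding deq using that by (simp only: C1_cl_add(2) C1_cl_cmult f1) simp
  have "h = (\<lambda>x. (1/2) * (f1 x + f0 x))" by (rule ext) (rule h(2))
  then have gh: "grad \<Omega> h x = (1/2) *\<^sub>R (grad \<Omega> f1 x + grad \<Omega> f0 x)" if "x \<in> closure \<Omega>" for x
    using that by (simp only: C1_cl_cmult(2) C1_cl_add f1)
  have iU: "integrable (lebesgue_on \<Omega>) (\<lambda>x. (U1 x)\<^sup>2)" "integrable (lebesgue_on \<Omega>) (\<lambda>x. (U0 x)\<^sup>2)"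
    using U by (simp_all add: in_L2_def)
  have il: "integrable (lebesgue_on \<Omega>) (\<lambda>x. lapl \<Omega> h x * d x)"
    by (intro integrable_domain continuous_on_mult lapl_continuous C1_cl_continuous h d)
  have ig: "integrable (lebesgue_on \<Omega>) (\<lambda>x. grad \<Omega> f1 x \<bullet> grad \<Omega> f1 x)"
    "integrable (lebesgue_on \<Omega>) (\<lambda>x. grad \<Omega> f0 x \<bullet> grad \<Omega> f0 x)"
    by (intro integrable_domain continuous_on_inner C1_cl_grad_continuous f1)+
  have "(\<integral>x. grad \<Omega> h x \<bullet> grad \<Omega> d x \<partial>lebesgue_on \<Omega>) =
      (\<integral>x. (1/2) * (grad \<Omega> f1 x \<bullet> grad \<Omega> f1 x) - (1/2) * (grad \<Omega> f0 x \<bullet> grad \<Omega> f0 x) \<partial>lebesgue_on \<Omega>)"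
    by (intro Bochner_Integration.integral_cong refl)
      (simp add: gh gd space_domain inner_diff_right inner_add_left inner_commute algebra_simps)
  then have G: "(\<integral>x. grad \<Omega> h x \<bullet> grad \<Omega> d x \<partial>lebesgue_on \<Omega>) =
      ((\<integral>x. grad \<Omega> f1 x \<bullet> grad \<Omega> f1 x \<partial>lebesgue_on \<Omega>) - (\<integral>x. grad \<Omega> f0 x \<bullet> grad \<Omega> f0 x \<partial>lebesgue_on \<Omega>)) / 2"
    using ig by (simp add: diff_divide_distrib)
  have "(\<integral>x. \<mu> x * d x \<partial>lebesgue_on \<Omega>) =
      (\<integral>x. (- lam * eps) * (lapl \<Omega> h x * d x) + (lam / (4 * eps)) * ((U1 x)\<^sup>2 - (U0 x)\<^sup>2) \<partial>lebesgue_on \<Omega>)"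
  proof (intro Bochner_Integration.integral_cong refl)
    fix x assume "x \<in> space (lebesgue_on \<Omega>)"
    then have x: "x \<in> \<Omega>" by (rule space_domain)
    \<comment> \<open>\<open>U0\<close> and \<open>U1\<close> are merely square integrable, so the
      product is brought to a difference of squares pointwise, before any integral is split.\<close>
    have "(U1 x)\<^sup>2 - (U0 x)\<^sup>2 = (U1 x - U0 x) * (U1 x + U0 x)"
      by (simp add: power2_eq_square algebra_simps)
    then have "(U1 x)\<^sup>2 - (U0 x)\<^sup>2 = 2 * \<phi>s x * d x * (U1 x + U0 x)"
      using eqU[OF x] by (simp add: d_def)
    then show "\<mu> x * d x = (- lam * eps) * (lapl \<Omega> h x * d x) + (lam / (4 * eps)) * ((U1 x)\<^sup>2 - (U0 x)\<^sup>2)"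
      using eps unfolding eq[OF x] by (simp add: field_simps)
  qed
  also have "\<dots> = (- lam * eps) * (\<integral>x. lapl \<Omega> h x * d x \<partial>lebesgue_on \<Omega>)
      + (lam / (4 * eps)) * ((\<integral>x. (U1 x)\<^sup>2 \<partial>lebesgue_on \<Omega>) - (\<integral>x. (U0 x)\<^sup>2 \<partial>lebesgue_on \<Omega>))"
    using il iU by simp
  finally show ?thesis
    unfolding green(2)[OF h(1) d] G by (simp add: d_def algebra_simps diff_divide_distrib)
qed

text \<open>The projection step says that \<open>wt\<close> is \<open>w1\<close> plus
  \<open>dt / 2\<close> times the gradient of \<open>p1 - p0\<close>. On inserting this, the
  products of the two pressure gradients with each other cancel and the squares with factor
  \<open>dt\<^sup>2 / 8\<close> remain. What else is left pairs \<open>w1\<close> with the gradient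
  of \<open>p1\<close> and \<open>w0\<close> with that of \<open>p0\<close>; both integrate to zero
  since these velocities are solenoidal and tangential.\<close>

lemma projection_balance:
  fixes w1 wt w0 v :: "real^'d \<Rightarrow> real^'d"
  assumes w: "vC1_cl \<Omega> w1" "vC1_cl \<Omega> wt" "vC1_cl \<Omega> w0" and v: "\<And>x. v x = (1/2) *\<^sub>R (wt x + w0 x)"
    and p: "C1_cl \<Omega> p0" "C1_cl \<Omega> p1" and dt: "dt > 0"
    and eq: "\<And>x. x \<in> \<Omega> \<Longrightarrow> (1 / dt) *\<^sub>R (w1 x - wt x) + grad \<Omega> (\<lambda>y. (p1 y - p0 y) / 2) x = 0"
    and div: "\<And>x. x \<in> \<Omega> \<Longrightarrow> divg \<Omega> w1 x = 0" "\<And>x. x \<in> \<Omega> \<Longrightarrow> divg \<Omega> w0 x = 0"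
    and bc: "AE z in \<sigma>. w1 z \<bullet> outward_normal \<Omega> z = 0" "AE z in \<sigma>. w0 z \<bullet> outward_normal \<Omega> z = 0"
  shows "(\<integral>x. wt x \<bullet> wt x \<partial>lebesgue_on \<Omega>) / 2 + dt * (\<integral>x. grad \<Omega> p0 x \<bullet> v x \<partial>lebesgue_on \<Omega>) =
    (\<integral>x. w1 x \<bullet> w1 x \<partial>lebesgue_on \<Omega>) / 2 + dt\<^sup>2 / 8 *
      ((\<integral>x. grad \<Omega> p1 x \<bullet> grad \<Omega> p1 x \<partial>lebesgue_on \<Omega>) - (\<integral>x. grad \<Omega> p0 x \<bullet> grad \<Omega> p0 x \<partial>lebesgue_on \<Omega>))"
proof -
  note cw = w[THEN vC1_cl_continuous] and cp = p[THEN C1_cl_grad_continuous]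
  have int: "integrable (lebesgue_on \<Omega>) (\<lambda>x. f x \<bullet> h x)"
    if "continuous_on (closure \<Omega>) f" "continuous_on (closure \<Omega>) h" for f h :: "real^'d \<Rightarrow> real^'d"
    using that by (intro integrable_domain continuous_on_inner)
  have "v = (\<lambda>x. (1/2) *\<^sub>R (wt x + w0 x))" by (rule ext) (rule v)
  then have cv: "continuous_on (closure \<Omega>) v" by (simp add: continuous_intros cw)
  have pe: "(\<lambda>y. (p1 y - p0 y) / 2) = (\<lambda>y. (1/2) * (p1 y + (-1) * p0 y))" by (simp add: fun_eq_iff)
  have gp: "grad \<Omega> (\<lambda>y. (p1 y - p0 y) / 2) x = (1/2) *\<^sub>R (grad \<Omega> p1 x - grad \<Omega> p0 x)" if "x \<in> closure \<Omega>" for x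
    unfolding pe using that by (simp only: C1_cl_cmult C1_cl_add p) simp
  have pw: "(1/2) * (wt x \<bullet> wt x) + dt * (grad \<Omega> p0 x \<bullet> v x) =
      (1/2) * (w1 x \<bullet> w1 x) + (dt/2) * (w1 x \<bullet> grad \<Omega> p1 x) + (dt/2) * (w0 x \<bullet> grad \<Omega> p0 x)
      + (dt\<^sup>2 / 8) * (grad \<Omega> p1 x \<bullet> grad \<Omega> p1 x) - (dt\<^sup>2 / 8) * (grad \<Omega> p0 x \<bullet> grad \<Omega> p0 x)" if x: "x \<in> \<Omega>" for x
  proof -
    have "dt *\<^sub>R ((1 / dt) *\<^sub>R (w1 x - wt x) + (1/2) *\<^sub>R (grad \<Omega> p1 x - grad \<Omega> p0 x)) = 0"
      using eq[OF x] gp[OF space_domain(2)[OF x]] by simp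
    then have "w1 x - wt x + (dt/2) *\<^sub>R (grad \<Omega> p1 x - grad \<Omega> p0 x) = 0"
      using dt by (simp add: scaleR_add_right)
    then have wt: "wt x = w1 x + (dt/2) *\<^sub>R (grad \<Omega> p1 x - grad \<Omega> p0 x)" by (simp add: algebra_simps)
    show ?thesis
      unfolding v wt
      by (simp add: inner_add_left inner_add_right inner_diff_left inner_diff_right inner_commute
          power2_eq_square field_simps)
  qed
  have "(\<integral>x. (1/2) * (wt x \<bullet> wt x) + dt * (grad \<Omega> p0 x \<bullet> v x) \<partial>lebesgue_on \<Omega>) =
      (\<integral>x. (1/2) * (w1 x \<bullet> w1 x) + (dt/2) * (w1 x \<bullet> grad \<Omega> p1 x) + (dt/2) * (w0 x \<bullet> grad \<Omega> p0 x)
      + (dt\<^sup>2 / 8) * (grad \<Omega> p1 x \<bullet> grad \<Omega> p1 x) - (dt\<^sup>2 / 8) * (grad \<Omega> p0 x \<bullet> grad \<Omega> p0 x) \<partial>lebesgue_on \<Omega>)"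
    by (intro Bochner_Integration.integral_cong refl pw space_domain)
  then show ?thesis
    using int[OF cw(2) cw(2)] int[OF cp(1) cv] int[OF cw(1) cw(1)] int[OF cw(1) cp(2)] int[OF cw(3) cp(1)]
      int[OF cp(1) cp(1)] int[OF cp(2) cp(2)]
      solenoidal_orthogonal_grad[OF w(1) p(2) bc(1) div(1)] solenoidal_orthogonal_grad[OF w(3) p(1) bc(2) div(2)]
    by (simp add: right_diff_distrib)
qed

lemma integrable_frontier_mult:
  fixes f h :: "real^'d \<Rightarrow> real"
  assumes f: "continuous_on (frontier \<Omega>) f" and h: "integrable \<sigma> h"
  shows "integrable \<sigma> (\<lambda>x. f x * h x)"
proof -
  have comp: "compact (frontier \<Omega>)" using bounded_\<Omega> by (simp add: compact_frontier_bounded)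
  have "bounded (f ` frontier \<Omega>)"
    using compact_continuous_image[OF f comp] by (rule compact_imp_bounded)
  then obtain B where B: "\<forall>y\<in>f ` frontier \<Omega>. norm y \<le> B" unfolding bounded_iff by blast
  have ae: "AE x in \<sigma>. norm (f x * h x) \<le> norm (B * h x)"
    using AE_frontier
  proof eventually_elim
    case (elim x)
    then have "\<bar>f x\<bar> \<le> \<bar>B\<bar>" using B by fastforce
    then show ?case by (simp add: abs_mult mult_right_mono)
  qed
  have m: "(\<lambda>x. f x * h x) \<in> borel_measurable \<sigma>"
    using integrable_frontier[OF f] h by (intro borel_measurable_times borel_measurable_integrable)
  show ?thesis
    by (rule Bochner_Integration.integrable_bound[OF integrable_mult_right[OF h, of B] m ae])
qed

text \<open>On a surface of finite area square integrability implies integrability, by the bound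
  \<open>t \<le> 1 + t\<^sup>2\<close>.\<close>

lemma in_L2_component:
  fixes w :: "real^'d \<Rightarrow> real^'d"
  assumes w: "in_L2 \<sigma> w"
  shows "integrable \<sigma> (\<lambda>x. w x $ i)" "integrable \<sigma> (\<lambda>x. w x \<bullet> w x)"
proof -
  show ww: "integrable \<sigma> (\<lambda>x. w x \<bullet> w x)" using w by (simp add: in_L2_def power2_norm_eq_inner)
  have one: "integrable \<sigma> (\<lambda>x. 1 :: real)"
    using finite_measure.integrable_const[OF finite_\<sigma>] by blast
  have wm: "w \<in> borel_measurable \<sigma>" using w by (simp add: in_L2_def)
  have m: "(\<lambda>x. w x $ i) \<in> borel_measurable \<sigma>"
    unfolding cart_eq_inner_axis by (intro borel_measurable_inner wm borel_measurable_const)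
  show "integrable \<sigma> (\<lambda>x. w x $ i)"
  proof (rule Bochner_Integration.integrable_bound[OF Bochner_Integration.integrable_add[OF one ww] m], rule AE_I2)
    fix x
    have "\<bar>w x $ i\<bar> \<le> norm (w x)" by (rule component_le_norm_cart)
    also have "\<dots> \<le> 1 + (norm (w x))\<^sup>2"
    proof -
      have "0 \<le> (norm (w x) - 1)\<^sup>2 + norm (w x)" by (rule add_nonneg_nonneg) auto
      then show ?thesis by (simp add: power2_diff)
    qed
    finally show "norm (w x $ i) \<le> norm (1 + w x \<bullet> w x)" by (simp add: power2_norm_eq_inner)
  qed
qed

text \<open>
  The term of the slip condition with \<open>\<nabla>\<^sub>\<tau> \<phi>\<^sub>\<star>\<close> supplies the transport part of \<open>\<phi>dot\<close> that is missing in
  the increment of \<open>\<phi>\<close>, so that the dissipation becomes the square of \<open>\<phi>dot\<close>.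
\<close>

lemma boundary_balance:
  fixes v uw :: "real^'d \<Rightarrow> real^'d" and \<phi>dot l :: "real^'d \<Rightarrow> real"
  assumes pos: "gam > 0" "dt > 0"
    and v: "vC2_cl \<Omega> v" "AE z in \<sigma>. v z \<bullet> outward_normal \<Omega> z = 0"
    and \<phi>s: "C1_cl \<Omega> \<phi>s" and h: "C2_cl \<Omega> h" and d: "C1_cl \<Omega> d"
    and \<phi>dot: "\<And>z. \<phi>dot z = d z / dt + tangential \<Omega> z (v z) \<bullet> tgrad \<Omega> \<phi>s z"
    and l: "continuous_on (frontier \<Omega>) l" and uw: "in_L2 \<sigma> uw" and W: "in_L2 \<sigma> W0" "in_L2 \<sigma> W1"
    and slip: "AE z in \<sigma>. nu *\<^sub>R tangential \<Omega> z (normal_deriv \<Omega> v z)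
                   = - (nu * l z) *\<^sub>R (v z - uw z) - (lam / gam * \<phi>dot z) *\<^sub>R tgrad \<Omega> \<phi>s z"
    and bc: "AE z in \<sigma>. eps * normal_deriv \<Omega> h z = - (1 / gam) * \<phi>dot z - Z z * ((W1 z + W0 z) / 2)"
    and bW: "AE z in \<sigma>. W1 z - W0 z = 1 / 2 * Z z * d z"
  shows "lam * eps * (\<integral>z. d z * normal_deriv \<Omega> h z \<partial>\<sigma>) + dt * nu * (\<integral>z. v z \<bullet> normal_deriv \<Omega> v z \<partial>\<sigma>) =
    - (lam * dt / gam) * (\<integral>z. (\<phi>dot z)\<^sup>2 \<partial>\<sigma>) - lam * ((\<integral>z. (W1 z)\<^sup>2 \<partial>\<sigma>) - (\<integral>z. (W0 z)\<^sup>2 \<partial>\<sigma>))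
    - dt * nu * (\<integral>z. l z * ((v z - uw z) \<bullet> (v z - uw z)) \<partial>\<sigma>)
    - dt * nu * (\<integral>z. l z * ((v z - uw z) \<bullet> uw z) \<partial>\<sigma>)"
proof -
  have sub: "frontier \<Omega> \<subseteq> closure \<Omega>" by (simp add: frontier_def)
  \<comment> \<open>As \<open>v\<close> is tangential, both tangential products reduce to this one.
    It is continuous on the closure, which gives the integrability of the square of
    \<open>\<phi>dot\<close>.\<close>
  define S where "S = (\<lambda>z. v z \<bullet> grad \<Omega> \<phi>s z)"
  have tan: "AE z in \<sigma>. tangential \<Omega> z (v z) \<bullet> tgrad \<Omega> \<phi>s z = S z \<and> tgrad \<Omega> \<phi>s z \<bullet> v z = S z"
    using v(2) by eventually_elim
      (simp add: tangential_def tgrad_def S_def inner_diff_right inner_diff_left inner_commute)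
  have Sc: "continuous_on (closure \<Omega>) S"
    unfolding S_def by (intro continuous_on_inner vC1_cl_continuous vC2_cl_imp_vC1_cl v C1_cl_grad_continuous \<phi>s)
  have dS: "AE z in \<sigma>. (d z / dt + S z)\<^sup>2 = (\<phi>dot z)\<^sup>2"
    using tan by eventually_elim (simp add: \<phi>dot)
  have "integrable \<sigma> (\<lambda>z. (d z / dt + S z)\<^sup>2)"
    using pos by (intro integrable_frontier continuous_on_subset[OF _ sub] continuous_intros Sc C1_cl_continuous d) auto
  from complete_measure.integrable_AE_eq(1)[OF complete_\<sigma> this dS]
  have i1: "integrable \<sigma> (\<lambda>z. (\<phi>dot z)\<^sup>2)" .
  have iW: "integrable \<sigma> (\<lambda>z. (W1 z)\<^sup>2)" "integrable \<sigma> (\<lambda>z. (W0 z)\<^sup>2)"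
    using W by (simp_all add: in_L2_def)
  have vc: "continuous_on (frontier \<Omega>) v"
    by (intro continuous_on_subset[OF _ sub] vC1_cl_continuous vC2_cl_imp_vC1_cl v)
  have vv: "integrable \<sigma> (\<lambda>z. v z \<bullet> v z)"
    by (intro integrable_frontier continuous_on_inner vc)
  \<comment> \<open>The wall velocity is only square integrable, so the product is taken by
    components, each continuous times integrable.\<close>
  have vw: "integrable \<sigma> (\<lambda>z. v z \<bullet> uw z)"
    unfolding inner_vec_def inner_real_def
    by (intro Bochner_Integration.integrable_sum integrable_frontier_mult in_L2_component uw
        continuous_on_component vc)
  note ww = in_L2_component(2)[OF uw]
  have i2: "integrable \<sigma> (\<lambda>z. l z * ((v z - uw z) \<bullet> (v z - uw z)))"
    unfolding inner_diff_left inner_diff_right inner_commute[of "uw _" "v _"]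
    by (intro integrable_frontier_mult[OF l] Bochner_Integration.integrable_diff vv vw ww)
  have i3: "integrable \<sigma> (\<lambda>z. l z * ((v z - uw z) \<bullet> uw z))"
    unfolding inner_diff_left
    by (intro integrable_frontier_mult[OF l] Bochner_Integration.integrable_diff vw ww)
  define R where "R = (\<lambda>z. - (lam * dt / gam) * (\<phi>dot z)\<^sup>2 - lam * ((W1 z)\<^sup>2 - (W0 z)\<^sup>2)
    - dt * nu * (l z * ((v z - uw z) \<bullet> (v z - uw z))) - dt * nu * (l z * ((v z - uw z) \<bullet> uw z)))"
  have iR: "integrable \<sigma> R" unfolding R_def using i1 iW i2 i3 by simp
  have ae: "AE z in \<sigma>. R z = lam * eps * (d z * normal_deriv \<Omega> h z) + dt * nu * (v z \<bullet> normal_deriv \<Omega> v z)"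
    using tan v(2) slip bc bW
  proof eventually_elim
    case (elim z)
    \<comment> \<open>Solving for the increment exposes the mixed product
      \<open>\<phi>dot z * S z\<close>, which the term with \<open>tgrad\<close> in the slip
      condition cancels below.\<close>
    have dz: "d z = dt * (\<phi>dot z - S z)" using pos elim(1) by (simp add: \<phi>dot)
    have "(W1 z)\<^sup>2 - (W0 z)\<^sup>2 = (W1 z - W0 z) * (W1 z + W0 z)"
      by (simp add: power2_eq_square algebra_simps)
    also have "\<dots> = Z z * ((W1 z + W0 z) / 2) * d z" unfolding elim(5) by simp
    finally have Wz: "Z z * ((W1 z + W0 z) / 2) * d z = (W1 z)\<^sup>2 - (W0 z)\<^sup>2" ..
    have "eps * normal_deriv \<Omega> h z * d z = - (1 / gam) * \<phi>dot z * d z - Z z * ((W1 z + W0 z) / 2) * d z"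
      unfolding elim(4) by (simp only: left_diff_distrib)
    then have 1: "eps * (d z * normal_deriv \<Omega> h z) = - (dt / gam) * (\<phi>dot z * (\<phi>dot z - S z)) - ((W1 z)\<^sup>2 - (W0 z)\<^sup>2)"
      unfolding Wz by (simp add: dz mult.commute mult.left_commute)
    have "v z \<bullet> normal_deriv \<Omega> v z = tangential \<Omega> z (normal_deriv \<Omega> v z) \<bullet> v z"
      using elim(2) by (simp add: tangential_def inner_diff_left inner_diff_right inner_commute)
    then have "nu * (v z \<bullet> normal_deriv \<Omega> v z) = (nu *\<^sub>R tangential \<Omega> z (normal_deriv \<Omega> v z)) \<bullet> v z"
      by simp
    also have "\<dots> = - (nu * l z) * ((v z - uw z) \<bullet> v z) - (lam / gam * \<phi>dot z) * S z"
      unfolding elim(3) inner_diff_left[of "_ *\<^sub>R _"] inner_scaleR_left using elim(1) by simp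
    \<comment> \<open>Writing \<open>v\<close> as slip plus wall velocity separates the friction
      into the square of the slip and the work done at the wall.\<close>
    also have "(v z - uw z) \<bullet> v z = (v z - uw z) \<bullet> (v z - uw z) + (v z - uw z) \<bullet> uw z"
      by (simp add: inner_add_right[symmetric])
    finally have 2: "nu * (v z \<bullet> normal_deriv \<Omega> v z) =
      - (nu * l z) * ((v z - uw z) \<bullet> (v z - uw z) + (v z - uw z) \<bullet> uw z) - (lam / gam * \<phi>dot z) * S z" .
    have "lam * eps * (d z * normal_deriv \<Omega> h z) + dt * nu * (v z \<bullet> normal_deriv \<Omega> v z) =
      lam * (eps * (d z * normal_deriv \<Omega> h z)) + dt * (nu * (v z \<bullet> normal_deriv \<Omega> v z))"
      by simp
    also have "\<dots> = R z"
      unfolding 1 2 R_def by (simp add: power2_eq_square algebra_simps)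
    finally show ?case ..
  qed
  note X = green(1)[OF h d] green_vector(1)[OF v(1)]
  have "lam * eps * (\<integral>z. d z * normal_deriv \<Omega> h z \<partial>\<sigma>) + dt * nu * (\<integral>z. v z \<bullet> normal_deriv \<Omega> v z \<partial>\<sigma>) =
    (\<integral>z. lam * eps * (d z * normal_deriv \<Omega> h z) + dt * nu * (v z \<bullet> normal_deriv \<Omega> v z) \<partial>\<sigma>)"
    using X by simp
  also have "\<dots> = integral\<^sup>L \<sigma> R"
    by (rule complete_measure.integrable_AE_eq(2)[OF complete_\<sigma> iR ae])
  also have "\<dots> = - (lam * dt / gam) * (\<integral>z. (\<phi>dot z)\<^sup>2 \<partial>\<sigma>) - lam * ((\<integral>z. (W1 z)\<^sup>2 \<partial>\<sigma>) - (\<integral>z. (W0 z)\<^sup>2 \<partial>\<sigma>))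
    - dt * nu * (\<integral>z. l z * ((v z - uw z) \<bullet> (v z - uw z)) \<partial>\<sigma>)
    - dt * nu * (\<integral>z. l z * ((v z - uw z) \<bullet> uw z) \<partial>\<sigma>)"
    unfolding R_def using i1 iW i2 i3 by simp
  finally show ?thesis .
qed

section \<open>Assembly of the energy law\<close>

lemma energy_eq:
  assumes u: "vC1_cl \<Omega> u" and \<phi>: "C1_cl \<Omega> \<phi>" and U: "in_L2 (lebesgue_on \<Omega>) U"
  shows "energy_cn \<Omega> \<sigma> lam eps C dt u \<phi> p U W =
    (\<integral>x. u x \<bullet> u x \<partial>lebesgue_on \<Omega>) / 2 + lam * eps / 2 * (\<integral>x. grad \<Omega> \<phi> x \<bullet> grad \<Omega> \<phi> x \<partial>lebesgue_on \<Omega>)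
    + lam / (4 * eps) * (\<integral>x. (U x)\<^sup>2 \<partial>lebesgue_on \<Omega>) + lam * (\<integral>x. (W x)\<^sup>2 \<partial>\<sigma>) - lam * C * measure \<sigma> (frontier \<Omega>)
    + dt\<^sup>2 / 8 * (\<integral>x. grad \<Omega> p x \<bullet> grad \<Omega> p x \<partial>lebesgue_on \<Omega>)"
proof -
  have i: "integrable (lebesgue_on \<Omega>) (\<lambda>x. u x \<bullet> u x)" "integrable (lebesgue_on \<Omega>) (\<lambda>x. grad \<Omega> \<phi> x \<bullet> grad \<Omega> \<phi> x)"
    by (intro integrable_domain continuous_on_inner vC1_cl_continuous C1_cl_grad_continuous u \<phi>)+
  have iU: "integrable (lebesgue_on \<Omega>) (\<lambda>x. (U x)\<^sup>2)" using U by (simp add: in_L2_def)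
  have "(\<integral>x. (1/2) * (norm (u x))\<^sup>2
          + lam * (eps / 2 * (norm (grad \<Omega> \<phi> x))\<^sup>2 + 1 / (4 * eps) * (U x)\<^sup>2) \<partial>lebesgue_on \<Omega>) =
    (\<integral>x. (1/2) * (u x \<bullet> u x) + lam * eps / 2 * (grad \<Omega> \<phi> x \<bullet> grad \<Omega> \<phi> x) + lam / (4 * eps) * (U x)\<^sup>2 \<partial>lebesgue_on \<Omega>)"
    by (simp add: power2_norm_eq_inner distrib_left mult.assoc add.assoc)
  also have "\<dots> = (\<integral>x. u x \<bullet> u x \<partial>lebesgue_on \<Omega>) / 2 + lam * eps / 2 * (\<integral>x. grad \<Omega> \<phi> x \<bullet> grad \<Omega> \<phi> x \<partial>lebesgue_on \<Omega>)
    + lam / (4 * eps) * (\<integral>x. (U x)\<^sup>2 \<partial>lebesgue_on \<Omega>)"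
    using i iU by simp
  finally show ?thesis unfolding energy_cn_def energy_def l2_norm_squared by simp
qed

end

theorem theorem3p2:
  fixes \<Omega> :: "(real^'d) set" and \<sigma> :: "(real^'d) measure"
    and M lam eps nu gam C \<theta>s dt :: real
    and ell :: "real \<Rightarrow> real"
    and uw ut :: "real^'d \<Rightarrow> real^'d"
    and \<mu> :: "real^'d \<Rightarrow> real"
    and \<phi> p U W :: "nat \<Rightarrow> real^'d \<Rightarrow> real"
    and u :: "nat \<Rightarrow> real^'d \<Rightarrow> real^'d"
    and n :: nat
  defines "\<phi>h \<equiv> mid (\<phi> (n+1)) (\<phi> n)"
    and "Uh \<equiv> mid (U (n+1)) (U n)"
    and "Wh \<equiv> mid (W (n+1)) (W n)"
    and "uth \<equiv> mid ut (u n)"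
    and "\<phi>s \<equiv> extrap \<phi> n"
    and "us \<equiv> extrap u n"
  defines "\<phi>dot \<equiv> \<lambda>x. (\<phi> (n+1) x - \<phi> n x) / dt + tangential \<Omega> x (uth x) \<bullet> tgrad \<Omega> \<phi>s x"
    and "slip \<equiv> \<lambda>x. uth x - uw x"
  assumes dim: "CARD('d) = 2 \<or> CARD('d) = 3"
    and domain: "bounded_lipschitz_domain \<Omega>"
    and surface: "is_surface_measure \<Omega> \<sigma>"
    and params: "M > 0" "lam > 0" "eps > 0" "nu > 0" "gam > 0" "dt > 0"
    and C: "\<forall>s. Gw \<theta>s s + C > 0"
    and ell: "continuous_on UNIV ell" "\<forall>s. ell s \<ge> 0"
    and n: "n \<ge> 1"
    \<comment> \<open>regularity\<close>
    and reg_phi: "C2_cl \<Omega> (\<phi> (n+1))" "C2_cl \<Omega> (\<phi> n)" "C1_cl \<Omega> (\<phi> (n-1))"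
    and reg_mu: "C2_cl \<Omega> \<mu>"
    and reg_u: "vC2_cl \<Omega> ut" "vC2_cl \<Omega> (u n)" "vC1_cl \<Omega> (u (n-1))" "vC1_cl \<Omega> (u (n+1))"
    and reg_p: "C1_cl \<Omega> (p n)" "C1_cl \<Omega> (p (n+1))"
    and reg_U: "in_L2 (lebesgue_on \<Omega>) (U n)" "in_L2 (lebesgue_on \<Omega>) (U (n+1))"
    and reg_W: "in_L2 \<sigma> (W n)" "in_L2 \<sigma> (W (n+1))"
    and reg_uw: "in_L2 \<sigma> uw"
    \<comment> \<open>previous velocities\<close>
    and prev_div: "\<forall>k\<in>{n-1, n}. \<forall>x\<in>\<Omega>. divg \<Omega> (u k) x = 0"
    and prev_bdry: "\<forall>k\<in>{n-1, n}. AE x in \<sigma>. u k x \<bullet> outward_normal \<Omega> x = 0"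
    \<comment> \<open>Step 1, in the domain\<close>
    and eq_phi: "\<forall>x\<in>\<Omega>. (\<phi> (n+1) x - \<phi> n x) / dt + divg \<Omega> (\<lambda>y. \<phi>s y *\<^sub>R uth y) x
                   = M * lapl \<Omega> \<mu> x"
    and eq_mu: "\<forall>x\<in>\<Omega>. \<mu> x = lam * (- eps * lapl \<Omega> \<phi>h x + 1 / eps * \<phi>s x * Uh x)"
    and eq_U: "\<forall>x\<in>\<Omega>. U (n+1) x - U n x = 2 * \<phi>s x * (\<phi> (n+1) x - \<phi> n x)"
    and eq_ut: "\<forall>x\<in>\<Omega>. (1 / dt) *\<^sub>R (ut x - u n x) + Bform \<Omega> us uth x - nu *\<^sub>R vlapl \<Omega> uth x
                   + grad \<Omega> (p n) x + \<phi>s x *\<^sub>R grad \<Omega> \<mu> x = 0"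
    \<comment> \<open>Step 1, on the boundary\<close>
    and bc_ut: "AE x in \<sigma>. ut x \<bullet> outward_normal \<Omega> x = 0"
    and bc_slip: "AE x in \<sigma>. nu *\<^sub>R tangential \<Omega> x (normal_deriv \<Omega> uth x)
                   = - (nu * ell (\<phi>s x)) *\<^sub>R (uth x - uw x)
                     - (lam / gam * \<phi>dot x) *\<^sub>R tgrad \<Omega> \<phi>s x"
    and bc_mu: "AE x in \<sigma>. normal_deriv \<Omega> \<mu> x = 0"
    and bc_phi: "AE x in \<sigma>. eps * normal_deriv \<Omega> \<phi>h x
                   = - (1 / gam) * \<phi>dot x - Zw \<theta>s C (\<phi>s x) * Wh x"
    and bc_W: "AE x in \<sigma>. W (n+1) x - W n x
                   = 1 / 2 * Zw \<theta>s C (\<phi>s x) * (\<phi> (n+1) x - \<phi> n x)"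
    \<comment> \<open>Step 2\<close>
    and eq_proj: "\<forall>x\<in>\<Omega>. (1 / dt) *\<^sub>R (u (n+1) x - ut x)
                   + grad \<Omega> (\<lambda>y. (p (n+1) y - p n y) / 2) x = 0"
    and eq_div: "\<forall>x\<in>\<Omega>. divg \<Omega> (u (n+1)) x = 0"
    and bc_proj: "AE x in \<sigma>. u (n+1) x \<bullet> outward_normal \<Omega> x = 0"
  shows "energy_cn \<Omega> \<sigma> lam eps C dt (u (n+1)) (\<phi> (n+1)) (p (n+1)) (U (n+1)) (W (n+1))
       = energy_cn \<Omega> \<sigma> lam eps C dt (u n) (\<phi> n) (p n) (U n) (W n)
         - M * dt * (l2_norm (lebesgue_on \<Omega>) (grad \<Omega> \<mu>))\<^sup>2
         - nu * dt * (l2_norm (lebesgue_on \<Omega>) (vgrad \<Omega> uth))\<^sup>2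
         - lam * dt / gam * (l2_norm \<sigma> \<phi>dot)\<^sup>2
         - nu * dt * (l2_norm \<sigma> (\<lambda>x. sqrt (ell (\<phi>s x)) *\<^sub>R slip x))\<^sup>2
         - nu * dt * l2_inner \<sigma> (\<lambda>x. ell (\<phi>s x) *\<^sub>R slip x) uw"
proof -
  interpret lipschitz_surface \<Omega> \<sigma>
    by unfold_locales (fact domain, fact surface)
  have dt: "dt > 0" and gam: "gam > 0" and eps: "eps > 0" using params by auto
  have \<phi>h_eq: "\<phi>h x = (1/2) * (\<phi> (n+1) x + \<phi> n x)" for x by (simp add: \<phi>h_def mid_def)
  have uth_eq: "uth x = (1/2) *\<^sub>R (ut x + u n x)" for x by (simp add: uth_def mid_def)
  have \<phi>s_eq: "\<phi>s = (\<lambda>x. (3/2) * \<phi> n x + (- 1/2) * \<phi> (n-1) x)"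
    by (simp add: \<phi>s_def extrap_def fun_eq_iff)
  have us_eq: "us = (\<lambda>x. (3/2) *\<^sub>R u n x + (- 1/2) *\<^sub>R u (n-1) x)"
    by (simp add: us_def extrap_def fun_eq_iff)
  let ?d = "\<lambda>x. \<phi> (n+1) x - \<phi> n x"
  have d_eq: "?d = (\<lambda>x. \<phi> (n+1) x + (-1) * \<phi> n x)" by simp
  note \<phi>1 = C2_clD(1)[OF reg_phi(1)] C2_clD(1)[OF reg_phi(2)]
  note u1 = vC2_cl_imp_vC1_cl[OF reg_u(1)] vC2_cl_imp_vC1_cl[OF reg_u(2)]
  have d: "C1_cl \<Omega> ?d" unfolding d_eq by (intro C1_cl_add C1_cl_cmult \<phi>1)
  have \<phi>h: "C2_cl \<Omega> \<phi>h"
    using C2_cl_cmult[OF C2_cl_add[OF reg_phi(1,2)], of "1/2"] by (simp add: \<phi>h_eq[abs_def])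
  have uth: "vC2_cl \<Omega> uth"
    using vC2_cl_cmult[OF vC2_cl_add[OF reg_u(1,2)], of "1/2"] by (simp add: uth_eq[abs_def])
  have \<phi>s: "C1_cl \<Omega> \<phi>s" unfolding \<phi>s_eq by (intro C1_cl_add C1_cl_cmult \<phi>1 reg_phi)
  have us: "vC1_cl \<Omega> us"
    unfolding us_eq by (intro vC1_cl_add vC1_cl_scaleR C1_cl_const u1 reg_u)
  have bu: "AE x in \<sigma>. u n x \<bullet> outward_normal \<Omega> x = 0" "AE x in \<sigma>. u (n-1) x \<bullet> outward_normal \<Omega> x = 0"
    using prev_bdry by auto
  have bus: "AE x in \<sigma>. us x \<bullet> outward_normal \<Omega> x = 0"
    using bu by eventually_elim (simp add: us_eq inner_add_left inner_diff_left)
  have buth: "AE x in \<sigma>. uth x \<bullet> outward_normal \<Omega> x = 0"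
    using bc_ut bu(1) by eventually_elim (simp add: uth_eq inner_add_left)
  have c\<phi>s: "continuous_on (frontier \<Omega>) \<phi>s"
    using continuous_on_subset[OF C1_cl_continuous[OF \<phi>s], of "frontier \<Omega>"] by (simp add: frontier_def)
  have l: "continuous_on (frontier \<Omega>) (\<lambda>x. ell (\<phi>s x))"
    by (rule continuous_on_compose2[OF ell(1) c\<phi>s]) simp
  have r2: "continuous_on (closure \<Omega>) (\<lambda>x. \<phi>s x *\<^sub>R grad \<Omega> \<mu> x)"
    by (intro continuous_on_scaleR C1_cl_continuous C1_cl_grad_continuous \<phi>s C2_clD(1)[OF reg_mu])
  let ?I = "\<lambda>f. integral\<^sup>L (lebesgue_on \<Omega>) f"
  \<comment> \<open>The fields \<open>r\<close> and \<open>s\<close> of the balance are the old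
    pressure gradient and \<open>\<phi>s\<close> times the gradient of \<open>\<mu>\<close>.\<close>
  have mom: "(?I (\<lambda>x. ut x \<bullet> ut x) - ?I (\<lambda>x. u n x \<bullet> u n x)) / (2 * dt) =
      nu * ((\<integral>z. uth z \<bullet> normal_deriv \<Omega> uth z \<partial>\<sigma>) - ?I (\<lambda>x. vgrad \<Omega> uth x \<bullet> vgrad \<Omega> uth x))
      - ?I (\<lambda>x. grad \<Omega> (p n) x \<bullet> uth x) - ?I (\<lambda>x. (\<phi>s x *\<^sub>R grad \<Omega> \<mu> x) \<bullet> uth x)"
    by (rule momentum_balance[OF u1 uth uth_eq us bus C1_cl_grad_continuous[OF reg_p(1)] r2])
      (rule eq_ut[rule_format])
  have ph: "?I (\<lambda>x. \<mu> x * ?d x) / dt = ?I (\<lambda>x. (\<phi>s x *\<^sub>R grad \<Omega> \<mu> x) \<bullet> uth x) - M * ?I (\<lambda>x. grad \<Omega> \<mu> x \<bullet> grad \<Omega> \<mu> x)"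
    by (rule phase_balance[OF \<phi>s d vC2_cl_imp_vC1_cl[OF uth] buth reg_mu bc_mu])
      (rule eq_phi[rule_format])
  have Uh: "Uh x = (U (n+1) x + U n x) / 2" for x by (simp add: Uh_def mid_def)
  have pot: "?I (\<lambda>x. \<mu> x * ?d x) =
    - lam * eps * (\<integral>z. ?d z * normal_deriv \<Omega> \<phi>h z \<partial>\<sigma>)
    + lam * eps / 2 * (?I (\<lambda>x. grad \<Omega> (\<phi> (n+1)) x \<bullet> grad \<Omega> (\<phi> (n+1)) x) - ?I (\<lambda>x. grad \<Omega> (\<phi> n) x \<bullet> grad \<Omega> (\<phi> n) x))
    + lam / (4 * eps) * (?I (\<lambda>x. (U (n+1) x)\<^sup>2) - ?I (\<lambda>x. (U n x)\<^sup>2))"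
    by (rule potential_balance[OF reg_phi(1,2) \<phi>h \<phi>h_eq reg_U eps])
      (rule eq_mu[rule_format, unfolded Uh], assumption, rule eq_U[rule_format])
  have proj: "?I (\<lambda>x. ut x \<bullet> ut x) / 2 + dt * ?I (\<lambda>x. grad \<Omega> (p n) x \<bullet> uth x) =
    ?I (\<lambda>x. u (n+1) x \<bullet> u (n+1) x) / 2 + dt\<^sup>2 / 8 *
      (?I (\<lambda>x. grad \<Omega> (p (n+1)) x \<bullet> grad \<Omega> (p (n+1)) x) - ?I (\<lambda>x. grad \<Omega> (p n) x \<bullet> grad \<Omega> (p n) x))"
    by (rule projection_balance[OF reg_u(4) u1 uth_eq reg_p dt eq_proj[rule_format] eq_div[rule_format] _ bc_proj bu(1)])
      (use prev_div in auto)
  have Wh: "Wh x = (W (n+1) x + W n x) / 2" for x by (simp add: Wh_def mid_def)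
  have bd: "lam * eps * (\<integral>z. ?d z * normal_deriv \<Omega> \<phi>h z \<partial>\<sigma>) + dt * nu * (\<integral>z. uth z \<bullet> normal_deriv \<Omega> uth z \<partial>\<sigma>) =
    - (lam * dt / gam) * (\<integral>z. (\<phi>dot z)\<^sup>2 \<partial>\<sigma>) - lam * ((\<integral>z. (W (n+1) z)\<^sup>2 \<partial>\<sigma>) - (\<integral>z. (W n z)\<^sup>2 \<partial>\<sigma>))
    - dt * nu * (\<integral>z. ell (\<phi>s z) * ((uth z - uw z) \<bullet> (uth z - uw z)) \<partial>\<sigma>)
    - dt * nu * (\<integral>z. ell (\<phi>s z) * ((uth z - uw z) \<bullet> uw z) \<partial>\<sigma>)"
    by (rule boundary_balance[OF gam dt uth buth \<phi>s \<phi>h d _ l reg_uw reg_W bc_slip bc_phi[unfolded Wh] bc_W])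
      (simp add: \<phi>dot_def)
  have slip_norm: "(l2_norm \<sigma> (\<lambda>x. sqrt (ell (\<phi>s x)) *\<^sub>R slip x))\<^sup>2 =
      (\<integral>z. ell (\<phi>s z) * ((uth z - uw z) \<bullet> (uth z - uw z)) \<partial>\<sigma>)"
    using ell(2) by (simp add: l2_norm_squared slip_def mult.assoc[symmetric])
  have slip_inner: "l2_inner \<sigma> (\<lambda>x. ell (\<phi>s x) *\<^sub>R slip x) uw =
      (\<integral>z. ell (\<phi>s z) * ((uth z - uw z) \<bullet> uw z) \<partial>\<sigma>)"
    by (simp add: l2_inner_def slip_def)
  have dot_norm: "(l2_norm \<sigma> \<phi>dot)\<^sup>2 = (\<integral>z. (\<phi>dot z)\<^sup>2 \<partial>\<sigma>)"
    unfolding l2_norm_squared by (simp add: power2_eq_square)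
  have mom': "(?I (\<lambda>x. ut x \<bullet> ut x) - ?I (\<lambda>x. u n x \<bullet> u n x)) / 2 =
      dt * (nu * ((\<integral>z. uth z \<bullet> normal_deriv \<Omega> uth z \<partial>\<sigma>) - ?I (\<lambda>x. vgrad \<Omega> uth x \<bullet> vgrad \<Omega> uth x))
      - ?I (\<lambda>x. grad \<Omega> (p n) x \<bullet> uth x) - ?I (\<lambda>x. (\<phi>s x *\<^sub>R grad \<Omega> \<mu> x) \<bullet> uth x))"
    unfolding mom[symmetric] using dt by simp
  have ph': "?I (\<lambda>x. \<mu> x * ?d x) =
      dt * (?I (\<lambda>x. (\<phi>s x *\<^sub>R grad \<Omega> \<mu> x) \<bullet> uth x) - M * ?I (\<lambda>x. grad \<Omega> \<mu> x \<bullet> grad \<Omega> \<mu> x))"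
    unfolding ph[symmetric] using dt by simp
  \<comment> \<open>Elimination among five equations linear in the integrals. What drops out are the
    square \<open>aa\<close> of the intermediate velocity, the potential term \<open>m\<close>, the
    works \<open>PP\<close> of the pressure and \<open>Q\<close> of the capillary force, and the
    boundary terms \<open>Bf\<close> and \<open>Bv\<close>. Stated over plain reals, each integral
    remains a single atom.\<close>
  have arith: "a1 / 2 + le / 2 * F1 + lf * V1 + lam * Y1 - K + q * P1 =
      a0 / 2 + le / 2 * F0 + lf * V0 + lam * Y0 - K + q * P0 - M * dt * Gm - nu * dt * Gv - c * D - nu * dt * s - nu * dt * t"
    if "(aa - a0) / 2 = dt * (nu * (Bv - Gv) - PP - Q)" "m = dt * (Q - M * Gm)"
      "m = - (le * Bf) + le / 2 * (F1 - F0) + lf * (V1 - V0)"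
      "aa / 2 + dt * PP = a1 / 2 + q * (P1 - P0)"
      "le * Bf + dt * nu * Bv = - c * D - lam * (Y1 - Y0) - dt * nu * s - dt * nu * t"
    for a1 le F1 lf V1 Y1 K q P1 a0 F0 V0 Y0 P0 Gm Gv c D s t aa Bv PP Q m Bf :: real
    using that by (simp add: algebra_simps add_divide_distrib diff_divide_distrib)
  show ?thesis
    unfolding energy_eq[OF reg_u(4) \<phi>1(1) reg_U(2)] energy_eq[OF u1(2) \<phi>1(2) reg_U(1)]
      slip_norm slip_inner dot_norm l2_norm_squared[of "lebesgue_on \<Omega>"]
    by (rule arith[OF mom' ph' pot[unfolded mult_minus_left] proj bd])
qed

end
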